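(* Let $f\in\Delta(\mathcal{G})$. Then for any probabilistic graph $(G,P)$ (i.e. $G$ a nonempty graph and $P\in\mathcal{P}(V(G))$) the limit \[ f(G,P):=\lim_{\epsilon\to 0}\limsup_{n\to\infty}\sqrt[n]{f\big(G^{\boxtimes n}[T^n_{B_\epsilon(P)}]\big)} \] exists. Let $F(G,P)=\log f(G,P)$, viewed as a function $F:\mathcal{G}_{\mathrm{prob}}\to\mathbb{R}$. Then $F$ satisfies: (P1) for every nonempty graph $G$ the map $P\mapsto F(G,P)$ is concave on $\mathcal{P}(V(G))$; (P2) for nonempty graphs $G,H$ and $P\in\mathcal{P}(V(G)\times V(H))$ with marginals $P_G$ on $V(G)$ and $P_H$ on $V(H)$, \[F(G\boxtimes H,P)\le F(G,P_G)+F(H,P_H)\le F(G\boxtimes H,P)+I(G:H)_P,\] where $I(G:H)_P=H(P_G)+H(P_H)-H(P)$; (P3) for nonempty graphs $G,H$, $P_G\in\mathcal{P}(V(G))$, $P_H\in\mathcal{P}(V(H))$ and $p\in[0,1]$, \[F(G\sqcup H,pP_G\oplus(1-p)P_H)=pF(G,P_G)+(1-p)F(H,P_H)+h(p);\] (P4) if $\varphi:\overline{H}\to\overline{G}$ is a graph homomorphism and $P\in\mathcal{P}(V(H))$, then $F(H,P)\le F(G,\varphi_*(P))$. Moreover, for every nonempty graph $G$, $f(G)=\max_{P\in\mathcal{P}(V(G))}f(G,P)$.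
   Context: All graphs are finite simple undirected graphs. $\overline{G}$ denotes the complement of $G$; $G\sqcup H$ the disjoint union; $G\boxtimes H$ the strong product (vertex set $V(G)\times V(H)$, distinct $(g,h),(g',h')$ adjacent iff ($g=g'$ or $\{g,g'\}\in E(G)$) and ($h=h'$ or $\{h,h'\}\in E(H)$)); $G^{\boxtimes n}$ the $n$-fold strong power; $G[S]$ the induced subgraph on $S\subseteq V(G)$; $K_1$ the one-vertex graph. $\mathcal{G}$ is the set of isomorphism classes of graphs. The asymptotic spectrum of graphs $\Delta(\mathcal{G})$ is the set of functions $f:\mathcal{G}\to\mathbb{R}_{\ge0}$ such that for all graphs $G,H$: (S1) $f(G\sqcup H)=f(G)+f(H)$; (S2) $f(G\boxtimes H)=f(G)f(H)$; (S3) if there is a homomorphism $\overline{H}\to\overline{G}$ then $f(H)\le f(G)$; (S4) $f(K_1)=1$. A probabilistic graph is a pair $(G,P)$ with $G$ nonempty and $P$ a probability distribution on $V(G)$; $\mathcal{G}_{\mathrm{prob}}$ is the set of isomorphism classes (measure-preserving graph isomorphisms) of probabilistic graphs. For a finite set $\mathcal{X}$, $\mathcal{P}(\mathcal{X})$ is the set of probability distributions on $\mathcal{X}$; $P$ is an $n$-type if $nP(x)\in\mathbb{N}$ for all $x$; for an $n$-type $P$, $T^n_P\subseteq\mathcal{X}^n$ is the set of strings in which each $x$ occurs exactly $nP(x)$ times; for $\mathcal{U}\subseteq\mathcal{P}(\mathcal{X})$, $T^n_{\mathcal{U}}$ is the union of $T^n_P$ over $n$-types $P\in\mathcal{U}$.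 $B_\epsilon(P)$ is the open $\epsilon$-ball around $P$ in total variation distance. $H(P)=-\sum_xP(x)\log P(x)$ (log base 2), $h(p)=-p\log p-(1-p)\log(1-p)$. For $p\in[0,1]$, $pP_G\oplus(1-p)P_H$ is the distribution on $V(G)\sqcup V(H)$ equal to $pP_G$ on $V(G)$ and $(1-p)P_H$ on $V(H)$. For a map $\varphi$, $\varphi_*(P)$ is the pushforward distribution. *)

theory Defs
  imports "HOL-Probability.Probability" "Graph_Theory.Graph_Theory"
begin

section \<open>Graphs\<close>

text \<open>
  A finite simple undirected graph is a record of type \<^typ>\<open>'a pair_pre_digraph\<close> satisfying
  \<^const>\<open>pair_graph\<close>: finite vertex set, and a symmetric irreflexive set of ordered pairs of
  vertices, so an edge \<open>{u, v}\<close> is present as both \<open>(u, v)\<close> and \<open>(v, u)\<close>.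
  The graph without vertices is allowed.
\<close>

definition graph_hom ::
    "('a \<Rightarrow> 'b) \<Rightarrow> 'a pair_pre_digraph \<Rightarrow> 'b pair_pre_digraph \<Rightarrow> bool" where
  "graph_hom \<phi> G H \<longleftrightarrow>
     \<phi> \<in> pverts G \<rightarrow> pverts H \<and> (\<forall>(u, v) \<in> parcs G. (\<phi> u, \<phi> v) \<in> parcs H)"

definition graph_isomorphism ::
    "('a \<Rightarrow> 'b) \<Rightarrow> 'a pair_pre_digraph \<Rightarrow> 'b pair_pre_digraph \<Rightarrow> bool" where
  "graph_isomorphism \<phi> G H \<longleftrightarrow>
     bij_betw \<phi> (pverts G) (pverts H) \<and>
     (\<forall>u \<in> pverts G. \<forall>v \<in> pverts G. (u, v) \<in> parcs G \<longleftrightarrow> (\<phi> u, \<phi> v) \<in> parcs H)"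

definition complement :: "'a pair_pre_digraph \<Rightarrow> 'a pair_pre_digraph" where
  "complement G =
     \<lparr> pverts = pverts G,
       parcs = {(u, v). u \<in> pverts G \<and> v \<in> pverts G \<and> u \<noteq> v \<and> (u, v) \<notin> parcs G} \<rparr>"

definition disjoint_union ::
    "'a pair_pre_digraph \<Rightarrow> 'b pair_pre_digraph \<Rightarrow> ('a + 'b) pair_pre_digraph"
    (infixl \<open>\<squnion>\<^sub>G\<close> 65) where
  "G \<squnion>\<^sub>G H =
     \<lparr> pverts = pverts G <+> pverts H,
       parcs = map_prod Inl Inl ` parcs G \<union> map_prod Inr Inr ` parcs H \<rparr>"

definition strong_product ::
    "'a pair_pre_digraph \<Rightarrow> 'b pair_pre_digraph \<Rightarrow> ('a \<times> 'b) pair_pre_digraph"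
    (infixl \<open>\<boxtimes>\<close> 70) where
  "G \<boxtimes> H =
     \<lparr> pverts = pverts G \<times> pverts H,
       parcs = {((g, h), (g', h')).
         g \<in> pverts G \<and> g' \<in> pverts G \<and> h \<in> pverts H \<and> h' \<in> pverts H \<and>
         (g, h) \<noteq> (g', h') \<and>
         (g = g' \<or> (g, g') \<in> parcs G) \<and> (h = h' \<or> (h, h') \<in> parcs H)} \<rparr>"

text \<open>
  The vertices of the \<open>n\<close>-fold strong power are the strings of length \<open>n\<close>. The lemma
  \<open>strong_power_Suc\<close> below identifies this graph with the iterated strong product.
\<close>

definition strong_power :: "'a pair_pre_digraph \<Rightarrow> nat \<Rightarrow> 'a list pair_pre_digraph" where
  "strong_power G n =
     \<lparr> pverts = {xs. length xs = n \<and> set xs \<subseteq> pverts G},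
       parcs = {(xs, ys).
         length xs = n \<and> set xs \<subseteq> pverts G \<and> length ys = n \<and> set ys \<subseteq> pverts G \<and> xs \<noteq> ys \<and>
         (\<forall>i < n. xs ! i = ys ! i \<or> (xs ! i, ys ! i) \<in> parcs G)} \<rparr>"

definition induced :: "'a pair_pre_digraph \<Rightarrow> 'a set \<Rightarrow> 'a pair_pre_digraph" where
  "induced G S = \<lparr> pverts = S, parcs = {(u, v) \<in> parcs G. u \<in> S \<and> v \<in> S} \<rparr>"

definition K1 :: "unit pair_pre_digraph" where
  "K1 = \<lparr> pverts = {()}, parcs = {} \<rparr>"


section \<open>The asymptotic spectrum of graphs\<close>

text \<open>
  Every finite graph, over whatever vertex type, is isomorphic to one whose vertices are natural
  numbers. Its isomorphism class is represented by the set of all such graphs.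
\<close>

definition iso_class :: "'a pair_pre_digraph \<Rightarrow> nat pair_pre_digraph set" where
  "iso_class G = {H. pair_graph H \<and> (\<exists>\<phi>. graph_isomorphism \<phi> G H)}"

definition graph_classes :: "nat pair_pre_digraph set set" where
  "graph_classes = {iso_class G |G :: nat pair_pre_digraph. pair_graph G}"

definition asymptotic_spectrum :: "(nat pair_pre_digraph set \<Rightarrow> real) set" where
  "asymptotic_spectrum = {f \<in> graph_classes \<rightarrow> {0..}.
     (\<forall>(G :: nat pair_pre_digraph) (H :: nat pair_pre_digraph). pair_graph G \<longrightarrow> pair_graph H \<longrightarrow>
        f (iso_class (G \<squnion>\<^sub>G H)) = f (iso_class G) + f (iso_class H) \<and>
        f (iso_class (G \<boxtimes> H)) = f (iso_class G) * f (iso_class H) \<and>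
        ((\<exists>\<phi>. graph_hom \<phi> (complement H) (complement G)) \<longrightarrow>
           f (iso_class H) \<le> f (iso_class G))) \<and>
     f (iso_class K1) = 1}"


section \<open>Probability distributions and types\<close>

definition distributions :: "'a set \<Rightarrow> 'a pmf set" where
  "distributions X = {P. set_pmf P \<subseteq> X}"

definition prob_graph :: "'a pair_pre_digraph \<Rightarrow> 'a pmf \<Rightarrow> bool" where
  "prob_graph G P \<longleftrightarrow> pair_graph G \<and> pverts G \<noteq> {} \<and> P \<in> distributions (pverts G)"

definition prob_graph_isomorphic ::
    "'a pair_pre_digraph \<Rightarrow> 'a pmf \<Rightarrow> 'b pair_pre_digraph \<Rightarrow> 'b pmf \<Rightarrow> bool" where
  "prob_graph_isomorphic G P H Q \<longleftrightarrow> (\<exists>\<phi>. graph_isomorphism \<phi> G H \<and> map_pmf \<phi> P = Q)"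

definition tv_dist :: "'a set \<Rightarrow> 'a pmf \<Rightarrow> 'a pmf \<Rightarrow> real" where
  "tv_dist X P Q = (\<Sum>x\<in>X. \<bar>pmf P x - pmf Q x\<bar>) / 2"

definition tv_ball :: "'a set \<Rightarrow> 'a pmf \<Rightarrow> real \<Rightarrow> 'a pmf set" where
  "tv_ball X P \<epsilon> = {Q \<in> distributions X. tv_dist X P Q < \<epsilon>}"

definition is_type :: "'a set \<Rightarrow> nat \<Rightarrow> 'a pmf \<Rightarrow> bool" where
  "is_type X n P \<longleftrightarrow> P \<in> distributions X \<and> (\<forall>x\<in>X. real n * pmf P x \<in> \<nat>)"

definition type_strings :: "'a set \<Rightarrow> nat \<Rightarrow> 'a pmf \<Rightarrow> 'a list set" where
  "type_strings X n P =
     {xs. length xs = n \<and> set xs \<subseteq> X \<and> (\<forall>x\<in>X. real (count_list xs x) = real n * pmf P x)}"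

definition type_union_strings :: "'a set \<Rightarrow> nat \<Rightarrow> 'a pmf set \<Rightarrow> 'a list set" where
  "type_union_strings X n U = (\<Union>P \<in> {P \<in> U. is_type X n P}. type_strings X n P)"

text \<open>The convex combination \<open>p P + (1 - p) Q\<close>, see the lemma \<open>pmf_mix\<close> below.\<close>

definition mix :: "real \<Rightarrow> 'a pmf \<Rightarrow> 'a pmf \<Rightarrow> 'a pmf" where
  "mix p P Q = bind_pmf (bernoulli_pmf p) (\<lambda>b. if b then P else Q)"

definition direct_sum :: "real \<Rightarrow> 'a pmf \<Rightarrow> 'b pmf \<Rightarrow> ('a + 'b) pmf" where
  "direct_sum p P Q = mix p (map_pmf Inl P) (map_pmf Inr Q)"

definition shannon_entropy :: "'a pmf \<Rightarrow> real" where
  "shannon_entropy P = - (\<Sum>x\<in>set_pmf P. pmf P x * log 2 (pmf P x))"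

definition binary_entropy :: "real \<Rightarrow> real" where
  "binary_entropy p = - p * log 2 p - (1 - p) * log 2 (1 - p)"

definition mutual_info :: "('a \<times> 'b) pmf \<Rightarrow> real" where
  "mutual_info P =
     shannon_entropy (map_pmf fst P) + shannon_entropy (map_pmf snd P) - shannon_entropy P"


section \<open>Probabilistic refinement of a spectral point\<close>

definition growth_rate ::
    "(nat pair_pre_digraph set \<Rightarrow> real) \<Rightarrow> 'a pair_pre_digraph \<Rightarrow> 'a pmf \<Rightarrow> real \<Rightarrow> ereal" where
  "growth_rate f G P \<epsilon> =
     limsup (\<lambda>n. ereal (root n
       (f (iso_class
         (induced (strong_power G n) (type_union_strings (pverts G) n (tv_ball (pverts G) P \<epsilon>)))))))"

text \<open>
  \<open>prob_value\<close> is meaningful only where \<^const>\<open>growth_rate\<close> has a finite limit as \<open>\<epsilon>\<close> tends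
  to \<open>0\<close> from above, and \<open>log_prob_value\<close> only where moreover \<open>prob_value\<close> is positive.
\<close>

definition prob_value ::
    "(nat pair_pre_digraph set \<Rightarrow> real) \<Rightarrow> 'a pair_pre_digraph \<Rightarrow> 'a pmf \<Rightarrow> real" where
  "prob_value f G P = real_of_ereal (Lim (at_right 0) (growth_rate f G P))"

definition log_prob_value ::
    "(nat pair_pre_digraph set \<Rightarrow> real) \<Rightarrow> 'a pair_pre_digraph \<Rightarrow> 'a pmf \<Rightarrow> real" where
  "log_prob_value f G P = log 2 (prob_value f G P)"


section \<open>Agreement with library notions and iterated products\<close>

lemma with_proj_induced: "with_proj (induced G S) = with_proj G \<restriction> S"
  by (auto simp: induced_def induce_subgraph_def with_proj_def)

lemma graph_isomorphism_iff_digraph_iso: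
  assumes "pair_graph G" "pair_graph H"
  shows "(\<exists>\<phi>. graph_isomorphism \<phi> G H) \<longleftrightarrow> digraph_iso (with_proj G) (with_proj H)"
proof
  interpret G: pair_graph G by fact
  interpret H: pair_graph H by fact
  assume "\<exists>\<phi>. graph_isomorphism \<phi> G H"
  then obtain \<phi> where bij: "bij_betw \<phi> (pverts G) (pverts H)"
    and adj: "\<And>u v. u \<in> pverts G \<Longrightarrow> v \<in> pverts G \<Longrightarrow> (u, v) \<in> parcs G \<longleftrightarrow> (\<phi> u, \<phi> v) \<in> parcs H"
    unfolding graph_isomorphism_def by blast
  have arcs: "parcs H = map_prod \<phi> \<phi> ` parcs G"
  proof
    show "map_prod \<phi> \<phi> ` parcs G \<subseteq> parcs H"
      by (auto dest: adj[THEN iffD1, OF G.wellformed'(1) G.wellformed'(2)])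
    show "parcs H \<subseteq> map_prod \<phi> \<phi> ` parcs G"
    proof
      fix e assume e: "e \<in> parcs H"
      obtain x y where [simp]: "e = (x, y)" by (cases e)
      have "x \<in> \<phi> ` pverts G" "y \<in> \<phi> ` pverts G"
        using e H.wellformed' bij by (auto simp: bij_betw_def)
      then obtain u v where "u \<in> pverts G" "v \<in> pverts G" "x = \<phi> u" "y = \<phi> v" by blast
      then show "e \<in> map_prod \<phi> \<phi> ` parcs G"
        using e adj[of u v] by (intro image_eqI[of _ _ "(u, v)"]) simp_all
    qed
  qed
  have inj: "inj_on \<phi> (pverts G)" using bij by (simp add: bij_betw_def)
  let ?h = "\<lparr> iso_verts = \<phi>, iso_arcs = map_prod \<phi> \<phi>, iso_head = snd, iso_tail = fst \<rparr>"
  have "inj_on (map_prod \<phi> \<phi>) (parcs G)"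
    by (intro map_prod_inj_on[OF inj inj, THEN inj_on_subset]) (auto dest: G.wellformed')
  then have "pre_digraph.digraph_isomorphism (with_proj G) ?h"
    using inj G.wf_digraph_axioms by (auto simp: pre_digraph.digraph_isomorphism_def)
  moreover have "with_proj H = app_iso ?h (with_proj G)"
    using bij arcs by (simp add: app_iso_def with_proj_def bij_betw_def)
  ultimately show "digraph_iso (with_proj G) (with_proj H)"
    unfolding digraph_iso_def by blast
next
  interpret G: pair_graph G by fact
  assume "digraph_iso (with_proj G) (with_proj H)"
  then obtain h where h: "pre_digraph.digraph_isomorphism (with_proj G) h"
    and H: "with_proj H = app_iso h (with_proj G)" unfolding digraph_iso_def by blast
  have inj: "inj_on (iso_verts h) (pverts G)"
    using h by (simp add: pre_digraph.digraph_isomorphism_def)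
  have V: "pverts H = iso_verts h ` pverts G" and A: "parcs H = iso_arcs h ` parcs G"
    and "iso_tail h = fst" "iso_head h = snd"
    using H by (auto simp: app_iso_def with_proj_def)
  then have arc: "iso_arcs h e = map_prod (iso_verts h) (iso_verts h) e" if "e \<in> parcs G" for e
    using h that by (auto simp: pre_digraph.digraph_isomorphism_def prod_eq_iff)
  have "(u, v) \<in> parcs G \<longleftrightarrow> (iso_verts h u, iso_verts h v) \<in> parcs H"
    if "u \<in> pverts G" "v \<in> pverts G" for u v
  proof
    assume "(u, v) \<in> parcs G"
    then show "(iso_verts h u, iso_verts h v) \<in> parcs H"
      unfolding A using arc by (intro image_eqI[of _ _ "(u, v)"]) simp_all
  next
    assume "(iso_verts h u, iso_verts h v) \<in> parcs H"
    then obtain e where "e \<in> parcs G" "(iso_verts h u, iso_verts h v) = iso_arcs h e"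
      unfolding A by blast
    then obtain u' v' where "(u', v') \<in> parcs G"
      "iso_verts h u = iso_verts h u'" "iso_verts h v = iso_verts h v'"
      using arc[of e] by (cases e) simp
    then show "(u, v) \<in> parcs G" using that inj G.wellformed' by (metis inj_onD)
  qed
  then have "graph_isomorphism (iso_verts h) G H"
    using inj V by (auto simp: graph_isomorphism_def bij_betw_def)
  then show "\<exists>\<phi>. graph_isomorphism \<phi> G H" by blast
qed

lemma strong_power_0: "graph_isomorphism (\<lambda>_. []) K1 (strong_power G 0)"
  by (auto simp: graph_isomorphism_def K1_def strong_power_def bij_betw_def)

lemma strong_power_Suc:
  "graph_isomorphism (\<lambda>(x, xs). x # xs) (G \<boxtimes> strong_power G n) (strong_power G (Suc n))"
proof -
  have "bij_betw (\<lambda>(x, xs). x # xs) (pverts (G \<boxtimes> strong_power G n)) (pverts (strong_power G (Suc n)))"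
    by (auto simp: bij_betw_def inj_on_def strong_product_def strong_power_def image_iff length_Suc_conv)
  moreover have "(\<forall>i < Suc n. (x # xs) ! i = (y # ys) ! i \<or> ((x # xs) ! i, (y # ys) ! i) \<in> parcs G) \<longleftrightarrow>
      (x = y \<or> (x, y) \<in> parcs G) \<and> (\<forall>i < n. xs ! i = ys ! i \<or> (xs ! i, ys ! i) \<in> parcs G)"
    for x y :: 'a and xs ys
    by (auto simp: less_Suc_eq_0_disj)
  ultimately show ?thesis
    by (auto simp: graph_isomorphism_def strong_product_def strong_power_def)
qed

lemma pmf_mix: "0 \<le> p \<Longrightarrow> p \<le> 1 \<Longrightarrow> pmf (mix p P Q) x = p * pmf P x + (1 - p) * pmf Q x"
  by (simp add: mix_def pmf_bind)

end

theory Submission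
  imports Defs
begin

text \<open>
  The relation ``equal or adjacent'' turns a graph into a tolerance relation. Strong products, strong
  powers and disjoint unions become \<^const>\<open>rel_prod\<close>, \<^const>\<open>list_all2\<close> and \<^const>\<open>rel_sum\<close>, and cohomomorphisms
  become maps reflecting the relation.

  For a multiset \<open>M\<close> of vertices let \<open>v(M)\<close> be the value of the spectral point on the type class of \<open>M\<close>.
  Concatenation gives \<open>v(M) v(N) \<le> v(M + N)\<close>, so by Fekete's lemma \<open>ln v(\<lfloor>n p\<rfloor>) / n\<close> converges for every
  weight function \<open>p\<close>. Inserting \<open>k\<close> further letters multiplies \<open>v\<close> by at most a binomial coefficient times
  \<open>|X|^k\<close>, so the limit, the exponent of \<open>p\<close>, is the same along every sequence of types with
  frequencies tending to \<open>p\<close>. There are only polynomially many types of size \<open>n\<close>, so the exponent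
  is the logarithm of the probabilistic value.

  All properties are then read off from identities for \<open>v\<close> on suitable sequences of types. The only
  substantial one is the bound with the mutual information: the product of two type classes is covered,
  up to a subexponential factor, by \<open>|T\<^sub>A| |T\<^sub>B| / |T\<^sub>M|\<close> translates of the joint type class
  under pairs of coordinate permutations.
\<close>

section \<open>Graphs as tolerance relations\<close>

text \<open>The spectral axioms bound values from above only through homomorphisms of complements,
  whereas unions, insertions and coverings come as images. The bridge is that a section of a
  relation-preserving surjection reflects the relation. Counting enters through the edgeless graph,
  the relation \<open>(=)\<close>, whose value is its number of vertices; cardinalities and values
  thus combine through the product axiom. The exponent then is homogeneous of degree one and
  superadditive, which together give concavity, and in a disjoint union the two parts enter with
  their actual masses, so the endpoints 0 and 1 of the mixing parameter fit in. Real weights rarely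
  have exact types. Rounding down fits superadditivity but loses letters, so types of size exactly
  \<open>n\<close> are obtained by padding, and the exponent has to be insensitive to a sublinear
  number of changed letters. Logarithms are natural throughout; base 2 appears only as a final
  division by \<open>ln 2\<close>.\<close>

definition tolerance :: "('v \<Rightarrow> 'v \<Rightarrow> bool) \<Rightarrow> bool" where
  "tolerance E \<longleftrightarrow> reflp E \<and> symp E"

lemma tolerance_refl: "tolerance E \<Longrightarrow> E x x"
  by (simp add: tolerance_def reflpD)

lemma tolerance_sym: "tolerance E \<Longrightarrow> E x y \<Longrightarrow> E y x"
  by (auto simp: tolerance_def dest: sympD)

lemma tolerance_eq: "tolerance (=)"
  by (simp add: tolerance_def)

lemma tolerance_rel_sum: "tolerance E \<Longrightarrow> tolerance F \<Longrightarrow> tolerance (rel_sum E F)"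
  by (auto simp: tolerance_def reflp_def symp_def rel_sum.simps split_sum_all)

lemma tolerance_rel_prod: "tolerance E \<Longrightarrow> tolerance F \<Longrightarrow> tolerance (rel_prod E F)"
  by (auto simp: tolerance_def reflp_def symp_def)

lemma tolerance_list_all2: "tolerance E \<Longrightarrow> tolerance (list_all2 E)"
  by (auto simp: tolerance_def reflp_def symp_def list_all2_conv_all_nth)

definition rel_graph :: "'v set \<Rightarrow> ('v \<Rightarrow> 'v \<Rightarrow> bool) \<Rightarrow> 'v pair_pre_digraph" where
  "rel_graph V E =
     \<lparr> pverts = V, parcs = {(u, v). u \<in> V \<and> v \<in> V \<and> u \<noteq> v \<and> E u v} \<rparr>"

definition adj_eq :: "'v pair_pre_digraph \<Rightarrow> 'v \<Rightarrow> 'v \<Rightarrow> bool" where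
  "adj_eq G u v \<longleftrightarrow> u = v \<or> (u, v) \<in> parcs G"

lemma pverts_rel_graph [simp]: "pverts (rel_graph V E) = V"
  by (simp add: rel_graph_def)

lemma pair_graph_iff:
  "pair_graph G \<longleftrightarrow> finite (pverts G) \<and> parcs G \<subseteq> pverts G \<times> pverts G \<and>
     (\<forall>u v. (u, v) \<in> parcs G \<longrightarrow> (v, u) \<in> parcs G \<and> u \<noteq> v)"
proof
  assume "pair_graph G"
  then interpret pair_graph G .
  show "finite (pverts G) \<and> parcs G \<subseteq> pverts G \<times> pverts G \<and>
     (\<forall>u v. (u, v) \<in> parcs G \<longrightarrow> (v, u) \<in> parcs G \<and> u \<noteq> v)"
    using pair_finite_verts wellformed' pair_no_loops pair_sym_arcs
    by (auto simp: symmetric_def dest: symD) (metis fst_conv snd_conv)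
next
  assume A: "finite (pverts G) \<and> parcs G \<subseteq> pverts G \<times> pverts G \<and>
     (\<forall>u v. (u, v) \<in> parcs G \<longrightarrow> (v, u) \<in> parcs G \<and> u \<noteq> v)"
  interpret pair_pre_digraph G .
  have "finite (parcs G)" using A finite_subset by blast
  then show "pair_graph G"
    using A by unfold_locales (auto simp: symmetric_def arcs_ends_conv intro!: symI)
qed

lemma pair_graph_rel_graph:
  assumes "finite V" "tolerance E"
  shows "pair_graph (rel_graph V E)"
  using assms by (auto simp: pair_graph_iff rel_graph_def dest: tolerance_sym)

lemma tolerance_adj_eq: "pair_graph G \<Longrightarrow> tolerance (adj_eq G)"
  unfolding pair_graph_iff tolerance_def adj_eq_def reflp_def symp_def by blast

lemma rel_graph_adj_eq: "pair_graph G \<Longrightarrow> rel_graph (pverts G) (adj_eq G) = G"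
  unfolding pair_graph_iff rel_graph_def adj_eq_def
  by (cases G) auto

text \<open>Reflexivity makes the two descriptions agree: "equal or adjacent" in a factor is then
  just the relation, and deleting loops afterwards leaves the condition that the pairs be
  distinct.\<close>

lemma strong_product_rel_graph:
  "rel_graph V E \<boxtimes> rel_graph W F = rel_graph (V \<times> W) (rel_prod E F)"
  if "tolerance E" "tolerance F"
  using that[THEN tolerance_refl] by (auto simp: strong_product_def rel_graph_def)

lemma disjoint_union_rel_graph:
  "rel_graph V E \<squnion>\<^sub>G rel_graph W F = rel_graph (V <+> W) (rel_sum E F)"
  by (force simp: disjoint_union_def rel_graph_def image_iff elim!: rel_sum.cases)

lemma pair_graph_strong_product: "pair_graph G \<Longrightarrow> pair_graph H \<Longrightarrow> pair_graph (G \<boxtimes> H)"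
  using pair_graph_rel_graph[of "pverts G \<times> pverts H" "rel_prod (adj_eq G) (adj_eq H)"]
    strong_product_rel_graph[OF tolerance_adj_eq tolerance_adj_eq, of G H "pverts G" "pverts H"]
  by (simp add: rel_graph_adj_eq tolerance_rel_prod tolerance_adj_eq pair_graph_iff[of G] pair_graph_iff[of H])

lemma pair_graph_disjoint_union: "pair_graph G \<Longrightarrow> pair_graph H \<Longrightarrow> pair_graph (G \<squnion>\<^sub>G H)"
  using pair_graph_rel_graph[of "pverts G <+> pverts H" "rel_sum (adj_eq G) (adj_eq H)"]
    disjoint_union_rel_graph[of "pverts G" "adj_eq G" "pverts H" "adj_eq H"]
  by (simp add: rel_graph_adj_eq tolerance_rel_sum tolerance_adj_eq pair_graph_iff[of G] pair_graph_iff[of H])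

lemma adj_eq_strong_product:
  assumes "pair_graph G" "pair_graph H"
    "u \<in> pverts G \<times> pverts H" "v \<in> pverts G \<times> pverts H"
  shows "adj_eq (G \<boxtimes> H) u v \<longleftrightarrow> rel_prod (adj_eq G) (adj_eq H) u v"
  using assms by (cases u; cases v) (auto simp: adj_eq_def strong_product_def pair_graph_iff)

lemma adj_eq_disjoint_union:
  "adj_eq (G \<squnion>\<^sub>G H) = rel_sum (adj_eq G) (adj_eq H)"
  unfolding fun_eq_iff
proof (intro allI)
  fix u v show "adj_eq (G \<squnion>\<^sub>G H) u v = rel_sum (adj_eq G) (adj_eq H) u v"
    by (cases u; cases v) (auto simp: adj_eq_def disjoint_union_def)
qed

lemma induced_strong_power:
  assumes "pair_graph G" "S \<subseteq> {xs. length xs = n \<and> set xs \<subseteq> pverts G}"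
  shows "induced (strong_power G n) S = rel_graph S (list_all2 (adj_eq G))"
  using assms(2) by (auto simp: induced_def strong_power_def rel_graph_def adj_eq_def list_all2_conv_all_nth)

lemma graph_isomorphism_inv:
  assumes "graph_isomorphism \<phi> G H"
  shows "graph_isomorphism (inv_into (pverts G) \<phi>) H G"
  unfolding graph_isomorphism_def
proof safe
  have bij: "bij_betw \<phi> (pverts G) (pverts H)"
    and adj: "\<And>u v. u \<in> pverts G \<Longrightarrow> v \<in> pverts G \<Longrightarrow> (u, v) \<in> parcs G \<longleftrightarrow> (\<phi> u, \<phi> v) \<in> parcs H"
    using assms by (auto simp: graph_isomorphism_def)
  show "bij_betw (inv_into (pverts G) \<phi>) (pverts H) (pverts G)"
    using bij by (rule bij_betw_inv_into)
  fix u v assume *: "u \<in> pverts H" "v \<in> pverts H"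
  have "inv_into (pverts G) \<phi> u \<in> pverts G" "inv_into (pverts G) \<phi> v \<in> pverts G"
    using * bij by (auto simp: bij_betw_def intro: inv_into_into)
  from adj[OF this] show "(u, v) \<in> parcs H \<Longrightarrow> (inv_into (pverts G) \<phi> u, inv_into (pverts G) \<phi> v) \<in> parcs G"
    "(inv_into (pverts G) \<phi> u, inv_into (pverts G) \<phi> v) \<in> parcs G \<Longrightarrow> (u, v) \<in> parcs H"
    using * bij by (auto simp: bij_betw_inv_into_right)
qed

lemma graph_isomorphism_comp:
  assumes "graph_isomorphism \<phi> G H" "graph_isomorphism \<psi> H K"
  shows "graph_isomorphism (\<psi> \<circ> \<phi>) G K"
  using assms unfolding graph_isomorphism_def
  by (auto intro: bij_betw_trans simp: bij_betw_apply)

lemma iso_class_eqI: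
  assumes "graph_isomorphism \<phi> G H"
  shows "iso_class G = iso_class H"
  unfolding iso_class_def
  using graph_isomorphism_comp[OF graph_isomorphism_inv[OF assms]] graph_isomorphism_comp[OF assms]
  by blast

lemma graph_isomorphism_rel_graph:
  assumes "bij_betw \<phi> V W" "\<And>u v. u \<in> V \<Longrightarrow> v \<in> V \<Longrightarrow> E u v \<longleftrightarrow> F (\<phi> u) (\<phi> v)"
  shows "graph_isomorphism \<phi> (rel_graph V E) (rel_graph W F)"
  using assms unfolding graph_isomorphism_def
  by (auto simp: rel_graph_def bij_betw_apply bij_betw_def inj_on_def)

text \<open>A homomorphism of complements sends distinct unrelated vertices to distinct unrelated
  vertices; read contrapositively, it reflects the relation. The case \<open>u = v\<close> is not
  about arcs and is settled by reflexivity.\<close>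

lemma graph_hom_complement_rel_graph:
  assumes "graph_hom \<phi> (complement (rel_graph V E)) (complement (rel_graph W F))" "tolerance E"
    "u \<in> V" "v \<in> V" "F (\<phi> u) (\<phi> v)"
  shows "E u v"
proof (cases "u = v")
  case True
  then show ?thesis using tolerance_refl[OF assms(2)] by simp
next
  case False
  show ?thesis
  proof (rule ccontr)
    assume "\<not> E u v"
    then have "(u, v) \<in> parcs (complement (rel_graph V E))"
      using assms(3,4) False by (simp add: complement_def rel_graph_def)
    then have "(\<phi> u, \<phi> v) \<in> parcs (complement (rel_graph W F))"
      using assms(1) by (auto simp: graph_hom_def)
    then show False using assms(5) by (auto simp: complement_def rel_graph_def)
  qed
qed

lemma graph_hom_complement_rel_graphI:
  assumes "\<phi> \<in> V \<rightarrow> W" "tolerance F"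
    "\<And>u v. u \<in> V \<Longrightarrow> v \<in> V \<Longrightarrow> F (\<phi> u) (\<phi> v) \<Longrightarrow> E u v"
  shows "graph_hom \<phi> (complement (rel_graph V E)) (complement (rel_graph W F))"
  unfolding graph_hom_def
proof (intro conjI ballI)
  show "\<phi> \<in> pverts (complement (rel_graph V E)) \<rightarrow> pverts (complement (rel_graph W F))"
    using assms(1) by (simp add: complement_def)
  fix e assume "e \<in> parcs (complement (rel_graph V E))"
  then obtain u v where e: "e = (u, v)" "u \<in> V" "v \<in> V" "\<not> E u v"
    by (auto simp: complement_def rel_graph_def)
  then have "\<not> F (\<phi> u) (\<phi> v)" using assms(3) by blast
  \<comment> \<open>An arc of the target complement also requires distinct images; reflexivity of
    \<open>F\<close> supplies this.\<close>
  moreover from this have "\<phi> u \<noteq> \<phi> v" using tolerance_refl[OF assms(2)] by metis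
  ultimately show "case e of (u, v) \<Rightarrow> (\<phi> u, \<phi> v) \<in> parcs (complement (rel_graph W F))"
    using e assms(1) by (auto simp: complement_def rel_graph_def)
qed

section \<open>Relabelling vertices by natural numbers\<close>

definition nat_code :: "'v set \<Rightarrow> 'v \<Rightarrow> nat" where
  "nat_code V = (SOME e. inj_on e V)"

text \<open>The axioms constrain a spectral point only through graphs whose vertices are natural
  numbers, so a relation on a finite set of any type is transported along the chosen injection.
  Pulling back along its inverse defines the relation on all of \<open>nat\<close>: the result at
  numbers that are not codes is arbitrary, but it stays a tolerance everywhere.\<close>

definition nat_rel :: "'v set \<Rightarrow> ('v \<Rightarrow> 'v \<Rightarrow> bool) \<Rightarrow> nat \<Rightarrow> nat \<Rightarrow> bool" where
  "nat_rel V E i j \<longleftrightarrow> E (inv_into V (nat_code V) i) (inv_into V (nat_code V) j)"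

lemma inj_on_nat_code:
  assumes "finite V"
  shows "inj_on (nat_code V) V"
proof -
  obtain e :: "'a \<Rightarrow> nat" and n where "e ` V = {i. i < n} \<and> inj_on e V"
    using finite_imp_inj_to_nat_seg[OF assms] by auto
  then have "inj_on e V" ..
  then show ?thesis unfolding nat_code_def by (rule someI[where P = "\<lambda>e. inj_on e V"])
qed

lemma nat_rel_nat_code: "finite V \<Longrightarrow> u \<in> V \<Longrightarrow> v \<in> V \<Longrightarrow> nat_rel V E (nat_code V u) (nat_code V v) \<longleftrightarrow> E u v"
  unfolding nat_rel_def by (simp only: inv_into_f_f[OF inj_on_nat_code])

lemma tolerance_nat_rel: "tolerance E \<Longrightarrow> tolerance (nat_rel V E)"
  unfolding tolerance_def nat_rel_def reflp_def symp_def by blast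

lemma iso_class_nat_code:
  assumes "finite V"
  shows "iso_class (rel_graph (nat_code V ` V) (nat_rel V E)) = iso_class (rel_graph V E)"
proof -
  have "graph_isomorphism (nat_code V) (rel_graph V E) (rel_graph (nat_code V ` V) (nat_rel V E))"
    using assms by (intro graph_isomorphism_rel_graph) (simp_all add: bij_betw_def inj_on_nat_code nat_rel_nat_code)
  from iso_class_eqI[OF this] show ?thesis by (rule sym)
qed

section \<open>The value of a spectral point on a finite relation\<close>

locale spectral_point =
  fixes f :: "nat pair_pre_digraph set \<Rightarrow> real"
  assumes spectral: "f \<in> asymptotic_spectrum"
begin

definition val :: "'v set \<Rightarrow> ('v \<Rightarrow> 'v \<Rightarrow> bool) \<Rightarrow> real" where
  "val V E = f (iso_class (rel_graph V E))"

lemma val_nat_code: "finite V \<Longrightarrow> val (nat_code V ` V) (nat_rel V E) = val V E"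
  by (simp add: val_def iso_class_nat_code)

lemma val_iso:
  assumes "bij_betw \<phi> V W" "\<And>u v. u \<in> V \<Longrightarrow> v \<in> V \<Longrightarrow> E u v \<longleftrightarrow> F (\<phi> u) (\<phi> v)"
  shows "val V E = val W F"
proof -
  have "graph_isomorphism \<phi> (rel_graph V E) (rel_graph W F)"
    by (rule graph_isomorphism_rel_graph) (fact assms)+
  from iso_class_eqI[OF this] show ?thesis unfolding val_def by (rule arg_cong)
qed

lemma val_nonneg: 
  assumes "finite V" "tolerance E"
  shows "0 \<le> val V E"
proof -
  have "pair_graph (rel_graph (nat_code V ` V) (nat_rel V E))"
    using assms by (intro pair_graph_rel_graph tolerance_nat_rel) auto
  then have "val (nat_code V ` V) (nat_rel V E) \<ge> 0"
    using spectral unfolding asymptotic_spectrum_def val_def graph_classes_def by (auto simp: Pi_iff)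
  then show ?thesis using val_nat_code[OF assms(1)] by metis
qed

lemma spectral_nat:
  fixes G H :: "nat pair_pre_digraph"
  assumes "pair_graph G" "pair_graph H"
  shows "f (iso_class (G \<squnion>\<^sub>G H)) = f (iso_class G) + f (iso_class H)"
    "f (iso_class (G \<boxtimes> H)) = f (iso_class G) * f (iso_class H)"
    "graph_hom \<phi> (complement H) (complement G) \<Longrightarrow> f (iso_class H) \<le> f (iso_class G)"
  using spectral assms unfolding asymptotic_spectrum_def by blast+

lemma val_sum:
  fixes V :: "'v set" and W :: "'w set"
  assumes "finite V" "tolerance E" "finite W" "tolerance F"
  shows "val (V <+> W) (rel_sum E F) = val V E + val W F"
proof -
  let ?V = "nat_code V ` V" and ?W = "nat_code W ` W" and ?E = "nat_rel V E" and ?F = "nat_rel W F"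
  have G: "pair_graph (rel_graph ?V ?E)" "pair_graph (rel_graph ?W ?F)"
    using assms by (auto intro!: pair_graph_rel_graph tolerance_nat_rel)
  have "val (V <+> W) (rel_sum E F) = val (?V <+> ?W) (rel_sum ?E ?F)"
  proof (rule val_iso)
    show "bij_betw (map_sum (nat_code V) (nat_code W)) (V <+> W) (?V <+> ?W)"
      using assms by (force simp: bij_betw_def inj_on_def image_iff Plus_def dest: inj_on_nat_code[THEN inj_onD])
  qed (use assms in \<open>auto simp: nat_rel_nat_code\<close>)
  also have "\<dots> = val ?V ?E + val ?W ?F"
    using spectral_nat(1)[OF G] by (simp add: val_def disjoint_union_rel_graph)
  finally show ?thesis using assms by (simp add: val_nat_code)
qed

lemma val_prod:
  fixes V :: "'v set" and W :: "'w set"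
  assumes "finite V" "tolerance E" "finite W" "tolerance F"
  shows "val (V \<times> W) (rel_prod E F) = val V E * val W F"
proof -
  let ?V = "nat_code V ` V" and ?W = "nat_code W ` W" and ?E = "nat_rel V E" and ?F = "nat_rel W F"
  have G: "pair_graph (rel_graph ?V ?E)" "pair_graph (rel_graph ?W ?F)"
    using assms by (auto intro!: pair_graph_rel_graph tolerance_nat_rel)
  have "val (V \<times> W) (rel_prod E F) = val (?V \<times> ?W) (rel_prod ?E ?F)"
  proof (rule val_iso)
    show "bij_betw (map_prod (nat_code V) (nat_code W)) (V \<times> W) (?V \<times> ?W)"
      using assms by (intro bij_betw_map_prod) (auto simp: bij_betw_def inj_on_nat_code)
  qed (use assms in \<open>auto simp: nat_rel_nat_code\<close>)
  also have "\<dots> = val ?V ?E * val ?W ?F"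
    using spectral_nat(2)[OF G] assms
    by (simp add: val_def strong_product_rel_graph tolerance_nat_rel)
  finally show ?thesis using assms by (simp add: val_nat_code)
qed

text \<open>This is (S3) with the homomorphism of complements replaced by a map reflecting the
  relation; conjugation with the two codings lets the vertex types differ.\<close>

lemma val_mono_map:
  fixes V :: "'v set" and W :: "'w set"
  assumes "finite W" "tolerance E" "tolerance F" "finite V"
    and \<phi>: "\<phi> \<in> V \<rightarrow> W" "\<And>u v. u \<in> V \<Longrightarrow> v \<in> V \<Longrightarrow> F (\<phi> u) (\<phi> v) \<Longrightarrow> E u v"
  shows "val V E \<le> val W F"
proof -
  let ?V = "nat_code V ` V" and ?W = "nat_code W ` W" and ?E = "nat_rel V E" and ?F = "nat_rel W F"
  have G: "pair_graph (rel_graph ?V ?E)" "pair_graph (rel_graph ?W ?F)"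
    using assms by (auto intro!: pair_graph_rel_graph tolerance_nat_rel)
  have "graph_hom (nat_code W \<circ> \<phi> \<circ> inv_into V (nat_code V))
      (complement (rel_graph ?V ?E)) (complement (rel_graph ?W ?F))"
    using assms
    by (intro graph_hom_complement_rel_graphI tolerance_nat_rel)
       (auto simp: inj_on_nat_code nat_rel_nat_code Pi_iff)
  from spectral_nat(3)[OF G(2,1) this] show ?thesis
    using assms by (simp add: val_nat_code flip: val_def)
qed

text \<open>If \<open>\<psi>\<close> preserves the relation, any section of it reflects the
  relation, so covering \<open>V\<close> by an image of \<open>W\<close> bounds the value of
  \<open>V\<close> from above.\<close>

lemma val_image_le:
  fixes V :: "'v set" and W :: "'w set"
  assumes "finite W" "tolerance E" "tolerance F" 
    and \<psi>: "V \<subseteq> \<psi> ` W" "\<And>u v. u \<in> W \<Longrightarrow> v \<in> W \<Longrightarrow> F u v \<Longrightarrow> E (\<psi> u) (\<psi> v)"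
  shows "val V E \<le> val W F"
proof (rule val_mono_map[where \<phi> = "inv_into W \<psi>"])
  show "finite V" using assms(1) \<psi>(1) by (meson finite_imageI finite_subset)
  show "inv_into W \<psi> \<in> V \<rightarrow> W" using \<psi>(1) by (auto intro: inv_into_into)
  fix u v assume "u \<in> V" "v \<in> V" "F (inv_into W \<psi> u) (inv_into W \<psi> v)"
  with \<psi>(2)[of "inv_into W \<psi> u" "inv_into W \<psi> v"] \<psi>(1) show "E u v"
    by (metis f_inv_into_f inv_into_into subsetD)
qed (use assms in auto)

lemma val_singleton: 
  assumes "tolerance E"
  shows "val {x} E = 1"
proof -
  have "val {x} E = val {()} (=)"
    using tolerance_refl[OF assms] by (intro val_iso[where \<phi> = "\<lambda>_. ()"]) (auto simp: bij_betw_def)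
  also have "rel_graph {()} (=) = K1" by (auto simp: rel_graph_def K1_def)
  then have "val {()} (=) = 1"
    using spectral by (simp add: val_def asymptotic_spectrum_def)
  finally show ?thesis .
qed

text \<open>The empty graph is the disjoint union of two empty graphs, so its value is twice
  itself.\<close>

lemma val_empty: "val {} E = 0"
proof -
  have "val ({} :: 'a set) E = val ({} <+> {}) (rel_sum (=) (=) :: unit + unit \<Rightarrow> _)"
    by (rule val_iso[where \<phi> = undefined]) (auto simp: bij_betw_def)
  also have "\<dots> = val ({} :: unit set) (=) + val ({} :: unit set) (=)"
    by (rule val_sum) (auto simp: tolerance_eq)
  also have "val ({} :: unit set) (=) = val ({} :: 'a set) E"
    by (rule val_iso[where \<phi> = undefined]) (auto simp: bij_betw_def)
  finally show ?thesis by simp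
qed

lemma val_mono: "finite W \<Longrightarrow> tolerance E \<Longrightarrow> V \<subseteq> W \<Longrightarrow> val V E \<le> val W E"
  by (rule val_image_le[where \<psi> = id]) auto

lemma val_ge_1:
  assumes "finite V" "tolerance E" "V \<noteq> {}"
  shows "1 \<le> val V E"
proof -
  obtain x where "x \<in> V" using assms by auto
  then show ?thesis using val_mono[of V E "{x}"] val_singleton[of E x] assms by simp
qed

text \<open>Disjoint copies of the two parts map onto the union, and the map preserves the relation
  because \<open>rel_sum\<close> relates only points on the same side.\<close>

lemma val_Un:
  assumes "finite V" "finite W" "tolerance E"
  shows "val (V \<union> W) E \<le> val V E + val W E"
proof -
  have "val (V \<union> W) E \<le> val (V <+> W) (rel_sum E E)"
  proof (rule val_image_le[where \<psi> = "case_sum id id"])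
    show "V \<union> W \<subseteq> case_sum id id ` (V <+> W)"
      by (force simp: image_iff)
    show "E (case_sum id id u) (case_sum id id v)" if "rel_sum E E u v" for u v
      using that by cases auto
  qed (use assms in \<open>simp_all add: tolerance_rel_sum\<close>)
  also have "\<dots> = val V E + val W E"
    using assms by (intro val_sum)
  finally show ?thesis .
qed

lemma val_UN:
  assumes "finite I" "\<And>i. i \<in> I \<Longrightarrow> finite (A i)" "tolerance E"
  shows "val (\<Union>i\<in>I. A i) E \<le> (\<Sum>i\<in>I. val (A i) E)"
  using assms
proof (induction I)
  case (insert i I)
  have "val (\<Union>j\<in>insert i I. A j) E \<le> val (A i) E + val (\<Union>i\<in>I. A i) E"
    using insert by (simp add: val_Un)
  then show ?case using insert by force
qed (simp add: val_empty)

text \<open>The edgeless graph splits off one isolated vertex at a time. This turns cardinalities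
  into values, which \<open>val_prod\<close> can multiply with other values.\<close>

lemma val_eq: "finite V \<Longrightarrow> val V (=) = card V"
proof (induction V rule: finite_induct)
  case (insert x V)
  have "val (insert x V) (=) = val ({x} <+> V) (rel_sum (=) (=))"
  proof (rule val_iso)
    show "bij_betw (\<lambda>y. if y = x then Inl x else Inr y) (insert x V) ({x} <+> V)"
      using insert.hyps by (intro bij_betw_byWitness[where f' = "case_sum id id"]) auto
  qed auto
  also have "\<dots> = val {x} (=) + val V (=)"
    using insert.hyps by (intro val_sum) (simp_all add: tolerance_eq)
  finally show ?case using insert by (simp add: val_singleton tolerance_eq)
qed (simp add: val_empty)

end

section \<open>Values of type classes\<close>

lemma card_perms_bool:
  "card (permutations_of_multiset (replicate_mset m True + replicate_mset k False)) = (m + k) choose m"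
proof -
  let ?A = "replicate_mset m True + replicate_mset k False"
  have "(\<Prod>x\<in>set_mset ?A. fact (count ?A x) :: nat) = (\<Prod>x\<in>UNIV. fact (count ?A x))"
    by (rule prod.mono_neutral_left) (auto simp flip: count_greater_zero_iff split: if_splits)
  also have "\<dots> = fact m * fact k" by (simp add: UNIV_bool mult.commute)
  finally have "card (permutations_of_multiset ?A) * (fact m * fact k) = fact (m + k)"
    using card_permutations_of_multiset_aux[of ?A] by simp
  moreover have "((m + k) choose m) * (fact m * fact k) = fact (m + k)"
    using binomial_fact_lemma[of m "m + k"] by (simp add: mult_ac)
  ultimately show ?thesis by (metis fact_nonzero mult_eq_0_iff mult_cancel2)
qed

section \<open>Strings over a disjoint sum\<close>

definition split_sum :: "('a + 'b) list \<Rightarrow> bool list \<times> 'a list \<times> 'b list" where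
  "split_sum xs = (map isl xs, map projl (filter isl xs), map projr (filter (\<lambda>x. \<not> isl x) xs))"

text \<open>Letters from different sides are never related, so related strings have the same pattern
  of sides and their subsequences correspond position by position. As an equivalence it serves both
  inequalities in \<open>type_val_sum\<close>.\<close>

lemma split_sum_rel:
  "rel_prod (=) (rel_prod (list_all2 E) (list_all2 F)) (split_sum xs) (split_sum ys) \<longleftrightarrow>
     list_all2 (rel_sum E F) xs ys"
proof (induction xs arbitrary: ys)
  case Nil
  then show ?case by (cases ys) (auto simp: split_sum_def)
next
  case (Cons x xs)
  show ?case
  proof (cases ys)
    case Nil
    then show ?thesis by (simp add: split_sum_def)
  next
    case ys: (Cons y zs)
    show ?thesis using Cons[of zs]
      by (cases x; cases y) (auto simp: split_sum_def ys)
  qed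
qed

lemma mset_split_sum:
  "mset xs = image_mset Inl (mset (fst (snd (split_sum xs)))) + image_mset Inr (mset (snd (snd (split_sum xs))))"
proof (induction xs)
  case (Cons x xs)
  then show ?case by (cases x) (auto simp: split_sum_def)
qed (simp add: split_sum_def)

text \<open>The pattern dictates from which of the two lists the next letter is taken; the length
  conditions ensure that neither list runs out early or is left over.\<close>

lemma split_sum_surj:
  assumes "length us = count_list z True" "length vs = count_list z False"
  obtains xs where "split_sum xs = (z, us, vs)"
  using assms
proof (induction z arbitrary: us vs thesis)
  case Nil
  then show ?case by (simp add: split_sum_def)
next
  case (Cons b z)
  show ?case
  proof (cases b)
    case True
    with Cons.prems obtain u us' where us: "us = u # us'" by (cases us) auto
    with True Cons.prems obtain xs where "split_sum xs = (z, us', vs)"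
      by (auto elim: Cons.IH[rotated])
    then have "split_sum (Inl u # xs) = (b # z, us, vs)" using True us by (simp add: split_sum_def)
    then show ?thesis by (rule Cons.prems(1))
  next
    case False
    with Cons.prems obtain v vs' where vs: "vs = v # vs'" by (cases vs) auto
    with False Cons.prems obtain xs where "split_sum xs = (z, us, vs')"
      by (auto elim: Cons.IH[rotated])
    then have "split_sum (Inr v # xs) = (b # z, us, vs)" using False vs by (simp add: split_sum_def)
    then show ?thesis by (rule Cons.prems(1))
  qed
qed

lemma split_sum_image:
  "split_sum ` permutations_of_multiset (image_mset Inl M + image_mset Inr N) =
     permutations_of_multiset (replicate_mset (size M) True + replicate_mset (size N) False) \<times>
     permutations_of_multiset M \<times> permutations_of_multiset N" (is "?L = ?R")
proof
  show "?L \<subseteq> ?R"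
  proof
    fix t assume "t \<in> ?L"
    then obtain xs where t: "t = split_sum xs" and xs: "mset xs = image_mset Inl M + image_mset Inr N"
      by (auto simp: permutations_of_multiset_def)
    have 1: "mset (map isl xs) = replicate_mset (size M) True + replicate_mset (size N) False"
      by (simp add: xs image_mset.compositionality o_def image_mset_const_eq)
    have "filter_mset isl (image_mset Inl M :: ('a + 'b) multiset) = image_mset Inl M"
      "filter_mset isl (image_mset Inr N :: ('a + 'b) multiset) = {#}"
      "filter_mset (\<lambda>x. \<not> isl x) (image_mset Inr N :: ('a + 'b) multiset) = image_mset Inr N"
      "filter_mset (\<lambda>x. \<not> isl x) (image_mset Inl M :: ('a + 'b) multiset) = {#}"
      by (auto simp: filter_mset_image_mset filter_mset_eq_conv)
    then show "t \<in> ?R"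
      using 1 by (auto simp: t split_sum_def permutations_of_multiset_def mset_filter xs
          image_mset.compositionality o_def)
  qed
  show "?R \<subseteq> ?L"
  proof
    fix t assume "t \<in> ?R"
    then obtain z us vs where t: "t = (z, us, vs)"
      and z: "mset z = replicate_mset (size M) True + replicate_mset (size N) False"
      and us: "mset us = M" and vs: "mset vs = N"
      by (auto simp: permutations_of_multiset_def)
    have "count_list z True = size M" "count_list z False = size N"
      by (simp_all add: z flip: count_mset)
    then obtain xs where xs: "split_sum xs = (z, us, vs)"
      using us vs by (metis size_mset split_sum_surj)
    have "mset xs = image_mset Inl M + image_mset Inr N"
      using mset_split_sum[of xs] by (simp add: xs us vs)
    with xs show "t \<in> ?L" unfolding t permutations_of_multiset_def by (metis (mono_tags) imageI mem_Collect_eq)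
  qed
qed

section \<open>Concatenation, sums and inserted letters in type classes\<close>

context spectral_point
begin

definition type_val :: "('v \<Rightarrow> 'v \<Rightarrow> bool) \<Rightarrow> 'v multiset \<Rightarrow> real" where
  "type_val E M = val (permutations_of_multiset M) (list_all2 E)"

lemma type_val_ge_1: "tolerance E \<Longrightarrow> 1 \<le> type_val E M"
  unfolding type_val_def by (intro val_ge_1 tolerance_list_all2) auto

lemma type_val_pos: "tolerance E \<Longrightarrow> 0 < type_val E M"
  using type_val_ge_1[of E M] by simp

lemma type_val_empty: "tolerance E \<Longrightarrow> type_val E {#} = 1"
  unfolding type_val_def by (simp add: val_singleton tolerance_list_all2)

text \<open>Since all strings of a type have the same length, a concatenation can be cut at a known
  place, so concatenating reflects the letterwise relation. Only an inequality results, because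
  concatenations need not fill the larger type class.\<close>

lemma type_val_add:
  assumes "tolerance E"
  shows "type_val E M * type_val E N \<le> type_val E (M + N)"
proof -
  have T: "tolerance (list_all2 E)" using assms by (rule tolerance_list_all2)
  have "type_val E M * type_val E N =
      val (permutations_of_multiset M \<times> permutations_of_multiset N) (rel_prod (list_all2 E) (list_all2 E))"
    unfolding type_val_def using T by (intro val_prod[symmetric]) auto
  also have "\<dots> \<le> type_val E (M + N)"
    unfolding type_val_def
  proof (rule val_mono_map[where \<phi> = "\<lambda>(xs, ys). xs @ ys"])
    show "(\<lambda>(xs, ys). xs @ ys) \<in> permutations_of_multiset M \<times> permutations_of_multiset N \<rightarrow>
        permutations_of_multiset (M + N)"
      by (auto simp: permutations_of_multiset_def)
    fix u v
    assume "u \<in> permutations_of_multiset M \<times> permutations_of_multiset N"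
      "v \<in> permutations_of_multiset M \<times> permutations_of_multiset N"
    then have "length (fst u) = length (fst v)"
      by (auto simp: length_finite_permutations_of_multiset)
    then show "list_all2 E (case u of (xs, ys) \<Rightarrow> xs @ ys) (case v of (xs, ys) \<Rightarrow> xs @ ys) \<Longrightarrow>
        rel_prod (list_all2 E) (list_all2 E) u v"
      by (cases u; cases v) (auto simp: list_all2_append)
  qed (use T in \<open>simp_all add: tolerance_rel_prod\<close>)
  finally show ?thesis .
qed

text \<open>The missing letters form a nonempty type class, whose value is at least 1, so
  multiplying by it can only increase the bound.\<close>

lemma type_val_mono:
  assumes "tolerance E" "M \<subseteq># N"
  shows "type_val E M \<le> type_val E N"
proof -
  have "type_val E M * 1 \<le> type_val E M * type_val E (N - M)"
    using assms(1) type_val_pos[of E M] by (intro mult_left_mono type_val_ge_1) auto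
  also have "\<dots> \<le> type_val E (M + (N - M))" using assms(1) by (rule type_val_add)
  finally show ?thesis using assms(2) by simp
qed

lemma type_val_map_mono:
  assumes "tolerance E" "tolerance F"
    "\<And>u v. u \<in># M \<Longrightarrow> v \<in># M \<Longrightarrow> F (\<phi> u) (\<phi> v) \<Longrightarrow> E u v"
  shows "type_val E M \<le> type_val F (image_mset \<phi> M)"
  unfolding type_val_def
proof (rule val_mono_map[where \<phi> = "map \<phi>"])
  show "map \<phi> \<in> permutations_of_multiset M \<rightarrow> permutations_of_multiset (image_mset \<phi> M)"
    by (auto simp: permutations_of_multiset_def)
  fix xs ys assume *: "xs \<in> permutations_of_multiset M" "ys \<in> permutations_of_multiset M"
    "list_all2 F (map \<phi> xs) (map \<phi> ys)"
  then have "set xs = set_mset M" "set ys = set_mset M"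
    by (metis permutations_of_multisetD set_mset_mset)+
  then have "\<And>i. i < length xs \<Longrightarrow> xs ! i \<in># M" "\<And>i. i < length ys \<Longrightarrow> ys ! i \<in># M"
    by (metis nth_mem)+
  with *(3) show "list_all2 E xs ys"
    using assms(3) by (auto simp: list_all2_conv_all_nth)
qed (use assms in \<open>simp_all add: tolerance_list_all2\<close>)

lemma type_val_image_le:
  assumes "tolerance E" "tolerance F"
    "\<And>u v. u \<in># M \<Longrightarrow> v \<in># M \<Longrightarrow> E u v \<Longrightarrow> F (\<phi> u) (\<phi> v)"
  shows "type_val F (image_mset \<phi> M) \<le> type_val E M"
  unfolding type_val_def
proof (rule val_image_le[where \<psi> = "map \<phi>"])
  show "permutations_of_multiset (image_mset \<phi> M) \<subseteq> map \<phi> ` permutations_of_multiset M"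
    by (simp add: permutations_of_multiset_image)
  fix xs ys assume *: "xs \<in> permutations_of_multiset M" "ys \<in> permutations_of_multiset M"
    "list_all2 E xs ys"
  then have "set xs = set_mset M" "set ys = set_mset M"
    by (metis permutations_of_multisetD set_mset_mset)+
  then have "\<And>i. i < length xs \<Longrightarrow> xs ! i \<in># M" "\<And>i. i < length ys \<Longrightarrow> ys ! i \<in># M"
    by (metis nth_mem)+
  with *(3) show "list_all2 F (map \<phi> xs) (map \<phi> ys)"
    using assms(3) by (auto simp: list_all2_conv_all_nth)
qed (use assms in \<open>simp_all add: tolerance_list_all2\<close>)

lemma type_val_cong:
  assumes "tolerance E" "tolerance F"
    "\<And>u v. u \<in># M \<Longrightarrow> v \<in># M \<Longrightarrow> E u v \<longleftrightarrow> F u v"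
  shows "type_val E M = type_val F M"
  using type_val_map_mono[of E F M id] type_val_map_mono[of F E M id] assms by force

lemma type_val_prod_le:
  assumes "tolerance E" "tolerance F"
  shows "type_val (rel_prod E F) M \<le> type_val E (image_mset fst M) * type_val F (image_mset snd M)"
proof -
  have T: "tolerance (list_all2 E)" "tolerance (list_all2 F)" "tolerance (list_all2 (rel_prod E F))"
    using assms by (simp_all add: tolerance_list_all2 tolerance_rel_prod)
  have "type_val (rel_prod E F) M \<le>
      val (permutations_of_multiset (image_mset fst M) \<times> permutations_of_multiset (image_mset snd M))
        (rel_prod (list_all2 E) (list_all2 F))"
    unfolding type_val_def
  proof (rule val_mono_map[where \<phi> = "\<lambda>xs. (map fst xs, map snd xs)"])
    show "rel_prod (list_all2 E) (list_all2 F) (map fst xs, map snd xs) (map fst ys, map snd ys) \<Longrightarrow>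
        list_all2 (rel_prod E F) xs ys" for xs ys
      by (auto simp: list_all2_conv_all_nth rel_prod_sel)
    show "(\<lambda>xs. (map fst xs, map snd xs)) \<in> permutations_of_multiset M \<rightarrow>
        permutations_of_multiset (image_mset fst M) \<times> permutations_of_multiset (image_mset snd M)"
      by (auto simp: permutations_of_multiset_def)
  qed (use T in \<open>simp_all add: tolerance_rel_prod\<close>)
  also have "\<dots> = type_val E (image_mset fst M) * type_val F (image_mset snd M)"
    unfolding type_val_def using T by (intro val_prod) auto
  finally show ?thesis .
qed

text \<open>Splitting a string into its side pattern and two subsequences is onto and both preserves
  and reflects the relation, hence equality. Patterns are compared by \<open>(=)\<close>, so they
  contribute a plain count, and this binomial coefficient is the origin of the binary
  entropy.\<close>

lemma type_val_sum:
  assumes "tolerance E" "tolerance F"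
  shows "type_val (rel_sum E F) (image_mset Inl M + image_mset Inr N) =
    real ((size M + size N) choose size M) * (type_val E M * type_val F N)"
proof -
  have T: "tolerance (list_all2 E)" "tolerance (list_all2 F)" "tolerance (list_all2 (rel_sum E F))"
    using assms by (simp_all add: tolerance_list_all2 tolerance_rel_sum)
  let ?V = "permutations_of_multiset (image_mset Inl M + image_mset Inr N)"
    and ?Z = "permutations_of_multiset (replicate_mset (size M) True + replicate_mset (size N) False)"
    and ?M = "permutations_of_multiset M" and ?N = "permutations_of_multiset N"
    and ?R = "rel_prod (=) (rel_prod (list_all2 E) (list_all2 F))"
  have R: "tolerance ?R" using T by (intro tolerance_rel_prod tolerance_eq)
  have im: "split_sum ` ?V = ?Z \<times> ?M \<times> ?N" by (rule split_sum_image)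
  have "type_val (rel_sum E F) (image_mset Inl M + image_mset Inr N) = val (?Z \<times> ?M \<times> ?N) ?R"
    unfolding type_val_def
  proof (rule antisym)
    show "val ?V (list_all2 (rel_sum E F)) \<le> val (?Z \<times> ?M \<times> ?N) ?R"
      by (rule val_mono_map[where \<phi> = split_sum]) (use T R im in \<open>auto simp: split_sum_rel\<close>)
    show "val (?Z \<times> ?M \<times> ?N) ?R \<le> val ?V (list_all2 (rel_sum E F))"
      by (rule val_image_le[where \<psi> = split_sum]) (use T R im in \<open>auto simp: split_sum_rel\<close>)
  qed
  also have "\<dots> = val ?Z (=) * val (?M \<times> ?N) (rel_prod (list_all2 E) (list_all2 F))"
    using T by (intro val_prod tolerance_rel_prod tolerance_eq) auto
  also have "val ?Z (=) = real ((size M + size N) choose size M)"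
    by (simp add: val_eq card_perms_bool)
  also have "val (?M \<times> ?N) (rel_prod (list_all2 E) (list_all2 F)) = type_val E M * type_val F N"
    unfolding type_val_def using T by (intro val_prod) auto
  finally show ?thesis .
qed

lemma val_strings:
  assumes "finite X" "tolerance E"
  shows "val {xs. set xs \<subseteq> X \<and> length xs = n} (list_all2 E) = val X E ^ n"
proof (induction n)
  case 0
  have "{xs. set xs \<subseteq> X \<and> length xs = 0} = {[]}" by auto
  then show ?case using assms by (simp add: val_singleton tolerance_list_all2)
next
  case (Suc n)
  let ?S = "\<lambda>n. {xs. set xs \<subseteq> X \<and> length xs = n}"
  have "val X E * val (?S n) (list_all2 E) = val (X \<times> ?S n) (rel_prod E (list_all2 E))"
    using assms by (intro val_prod[symmetric] tolerance_list_all2 finite_lists_length_eq)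
  also have "\<dots> = val (?S (Suc n)) (list_all2 E)"
  proof (rule val_iso)
    show "bij_betw (\<lambda>(x, xs). x # xs) (X \<times> ?S n) (?S (Suc n))"
      by (rule bij_betw_byWitness[where f' = "\<lambda>xs. (hd xs, tl xs)"]) (auto simp: length_Suc_conv)
  qed auto
  finally show ?case using Suc by simp
qed

lemma type_val_le_power:
  assumes "finite X" "tolerance E" "set_mset M \<subseteq> X"
  shows "type_val E M \<le> val X E ^ size M"
proof -
  have "type_val E M \<le> val {xs. set xs \<subseteq> X \<and> length xs = size M} (list_all2 E)"
    unfolding type_val_def using assms
    by (intro val_mono tolerance_list_all2 finite_lists_length_eq)
       (auto simp: permutations_of_multiset_def)
  then show ?thesis using assms by (simp add: val_strings)
qed

text \<open>A string of type \<open>M + N\<close> is determined by the positions of the letters of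
  \<open>N\<close>, the word they form, and a string of type \<open>M\<close>. The three factors
  bound these choices.\<close>

lemma type_val_add_le:
  assumes "finite X" "tolerance E" "set_mset N \<subseteq> X"
  shows "type_val E (M + N) \<le>
    real ((size M + size N) choose size N) * real (card X) ^ size N * type_val E M"
proof -
  have "type_val E (M + N) = type_val E (image_mset (case_sum id id) (image_mset Inl M + image_mset Inr N))"
    by (simp add: image_mset.compositionality o_def)
  \<comment> \<open>The inserted letters carry only the relation \<open>(=)\<close>, the smallest
    tolerance. Merging the two sides then preserves the relation because \<open>E\<close> is
    reflexive, and the contribution of the inserted letters becomes a cardinality.\<close>
  also have "\<dots> \<le> type_val (rel_sum E (=)) (image_mset Inl M + image_mset Inr N)"
    by (intro type_val_image_le tolerance_rel_sum tolerance_eq assms)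
       (auto elim!: rel_sum.cases intro: tolerance_refl[OF assms(2)])
  also have "\<dots> = real ((size M + size N) choose size M) * (type_val E M * type_val (=) N)"
    by (intro type_val_sum tolerance_eq assms)
  also have "\<dots> \<le> real ((size M + size N) choose size M) * (type_val E M * real (card X) ^ size N)"
    using type_val_le_power[OF assms(1) tolerance_eq assms(3)] type_val_pos[OF assms(2), of M]
    by (intro mult_left_mono) (simp_all add: val_eq assms)
  also have "(size M + size N) choose size M = (size M + size N) choose size N"
    by (simp add: binomial_symmetric[of "size M"])
  finally show ?thesis by (simp add: mult_ac)
qed

end

section \<open>Exponents\<close>

text \<open>A single term of the binomial expansion of \<open>(1 + t) ^ n\<close>. With a small
  fixed \<open>t\<close> it replaces the entropy estimate for binomial coefficients with small
  \<open>k / n\<close>.\<close>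

lemma binomial_times_power_le:
  fixes t :: real
  assumes "0 \<le> t" "k \<le> n"
  shows "real (n choose k) * t ^ k \<le> (1 + t) ^ n"
proof -
  have "real (n choose k) * t ^ k \<le> (\<Sum>i\<le>n. real (n choose i) * t ^ i)"
    using assms by (intro member_le_sum) auto
  also have "\<dots> = (1 + t) ^ n"
    using binomial_ring[of t 1 n] by (simp add: add.commute)
  finally show ?thesis .
qed

text \<open>The limit is the supremum of the quotients. For fixed \<open>m\<close>, cutting
  \<open>n\<close> into \<open>n div m\<close> blocks and discarding the remainder by nonnegativity
  gives \<open>v n / n \<ge> v m / m - v m / n\<close>.\<close>

lemma superadditive_convergent:
  fixes v :: "nat \<Rightarrow> real"
  assumes super: "\<And>m n. v m + v n \<le> v (m + n)" and nonneg: "\<And>n. 0 \<le> v n"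
    and bound: "\<And>n. v n \<le> C * real n"
  shows "convergent (\<lambda>n. v n / real n)"
proof -
  define L where "L = (SUP n\<in>{1..}. v n / real n)"
  have bdd: "bdd_above ((\<lambda>n. v n / real n) ` {1..})"
    using bound by (intro bdd_aboveI[of _ C]) (auto simp: field_simps)
  have upper: "v n / real n \<le> L" if "n \<ge> 1" for n
    unfolding L_def using bdd that by (intro cSUP_upper) auto
  have mult: "real q * v m \<le> v (q * m + r)" for q m r
  proof (induction q)
    case (Suc q)
    then show ?case using super[of m "q * m + r"] by (simp add: algebra_simps)
  qed (simp add: nonneg)
  have "(\<lambda>n. v n / real n) \<longlonglongrightarrow> L"
  proof (rule order_tendstoI)
    fix a assume "a < L"
    then obtain m where m: "m \<ge> 1" "a < v m / real m"
      unfolding L_def using bdd by (auto simp: less_cSUP_iff)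
    have "((\<lambda>n. v m / real m - v m / real n) \<longlongrightarrow> v m / real m - 0) sequentially"
      by (intro tendsto_intros tendsto_divide_0[OF tendsto_const] filterlim_real_at_infinity_sequentially)
    then have "eventually (\<lambda>n. a < v m / real m - v m / real n) sequentially"
      using m by (intro order_tendstoD(1)) auto
    then show "eventually (\<lambda>n. a < v n / real n) sequentially"
      using eventually_gt_at_top[of 0]
    proof eventually_elim
      case (elim n)
      have "real n < real (n div m + 1) * real m"
      proof -
        have "n < (n div m + 1) * m"
          using m(1) dividend_less_div_times[of m n] by (simp add: algebra_simps)
        then show ?thesis by (metis of_nat_less_iff of_nat_mult)
      qed
      then have "(real n / real m - 1) * v m \<le> real (n div m) * v m"
        using m nonneg by (intro mult_right_mono) (auto simp: field_simps)
      also have "\<dots> \<le> v n" using mult[of "n div m" m "n mod m"] by simp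
      finally have "(real n / real m - 1) * v m / real n \<le> v n / real n"
        by (intro divide_right_mono) auto
      moreover have "(real n / real m - 1) * v m / real n = v m / real m - v m / real n"
        using elim(2) m by (simp add: field_simps)
      ultimately have "v m / real m - v m / real n \<le> v n / real n" by simp
      with elim(1) show ?case by simp
    qed
  next
    fix a assume "L < a"
    show "eventually (\<lambda>n. v n / real n < a) sequentially"
      using eventually_ge_at_top[of 1] by eventually_elim (use upper \<open>L < a\<close> in force)
  qed
  then show ?thesis by (auto simp: convergent_def)
qed

section \<open>Types approximating a weight function\<close>

definition floor_mset :: "'a set \<Rightarrow> ('a \<Rightarrow> real) \<Rightarrow> nat \<Rightarrow> 'a multiset" where
  "floor_mset X p n = (\<Sum>x\<in>X. replicate_mset (nat \<lfloor>real n * p x\<rfloor>) x)"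

lemma count_floor_mset:
  "finite X \<Longrightarrow> count (floor_mset X p n) x = (if x \<in> X then nat \<lfloor>real n * p x\<rfloor> else 0)"
  unfolding floor_mset_def by (simp add: count_sum)

lemma set_floor_mset: "finite X \<Longrightarrow> set_mset (floor_mset X p n) \<subseteq> X"
  by (auto simp: count_floor_mset simp flip: count_greater_zero_iff split: if_splits)

lemma size_eq_sum_count:
  assumes "finite X" "set_mset M \<subseteq> X"
  shows "size M = (\<Sum>x\<in>X. count M x)"
  unfolding size_multiset_overloaded_eq using assms
  by (intro sum.mono_neutral_left) (auto simp: not_in_iff)

lemma size_floor_mset:
  assumes "finite X"
  shows "size (floor_mset X p n) = (\<Sum>x\<in>X. nat \<lfloor>real n * p x\<rfloor>)"
  using size_eq_sum_count[OF assms set_floor_mset[OF assms]] assms by (simp add: count_floor_mset)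

text \<open>Rounding down is superadditive letter by letter. This is the reason for using floors
  instead of a rounding that preserves the total size, which would not give an inclusion of
  multisets.\<close>

lemma floor_mset_add:
  assumes "finite X"
  shows "floor_mset X p m + floor_mset X p n \<subseteq># floor_mset X p (m + n)"
proof (rule mset_subset_eqI)
  fix x show "count (floor_mset X p m + floor_mset X p n) x \<le> count (floor_mset X p (m + n)) x"
  proof -
    have "nat \<lfloor>real m * p x\<rfloor> + nat \<lfloor>real n * p x\<rfloor> \<le> nat \<lfloor>real (m + n) * p x\<rfloor>"
    proof (cases "p x \<ge> 0")
      case True
      have "\<lfloor>real m * p x\<rfloor> + \<lfloor>real n * p x\<rfloor> \<le> \<lfloor>real (m + n) * p x\<rfloor>"
        by (simp add: algebra_simps le_floor_add)
      with True show ?thesis by (simp add: nat_add_distrib[symmetric])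
    next
      case False
      then have "\<lfloor>real k * p x\<rfloor> \<le> 0" for k
        using mult_nonneg_nonpos[of "real k" "p x"] by linarith
      then show ?thesis by (metis add_0 le0 nat_le_0)
    qed
    with assms show ?thesis by (simp add: count_floor_mset)
  qed
qed

lemma nat_floor_tendsto:
  assumes "0 \<le> q"
  shows "((\<lambda>n. real (nat \<lfloor>real n * q\<rfloor>) / real n) \<longlongrightarrow> q) sequentially"
proof (rule tendsto_sandwich)
  show "((\<lambda>n. q - 1 / real n) \<longlongrightarrow> q) sequentially"
    using tendsto_diff[OF tendsto_const lim_1_over_n, of q] by simp
  show "((\<lambda>n. q) \<longlongrightarrow> q) sequentially" by simp
  have *: "real n * q - 1 \<le> real (nat \<lfloor>real n * q\<rfloor>)" "real (nat \<lfloor>real n * q\<rfloor>) \<le> real n * q" for n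
    using assms by linarith (simp add: assms of_nat_floor)
  show "eventually (\<lambda>n. q - 1 / real n \<le> real (nat \<lfloor>real n * q\<rfloor>) / real n) sequentially"
    using eventually_gt_at_top[of 0]
  proof eventually_elim
    case (elim n)
    then show ?case using divide_right_mono[OF *(1)[of n], of "real n"] by (simp add: diff_divide_distrib)
  qed
  show "eventually (\<lambda>n. real (nat \<lfloor>real n * q\<rfloor>) / real n \<le> q) sequentially"
    using eventually_gt_at_top[of 0]
  proof eventually_elim
    case (elim n)
    then show ?case using divide_right_mono[OF *(2)[of n], of "real n"] by simp
  qed
qed

lemma count_floor_mset_tendsto:
  assumes "finite X" "x \<in> X" "0 \<le> p x"
  shows "((\<lambda>n. real (count (floor_mset X p n) x) / real n) \<longlongrightarrow> p x) sequentially"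
  using nat_floor_tendsto[OF assms(3)] assms by (simp add: count_floor_mset)

section \<open>Continuity of type class values and existence of the exponent\<close>

context spectral_point
begin

text \<open>Types that differ in few letters have values that differ by a small exponential factor: inserting
  the missing letters costs at most the number of ways to place them.\<close>

lemma type_val_continuous:
  assumes X: "finite X" and E: "tolerance E" and "0 < c" "0 < \<theta>"
  obtains \<delta> where "0 < \<delta>"
    "\<And>n M N. set_mset N \<subseteq> X \<Longrightarrow> real (size N) \<le> c * n \<Longrightarrow> real (size (N - M)) \<le> \<delta> * n \<Longrightarrow>
       ln (type_val E N) \<le> ln (type_val E M) + \<theta> * n"
proof -
  \<comment> \<open>With \<open>k\<close> inserted letters the logarithm of the cost is at most
    \<open>size N * ln (1 + t) + k * L\<close>. The choice of \<open>t\<close> makes the first term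
    at most half of \<open>\<theta> * n\<close>; with \<open>L\<close> then fixed, the bound
    \<open>\<theta> / (2 * L)\<close> on \<open>k / n\<close> does the same for the second. The
    maximum in \<open>K\<close> keeps \<open>ln K\<close> nonnegative even for empty
    \<open>X\<close>.\<close>
  define t where "t = min (1/2) (\<theta> / (2 * c))"
  define K where "K = max 1 (real (card X))"
  define L where "L = ln K - ln t"
  have t: "0 < t" "t < 1" "c * t \<le> \<theta> / 2"
    using assms by (auto simp: t_def min_def field_simps)
  have K: "1 \<le> K" "real (card X) \<le> K" by (auto simp: K_def)
  have L: "L > 0" using t K by (simp add: L_def ln_ge_zero add_strict_increasing2)
  show thesis
  proof (rule that[of "\<theta> / (2 * L)"])
    show "0 < \<theta> / (2 * L)" using L assms by simp
    fix n M N
    assume N: "set_mset N \<subseteq> X" and s: "real (size N) \<le> c * n" and k: "real (size (N - M)) \<le> \<theta> / (2 * L) * n"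
    let ?k = "size (N - M)" and ?I = "N \<inter># M"
    have n: "0 \<le> n" using s \<open>0 < c\<close> by (metis mult_le_cancel_left_pos mult_zero_right of_nat_0_le_iff order_trans)
    \<comment> \<open>\<open>N\<close> is rebuilt from its common part with \<open>M\<close>. Only
      letters of \<open>N\<close> missing from \<open>M\<close> are inserted; surplus letters of
      \<open>M\<close> cost nothing, by monotonicity.\<close>
    have NI: "N = ?I + (N - M)"
      by (auto simp: multiset_eq_iff min_def)
    have size: "size ?I + ?k = size N" by (metis NI size_union)
    have "set_mset (N - M) \<subseteq> X" using N by (meson in_diffD subset_iff)
    from type_val_add_le[OF X E this, of ?I]
    have "type_val E N \<le> real (size N choose ?k) * real (card X) ^ ?k * type_val E ?I"
      using NI size by simp
    also have "\<dots> \<le> ((1 + t) ^ size N / t ^ ?k) * K ^ ?k * type_val E ?I"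
    proof (intro mult_right_mono mult_mono power_mono)
      show "real (size N choose ?k) \<le> (1 + t) ^ size N / t ^ ?k"
        using binomial_times_power_le[of t ?k "size N"] t size by (simp add: field_simps)
    qed (use t K type_val_pos[OF E, of ?I] in auto)
    also have "\<dots> \<le> ((1 + t) ^ size N / t ^ ?k) * K ^ ?k * type_val E M"
      using t K E by (intro mult_left_mono type_val_mono) auto
    finally have "ln (type_val E N) \<le> ln (((1 + t) ^ size N / t ^ ?k) * K ^ ?k * type_val E M)"
      using type_val_pos[OF E, of N] by simp
    also have "\<dots> = real (size N) * ln (1 + t) + real ?k * L + ln (type_val E M)"
      using t K type_val_pos[OF E, of M]
      by (simp add: ln_mult ln_div ln_realpow L_def algebra_simps)
    also have "\<dots> \<le> c * n * t + \<theta> / (2 * L) * n * L + ln (type_val E M)"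
      using s k L t n \<open>0 < c\<close>
      by (intro add_mono mult_mono mult_right_mono ln_add_one_self_le_self order.refl) auto
    also have "\<dots> \<le> \<theta> / 2 * n + \<theta> / 2 * n + ln (type_val E M)"
      using t(3) n L mult_right_mono[OF t(3) n] by (simp add: algebra_simps)
    finally show "ln (type_val E N) \<le> ln (type_val E M) + \<theta> * n" by simp
  qed
qed

text \<open>Types with the same limiting frequencies differ by sublinearly many letters in either
  direction, so continuity applies both ways. The general filter and the separate length
  \<open>nn\<close> allow subsequences and rescaled lengths.\<close>

lemma type_val_diff_tendsto:
  fixes M N :: "'i \<Rightarrow> 'v multiset" and nn :: "'i \<Rightarrow> nat"
  assumes X: "finite X" and E: "tolerance E" and nn: "filterlim nn at_top F"
    and M: "\<And>i. set_mset (M i) \<subseteq> X" "\<And>x. x \<in> X \<Longrightarrow> ((\<lambda>i. real (count (M i) x) / real (nn i)) \<longlongrightarrow> p x) F"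
    and N: "\<And>i. set_mset (N i) \<subseteq> X" "\<And>x. x \<in> X \<Longrightarrow> ((\<lambda>i. real (count (N i) x) / real (nn i)) \<longlongrightarrow> p x) F"
  shows "((\<lambda>i. ln (type_val E (M i)) / real (nn i) - ln (type_val E (N i)) / real (nn i)) \<longlongrightarrow> 0) F"
proof -
  \<comment> \<open>Any positive number above the total weight would do: sizes are then eventually
    at most \<open>c * nn i\<close>.\<close>
  define c where "c = \<bar>\<Sum>x\<in>X. p x\<bar> + 1"
  have c: "0 < c" "(\<Sum>x\<in>X. p x) < c" by (auto simp: c_def)
  have pos: "eventually (\<lambda>i. nn i > 0) F"
    using filterlim_at_top[THEN iffD1, OF nn, rule_format, of 1] by (simp add: Suc_le_eq)
  have size_bound: "eventually (\<lambda>i. real (size (M i)) \<le> c * real (nn i)) F"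
    if M: "\<And>i. set_mset (M i) \<subseteq> X" "\<And>x. x \<in> X \<Longrightarrow> ((\<lambda>i. real (count (M i) x) / real (nn i)) \<longlongrightarrow> p x) F"
    for M :: "'i \<Rightarrow> 'v multiset"
  proof -
    have "((\<lambda>i. (\<Sum>x\<in>X. real (count (M i) x) / real (nn i))) \<longlongrightarrow> (\<Sum>x\<in>X. p x)) F"
      by (intro tendsto_sum M)
    then have "eventually (\<lambda>i. (\<Sum>x\<in>X. real (count (M i) x) / real (nn i)) < c) F"
      using c(2) by (rule order_tendstoD)
    with pos show ?thesis
      by eventually_elim
        (simp add: size_eq_sum_count[OF X M(1)] field_simps flip: sum_divide_distrib)
  qed
  have diff_bound: "eventually (\<lambda>i. real (size (M i - N i)) \<le> \<delta> * real (nn i)) F"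
    if \<delta>: "0 < \<delta>"
      and M: "\<And>i. set_mset (M i) \<subseteq> X" "\<And>x. x \<in> X \<Longrightarrow> ((\<lambda>i. real (count (M i) x) / real (nn i)) \<longlongrightarrow> p x) F"
      and N: "\<And>i. set_mset (N i) \<subseteq> X" "\<And>x. x \<in> X \<Longrightarrow> ((\<lambda>i. real (count (N i) x) / real (nn i)) \<longlongrightarrow> p x) F"
    for \<delta> and M N :: "'i \<Rightarrow> 'v multiset"
  proof -
    have "((\<lambda>i. (\<Sum>x\<in>X. \<bar>real (count (M i) x) / real (nn i) - real (count (N i) x) / real (nn i)\<bar>)) \<longlongrightarrow>
        (\<Sum>x\<in>X. \<bar>p x - p x\<bar>)) F"
      by (intro tendsto_sum tendsto_rabs tendsto_diff M N)
    then have "eventually (\<lambda>i. (\<Sum>x\<in>X. \<bar>real (count (M i) x) / real (nn i) - real (count (N i) x) / real (nn i)\<bar>) < \<delta>) F"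
      using \<delta> by (intro order_tendstoD(2)) auto
    with pos show ?thesis
    proof eventually_elim
      case (elim i)
      have "set_mset (M i - N i) \<subseteq> X" using M(1) by (meson in_diffD subset_iff)
      then have "real (size (M i - N i)) = (\<Sum>x\<in>X. real (count (M i) x - count (N i) x))"
        by (simp add: size_eq_sum_count[OF X])
      also have "\<dots> \<le> (\<Sum>x\<in>X. real (nn i) * \<bar>real (count (M i) x) / real (nn i) - real (count (N i) x) / real (nn i)\<bar>)"
      proof (rule sum_mono)
        fix x
        have "real (count (M i) x - count (N i) x) \<le> \<bar>real (count (M i) x) - real (count (N i) x)\<bar>" by linarith
        also have "\<dots> = real (nn i) * \<bar>real (count (M i) x) / real (nn i) - real (count (N i) x) / real (nn i)\<bar>"
          using elim(1) by (simp add: abs_divide flip: diff_divide_distrib)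
        finally show "real (count (M i) x - count (N i) x) \<le>
          real (nn i) * \<bar>real (count (M i) x) / real (nn i) - real (count (N i) x) / real (nn i)\<bar>" .
      qed
      also have "\<dots> \<le> real (nn i) * \<delta>"
        using elim by (simp flip: sum_distrib_left)
      finally show ?case by (simp add: mult.commute)
    qed
  qed
  show ?thesis
  proof (rule tendstoI)
    fix e :: real assume "e > 0"
    then obtain \<delta> where \<delta>: "0 < \<delta>"
      "\<And>n M N. set_mset N \<subseteq> X \<Longrightarrow> real (size N) \<le> c * n \<Longrightarrow> real (size (N - M)) \<le> \<delta> * n \<Longrightarrow>
         ln (type_val E N) \<le> ln (type_val E M) + (e / 2) * n"
      using type_val_continuous[OF X E c(1), of "e / 2"] by auto
    have "eventually (\<lambda>i. real (size (M i)) \<le> c * real (nn i)) F"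
      "eventually (\<lambda>i. real (size (N i)) \<le> c * real (nn i)) F"
      "eventually (\<lambda>i. real (size (M i - N i)) \<le> \<delta> * real (nn i)) F"
      "eventually (\<lambda>i. real (size (N i - M i)) \<le> \<delta> * real (nn i)) F"
      by (intro size_bound diff_bound \<delta>(1) M N; assumption)+
    with pos show "eventually (\<lambda>i. dist (ln (type_val E (M i)) / real (nn i) - ln (type_val E (N i)) / real (nn i)) 0 < e) F"
    proof eventually_elim
      case (elim i)
      have "\<bar>ln (type_val E (M i)) - ln (type_val E (N i))\<bar> \<le> (e / 2) * real (nn i)"
        using \<delta>(2)[OF M(1) elim(2,4)] \<delta>(2)[OF N(1) elim(3,5)] by linarith
      also have "\<dots> < e * real (nn i)" using elim(1) \<open>e > 0\<close> by simp
      finally show ?case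
        using elim(1) by (simp add: dist_norm field_simps flip: diff_divide_distrib)
    qed
  qed
qed

definition exponent :: "('v \<Rightarrow> 'v \<Rightarrow> bool) \<Rightarrow> 'v set \<Rightarrow> ('v \<Rightarrow> real) \<Rightarrow> real" where
  "exponent E X p = lim (\<lambda>n. ln (type_val E (floor_mset X p n)) / real n)"

text \<open>The floors at \<open>m\<close> and \<open>n\<close> only sit inside the floor at
  \<open>m + n\<close>, so superadditivity of the logarithms combines concatenation with
  monotonicity. In the linear bound, the maximum with 1 covers the empty \<open>X\<close>, whose
  value is 0.\<close>

lemma floor_mset_tendsto_exponent:
  assumes X: "finite X" and E: "tolerance E" and p: "\<And>x. x \<in> X \<Longrightarrow> 0 \<le> p x"
  shows "(\<lambda>n. ln (type_val E (floor_mset X p n)) / real n) \<longlonglongrightarrow> exponent E X p"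
  unfolding exponent_def convergent_LIMSEQ_iff[symmetric]
proof (rule superadditive_convergent)
  let ?v = "\<lambda>n. ln (type_val E (floor_mset X p n))"
  fix m n
  have "?v m + ?v n = ln (type_val E (floor_mset X p m) * type_val E (floor_mset X p n))"
    using type_val_pos[OF E] by (simp add: ln_mult_pos)
  also have "\<dots> \<le> ?v (m + n)"
    using type_val_pos[OF E] type_val_add[OF E] type_val_mono[OF E floor_mset_add[OF X]]
    by (metis (no_types, lifting) ln_le_cancel_iff mult_pos_pos order_trans)
  finally show "?v m + ?v n \<le> ?v (m + n)" .
  show "0 \<le> ?v n" using type_val_ge_1[OF E] by simp
  let ?K = "max 1 (val X E)" and ?s = "\<Sum>x\<in>X. p x"
  have size: "real (size (floor_mset X p n)) \<le> ?s * real n"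
  proof -
    have "real (nat \<lfloor>real n * p x\<rfloor>) \<le> real n * p x" if "x \<in> X" for x
      using p[OF that] by (simp add: of_nat_floor)
    then have "(\<Sum>x\<in>X. real (nat \<lfloor>real n * p x\<rfloor>)) \<le> (\<Sum>x\<in>X. real n * p x)"
      by (rule sum_mono)
    then show ?thesis using X by (simp add: size_floor_mset sum_distrib_left mult.commute)
  qed
  have "type_val E (floor_mset X p n) \<le> val X E ^ size (floor_mset X p n)"
    by (intro type_val_le_power X E set_floor_mset)
  also have "\<dots> \<le> ?K ^ size (floor_mset X p n)"
    using val_nonneg[OF X E] by (intro power_mono) auto
  finally have "?v n \<le> ln (?K ^ size (floor_mset X p n))"
    using type_val_pos[OF E] by (simp add: max_def)
  also have "\<dots> = real (size (floor_mset X p n)) * ln ?K" by (simp add: ln_realpow)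
  also have "\<dots> \<le> (?s * real n) * ln ?K"
    using size by (intro mult_right_mono) (auto simp: ln_ge_zero)
  finally show "?v n \<le> (?s * ln ?K) * real n" by (simp add: mult_ac)
qed

theorem type_val_tendsto_exponent:
  fixes M :: "'i \<Rightarrow> 'v multiset" and nn :: "'i \<Rightarrow> nat"
  assumes X: "finite X" and E: "tolerance E" and nn: "filterlim nn at_top F"
    and p: "\<And>x. x \<in> X \<Longrightarrow> 0 \<le> p x"
    and M: "\<And>i. set_mset (M i) \<subseteq> X" "\<And>x. x \<in> X \<Longrightarrow> ((\<lambda>i. real (count (M i) x) / real (nn i)) \<longlongrightarrow> p x) F"
  shows "((\<lambda>i. ln (type_val E (M i)) / real (nn i)) \<longlongrightarrow> exponent E X p) F"
proof -
  let ?N = "\<lambda>i. floor_mset X p (nn i)"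
  have "((\<lambda>i. ln (type_val E (?N i)) / real (nn i)) \<longlongrightarrow> exponent E X p) F"
    using filterlim_compose[OF floor_mset_tendsto_exponent[OF X E p] nn] by simp
  moreover have "((\<lambda>i. ln (type_val E (M i)) / real (nn i) - ln (type_val E (?N i)) / real (nn i)) \<longlongrightarrow> 0) F"
    using filterlim_compose[OF count_floor_mset_tendsto[OF X] nn] p
    by (intro type_val_diff_tendsto[OF X E nn M] set_floor_mset[OF X]) auto
  ultimately show ?thesis
    using tendsto_add by fastforce
qed

text \<open>The types for \<open>p\<close> at length \<open>\<lfloor>n * t\<rfloor>\<close> are
  approximate types for \<open>t * p\<close> at length \<open>n\<close>. Measuring the same
  logarithms against either length yields the two sides.\<close>

lemma exponent_scale:
  assumes X: "finite X" and E: "tolerance E" and p: "\<And>x. x \<in> X \<Longrightarrow> 0 \<le> p x" and "0 \<le> t"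
  shows "exponent E X (\<lambda>x. t * p x) = t * exponent E X p"
\<comment> \<open>For \<open>t = 0\<close> the rescaled lengths do not tend to infinity; here all
  types are empty and have value 1.\<close>
proof (cases "t = 0")
  case True
  have "floor_mset X (\<lambda>x. 0) n = {#}" for n by (simp add: floor_mset_def)
  then show ?thesis using True type_val_empty[OF E] by (simp add: exponent_def)
next
  case False
  with \<open>0 \<le> t\<close> have t: "0 < t" by simp
  let ?m = "\<lambda>n. nat \<lfloor>real n * t\<rfloor>"
  have m: "filterlim ?m at_top sequentially"
    using t by (intro filterlim_compose[OF filterlim_nat_sequentially] filterlim_compose[OF filterlim_floor_sequentially]
      filterlim_at_top_mult_tendsto_pos[OF tendsto_const] filterlim_real_sequentially)
  have mt: "(\<lambda>n. real (?m n) / real n) \<longlonglongrightarrow> t" using t by (intro nat_floor_tendsto) simp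
  have mpos: "eventually (\<lambda>n. ?m n > 0) sequentially"     using filterlim_at_top[THEN iffD1, OF m, rule_format, of 1] by (simp only: Suc_le_eq One_nat_def)
  have cancel: "0 < k \<Longrightarrow> real k / b * (a / real k) = a / b" for k :: nat and a b :: real by simp
  have "(\<lambda>n. ln (type_val E (floor_mset X p (?m n))) / real n) \<longlonglongrightarrow> exponent E X (\<lambda>x. t * p x)"
  proof (rule type_val_tendsto_exponent[OF X E filterlim_ident])
    fix x assume x: "x \<in> X"
    have "(\<lambda>n. (real (?m n) / real n) * (real (count (floor_mset X p (?m n)) x) / real (?m n))) \<longlonglongrightarrow> t * p x"
      by (intro tendsto_mult mt filterlim_compose[OF count_floor_mset_tendsto[where X = X and p = p and x = x] m]
          X x p[OF x])
    then show "(\<lambda>n. real (count (floor_mset X p (?m n)) x) / real n) \<longlonglongrightarrow> t * p x"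
      by (rule Lim_transform_eventually) (rule eventually_mono[OF mpos], rule cancel)
  qed (use p t set_floor_mset[OF X] in auto)
  moreover have "(\<lambda>n. ln (type_val E (floor_mset X p (?m n))) / real n) \<longlonglongrightarrow> t * exponent E X p"
  proof -
    have "(\<lambda>n. (real (?m n) / real n) * (ln (type_val E (floor_mset X p (?m n))) / real (?m n))) \<longlonglongrightarrow> t * exponent E X p"
      by (intro tendsto_mult mt filterlim_compose[OF floor_mset_tendsto_exponent[OF X E p] m])
    then show ?thesis
      by (rule Lim_transform_eventually) (rule eventually_mono[OF mpos], rule cancel)
  qed
  ultimately show ?thesis by (rule LIMSEQ_unique)
qed

end

section \<open>Sizes of type classes and coverings by translates\<close>

text \<open>Continuity of \<open>x * ln x\<close> up to 0, where the convention
  \<open>ln 0 = 0\<close> gives the right value. This is what lets letters of probability zero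
  appear in the entropy limits.\<close>

lemma xlnx_tendsto:
  fixes g :: "'i \<Rightarrow> real"
  assumes g: "(g \<longlongrightarrow> p) F" and nonneg: "\<And>i. 0 \<le> g i"
  shows "((\<lambda>i. g i * ln (g i)) \<longlongrightarrow> p * ln p) F"
proof (cases "p = 0")
  case False
  then show ?thesis using g by (intro tendsto_intros)
next
  case True
  have bound: "\<bar>x * ln x\<bar> \<le> 2 * sqrt x" if "0 \<le> x" "x \<le> 1" for x :: real
  proof (cases "x = 0")
    case False
    with that have x: "0 < x" by simp
    \<comment> \<open>Writing \<open>x\<close> as the square of its root and applying
      \<open>ln y \<le> y - 1\<close> to \<open>y = 1 / sqrt x\<close> trades the logarithm for a
      power that \<open>x\<close> dominates.\<close>
    have "- ln x = 2 * ln (1 / sqrt x)" using x by (simp add: ln_div ln_sqrt)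
    also have "\<dots> \<le> 2 * (1 / sqrt x)"
      using x ln_le_minus_one[of "1 / sqrt x"] by simp
    finally have "x * (- ln x) \<le> x * (2 * (1 / sqrt x))" using x by (intro mult_left_mono) auto
    also have "\<dots> = 2 * (x / sqrt x)" by simp
    also have "\<dots> = 2 * sqrt x" using x by (simp only: real_div_sqrt less_imp_le)
    finally show ?thesis using x that by (simp add: abs_mult)
  qed simp
  have "((\<lambda>i. 2 * sqrt (g i)) \<longlongrightarrow> 2 * sqrt p) F" using g by (intro tendsto_intros)
  then have "((\<lambda>i. 2 * sqrt (g i)) \<longlongrightarrow> 0) F" using True by simp
  moreover have "eventually (\<lambda>i. norm (g i * ln (g i)) \<le> 2 * sqrt (g i)) F"
    using order_tendstoD(2)[OF g, of 1] True
    by (auto elim!: eventually_mono simp: bound nonneg less_imp_le)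
  ultimately have "((\<lambda>i. g i * ln (g i)) \<longlongrightarrow> 0) F" by (rule Lim_null_comparison[rotated])
  then show ?thesis using True by simp
qed

text \<open>A weak Stirling bound: with its upper counterpart it determines
  \<open>ln (fact k)\<close> up to a logarithmic error, which vanishes after division by the length.
  The induction step is \<open>k * ln (1 + 1 / k) \<le> 1\<close>.\<close>

lemma ln_fact_lower: "real k * ln (real k) - real k \<le> ln (fact k)"
proof (induction k)
  case (Suc k)
  have "real k * (ln (real (Suc k)) - ln (real k)) \<le> 1"
  proof (cases "k = 0")
    case False
    then have "ln (real (Suc k)) - ln (real k) = ln (1 + 1 / real k)"
      by (subst ln_divide_pos[symmetric]) (auto simp: field_simps)
    also have "\<dots> \<le> 1 / real k" by (intro ln_add_one_self_le_self) auto
    finally have "real k * (ln (real (Suc k)) - ln (real k)) \<le> real k * (1 / real k)"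
      by (intro mult_left_mono) auto
    then show ?thesis using False by simp
  qed simp
  moreover have "ln (fact (Suc k)) = ln (real (Suc k)) + ln (fact k :: real)"
    by (simp add: ln_mult_pos)
  ultimately show ?case using Suc by (simp add: algebra_simps)
qed simp

lemma ln_fact_upper: "ln (fact k) \<le> (real k + 1) * ln (real k + 1) - real k"
proof (induction k)
  case (Suc k)
  have "ln (real k + 1) - ln (real k + 2) = ln ((real k + 1) / (real k + 2))"
    by (subst ln_divide_pos[symmetric]) auto
  also have "\<dots> \<le> (real k + 1) / (real k + 2) - 1" by (intro ln_le_minus_one) auto
  also have "\<dots> = - (1 / (real k + 2))" by (simp add: field_simps)
  finally have "(real k + 2) * (ln (real k + 1) - ln (real k + 2)) \<le> (real k + 2) * - (1 / (real k + 2))"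
    by (intro mult_left_mono) auto
  then have "(real k + 2) * (ln (real k + 1) - ln (real k + 2)) \<le> - 1" by simp
  moreover have "ln (fact (Suc k)) = ln (real k + 1) + ln (fact k :: real)"
    by (simp add: ln_mult_pos add.commute)
  ultimately show ?case using Suc by (simp add: algebra_simps)
qed simp

text \<open>Without the subtraction the quotient would contain a term of order
  \<open>p * ln nn\<close>. The subtracted terms cancel in a multinomial coefficient, because the
  counts add up to the size.\<close>

lemma ln_fact_tendsto:
  fixes k nn :: "'i \<Rightarrow> nat"
  assumes nn: "filterlim nn at_top F" and k: "((\<lambda>i. real (k i) / real (nn i)) \<longlongrightarrow> p) F"
  shows "((\<lambda>i. (ln (fact (k i)) - real (k i) * ln (real (nn i))) / real (nn i)) \<longlongrightarrow> p * ln p - p) F"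
proof (rule tendsto_sandwich)
  have pos: "eventually (\<lambda>i. nn i > 0) F"
    using filterlim_at_top[THEN iffD1, OF nn, rule_format, of 1] by (simp add: Suc_le_eq)
  have inv: "((\<lambda>i. 1 / real (nn i)) \<longlongrightarrow> 0) F" and lninv: "((\<lambda>i. ln (real (nn i)) / real (nn i)) \<longlongrightarrow> 0) F"
    using filterlim_compose[OF lim_1_over_n nn] filterlim_compose[OF lim_ln_over_n nn] by auto
  let ?a = "\<lambda>i. real (k i) / real (nn i)" and ?b = "\<lambda>i. (real (k i) + 1) / real (nn i)"
  have b: "(?b \<longlongrightarrow> p) F" using tendsto_add[OF k inv] by (simp add: add_divide_distrib)
  show "((\<lambda>i. ?a i * ln (?a i) - ?a i) \<longlongrightarrow> p * ln p - p) F"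
    by (intro tendsto_diff xlnx_tendsto k) auto
  have "((\<lambda>i. ?b i * ln (?b i) - ?a i + ln (real (nn i)) / real (nn i)) \<longlongrightarrow> p * ln p - p + 0) F"
    by (intro tendsto_diff tendsto_add xlnx_tendsto k b lninv) auto
  then show "((\<lambda>i. ?b i * ln (?b i) - ?a i + ln (real (nn i)) / real (nn i)) \<longlongrightarrow> p * ln p - p) F" by simp
  show "eventually (\<lambda>i. ?a i * ln (?a i) - ?a i \<le> (ln (fact (k i)) - real (k i) * ln (real (nn i))) / real (nn i)) F"
    using pos
  proof eventually_elim
    case (elim i)
    have "?a i * ln (?a i) - ?a i = (real (k i) * ln (real (k i)) - real (k i) - real (k i) * ln (real (nn i))) / real (nn i)"
      using elim by (cases "k i = 0") (auto simp: ln_div field_simps)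
    also have "\<dots> \<le> (ln (fact (k i)) - real (k i) * ln (real (nn i))) / real (nn i)"
      using ln_fact_lower[of "k i"] by (intro divide_right_mono) auto
    finally show ?case .
  qed
  show "eventually (\<lambda>i. (ln (fact (k i)) - real (k i) * ln (real (nn i))) / real (nn i) \<le>
      ?b i * ln (?b i) - ?a i + ln (real (nn i)) / real (nn i)) F"
    using pos
  proof eventually_elim
    case (elim i)
    have "(ln (fact (k i)) - real (k i) * ln (real (nn i))) / real (nn i) \<le>
        ((real (k i) + 1) * ln (real (k i) + 1) - real (k i) - real (k i) * ln (real (nn i))) / real (nn i)"
      using ln_fact_upper[of "k i"] by (intro divide_right_mono) auto
    also have "\<dots> = ?b i * ln (?b i) - ?a i + ln (real (nn i)) / real (nn i)"
      using elim by (simp add: ln_div field_simps)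
    finally show ?case .
  qed
qed

lemma card_perms_pos: "0 < card (permutations_of_multiset M)"
  by (simp add: card_gt_0_iff)

lemma ln_card_perms:
  assumes "finite X" "set_mset M \<subseteq> X"
  shows "ln (real (card (permutations_of_multiset M))) = ln (fact (size M)) - (\<Sum>x\<in>X. ln (fact (count M x)))"
proof -
  have "(\<Prod>x\<in>set_mset M. fact (count M x) :: nat) = (\<Prod>x\<in>X. fact (count M x))"
    using assms by (intro prod.mono_neutral_left) (auto simp: not_in_iff)
  then have "card (permutations_of_multiset M) * (\<Prod>x\<in>X. fact (count M x)) = fact (size M)"
    using card_permutations_of_multiset_aux[of M] by simp
  then have "ln (real (card (permutations_of_multiset M) * (\<Prod>x\<in>X. fact (count M x)))) = ln (fact (size M))"
    by simp
  then have "ln (real (card (permutations_of_multiset M))) + ln (\<Prod>x\<in>X. fact (count M x) :: real) = ln (fact (size M))"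
    using card_perms_pos[of M] by (subst (asm) of_nat_mult, subst (asm) ln_mult_pos) (auto intro!: prod_pos)
  moreover have "ln (\<Prod>x\<in>X. fact (count M x) :: real) = (\<Sum>x\<in>X. ln (fact (count M x)))"
    using assms(1) by (intro ln_prod) auto
  ultimately show ?thesis by simp
qed

text \<open>The limit is the homogeneous extension of the entropy to weights of arbitrary total
  mass; for total mass 1 its first term vanishes. Besides the \<open>ln nn\<close> terms, the linear
  terms of the factorial limits cancel as well.\<close>

lemma ln_card_perms_tendsto:
  fixes M :: "'i \<Rightarrow> 'v multiset" and nn :: "'i \<Rightarrow> nat"
  assumes X: "finite X" and nn: "filterlim nn at_top F"
    and M: "\<And>i. set_mset (M i) \<subseteq> X" "\<And>x. x \<in> X \<Longrightarrow> ((\<lambda>i. real (count (M i) x) / real (nn i)) \<longlongrightarrow> p x) F"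
  shows "((\<lambda>i. ln (real (card (permutations_of_multiset (M i)))) / real (nn i)) \<longlongrightarrow>
    (\<Sum>x\<in>X. p x) * ln (\<Sum>x\<in>X. p x) - (\<Sum>x\<in>X. p x * ln (p x))) F"
proof -
  have size: "((\<lambda>i. real (size (M i)) / real (nn i)) \<longlongrightarrow> (\<Sum>x\<in>X. p x)) F"
    using tendsto_sum[of X, OF M(2)] by (simp add: size_eq_sum_count[OF X M(1)] sum_divide_distrib)
  let ?d = "\<lambda>k i. (ln (fact k) - real k * ln (real (nn i))) / real (nn i)"
  have "((\<lambda>i. ?d (size (M i)) i - (\<Sum>x\<in>X. ?d (count (M i) x) i)) \<longlongrightarrow>
      ((\<Sum>x\<in>X. p x) * ln (\<Sum>x\<in>X. p x) - (\<Sum>x\<in>X. p x)) - (\<Sum>x\<in>X. p x * ln (p x) - p x)) F"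
    by (intro tendsto_diff tendsto_sum ln_fact_tendsto nn size M)
  moreover have "?d (size (M i)) i - (\<Sum>x\<in>X. ?d (count (M i) x) i) =
      ln (real (card (permutations_of_multiset (M i)))) / real (nn i)" for i
    by (simp add: ln_card_perms[OF X M(1)] size_eq_sum_count[OF X M(1)] diff_divide_distrib sum_subtractf
        sum_distrib_right flip: sum_divide_distrib)
  ultimately show ?thesis by (simp add: sum_subtractf)
qed

text \<open>A random translate of \<open>W\<close> meets \<open>U\<close> in \<open>card W * card U / card \<Omega>\<close> points on average.\<close>

lemma exists_translate:
  fixes act :: "'g \<Rightarrow> 'w \<Rightarrow> 'w"
  assumes fin: "finite I" "finite \<Omega>" and ne: "I \<noteq> {}" "\<Omega> \<noteq> {}"
    and act: "\<And>i w. i \<in> I \<Longrightarrow> w \<in> \<Omega> \<Longrightarrow> act i w \<in> \<Omega>" "\<And>i. i \<in> I \<Longrightarrow> inj_on (act i) \<Omega>"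
    and unif: "\<And>w u. w \<in> \<Omega> \<Longrightarrow> u \<in> \<Omega> \<Longrightarrow> card {i \<in> I. act i w = u} = c"
    and W: "W \<subseteq> \<Omega>" and U: "U \<subseteq> \<Omega>"
  shows "\<exists>i\<in>I. card W * card U \<le> card (act i ` W \<inter> U) * card \<Omega>"
proof -
  have finW: "finite W" "finite U" using W U fin by (auto intro: finite_subset)
  \<comment> \<open>The elements of \<open>I\<close>, sorted by where they send one fixed point,
    form \<open>card \<Omega>\<close> classes of size \<open>c\<close>. Thus \<open>c\<close> is
    \<open>card I / card \<Omega>\<close>, which turns the sum below into the stated
    average.\<close>
  have I: "card I = card \<Omega> * c"
  proof -
    obtain w where w: "w \<in> \<Omega>" using ne by auto
    have "card I = card (\<Union>u\<in>\<Omega>. {i \<in> I. act i w = u})"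
      using act(1) w by (intro arg_cong[where f = card]) auto
    also have "\<dots> = (\<Sum>u\<in>\<Omega>. card {i \<in> I. act i w = u})"
      using fin by (intro card_UN_disjoint) auto
    also have "\<dots> = card \<Omega> * c" using unif[OF w] by simp
    finally show ?thesis .
  qed
  \<comment> \<open>Double counting of the pairs of a point of \<open>W\<close> and its image in
    \<open>U\<close>: with the sum over \<open>I\<close> moved inside, each pair contributes exactly
    \<open>c\<close>.\<close>
  have "(\<Sum>i\<in>I. card (act i ` W \<inter> U)) = (\<Sum>i\<in>I. card {p \<in> W \<times> U. act i (fst p) = snd p})"
  proof (rule sum.cong)
    fix i assume i: "i \<in> I"
    let ?W = "{w \<in> W. act i w \<in> U}"
    have "act i ` W \<inter> U = act i ` ?W" by auto
    moreover have "inj_on (act i) ?W"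
      by (rule inj_on_subset[OF act(2)[OF i]]) (use W in auto)
    ultimately have "card (act i ` W \<inter> U) = card ?W" by (simp add: card_image)
    also have "\<dots> = card ((\<lambda>w. (w, act i w)) ` ?W)"
      by (rule card_image[symmetric]) (simp add: inj_on_def)
    also have "(\<lambda>w. (w, act i w)) ` ?W = {p \<in> W \<times> U. act i (fst p) = snd p}" by auto
    finally show "card (act i ` W \<inter> U) = card {p \<in> W \<times> U. act i (fst p) = snd p}" .
  qed simp
  also have "\<dots> = (\<Sum>i\<in>I. \<Sum>p\<in>W \<times> U. if act i (fst p) = snd p then 1 else 0)"
    unfolding card_eq_sum using finW by (intro sum.cong[OF refl] sum.inter_filter) auto
  also have "\<dots> = (\<Sum>p\<in>W \<times> U. \<Sum>i\<in>I. if act i (fst p) = snd p then 1 else 0)"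
    by (rule sum.swap)
  also have "\<dots> = (\<Sum>p\<in>W \<times> U. card {i \<in> I. act i (fst p) = snd p})"
    unfolding card_eq_sum using fin by (intro sum.cong[OF refl] sum.inter_filter[symmetric]) auto
  also have "\<dots> = (\<Sum>p\<in>W \<times> U. c)"
    by (intro sum.cong[OF refl] unif) (use W U in auto)
  also have "\<dots> = card W * card U * c" by (simp add: card_cartesian_product)
  finally have total: "(\<Sum>i\<in>I. card (act i ` W \<inter> U)) = card W * card U * c" .
  show ?thesis
  proof (rule ccontr)
    assume "\<not> ?thesis"
    then have "(\<Sum>i\<in>I. card (act i ` W \<inter> U) * card \<Omega>) < (\<Sum>i\<in>I. card W * card U)"
      using fin ne by (intro sum_strict_mono) (auto simp: not_le)
    then have "card W * card U * c * card \<Omega> < card I * (card W * card U)"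
      by (simp flip: total sum_distrib_right)
    then show False using I by (simp add: mult_ac)
  qed
qed

text \<open>Each new translate is chosen to catch at least the fraction
  \<open>q = card W / card \<Omega>\<close> of the points still uncovered, so at most
  \<open>(1 - q) ^ N * card \<Omega>\<close> points remain after \<open>N\<close> steps. Once
  \<open>q * N\<close> exceeds \<open>ln (card \<Omega>)\<close> this is below 1, hence no point
  remains.\<close>

lemma greedy_cover:
  fixes act :: "'g \<Rightarrow> 'w \<Rightarrow> 'w"
  assumes fin: "finite I" "finite \<Omega>" and ne: "I \<noteq> {}" "W \<noteq> {}"
    and act: "\<And>i w. i \<in> I \<Longrightarrow> w \<in> \<Omega> \<Longrightarrow> act i w \<in> \<Omega>" "\<And>i. i \<in> I \<Longrightarrow> inj_on (act i) \<Omega>"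
    and unif: "\<And>w u. w \<in> \<Omega> \<Longrightarrow> u \<in> \<Omega> \<Longrightarrow> card {i \<in> I. act i w = u} = c"
    and W: "W \<subseteq> \<Omega>"
  obtains N s where "s \<in> {..<N} \<rightarrow> I" "\<Omega> \<subseteq> (\<Union>j<N. act (s j) ` W)"
    "real N \<le> real (card \<Omega>) / real (card W) * ln (real (card \<Omega>)) + 1"
proof -
  have finW: "finite W" using W fin by (auto intro: finite_subset)
  have cW: "0 < card W" "card W \<le> card \<Omega>" using finW ne W fin by (auto simp: card_gt_0_iff card_mono)
  have \<Omega>: "\<Omega> \<noteq> {}" using W ne by auto
  define q where "q = real (card W) / real (card \<Omega>)"
  have q: "0 < q" "q \<le> 1" using cW by (auto simp: q_def)
  have "\<exists>s. s \<in> {..<N} \<rightarrow> I \<and> real (card (\<Omega> - (\<Union>j<N. act (s j) ` W))) \<le> (1 - q) ^ N * real (card \<Omega>)" for N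
  proof (induction N)
    case 0
    then show ?case by simp
  next
    case (Suc N)
    then obtain s where s: "s \<in> {..<N} \<rightarrow> I"
      "real (card (\<Omega> - (\<Union>j<N. act (s j) ` W))) \<le> (1 - q) ^ N * real (card \<Omega>)" by auto
    let ?U = "\<Omega> - (\<Union>j<N. act (s j) ` W)"
    have "\<exists>i\<in>I. card W * card ?U \<le> card (act i ` W \<inter> ?U) * card \<Omega>"
      by (rule exists_translate[where act = act and U = ?U and c = c]) (use fin ne(1) \<Omega> act unif W in auto)
    then obtain i where i: "i \<in> I" "card W * card ?U \<le> card (act i ` W \<inter> ?U) * card \<Omega>" by blast
    have "real (card W) * real (card ?U) \<le> real (card (act i ` W \<inter> ?U)) * real (card \<Omega>)"
      using i(2) by (metis of_nat_le_iff of_nat_mult)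
    then have "q * real (card ?U) \<le> real (card (act i ` W \<inter> ?U))"
      using cW by (simp add: q_def field_simps)
    moreover have "card (?U - act i ` W) = card ?U - card (act i ` W \<inter> ?U)"
      using fin by (simp add: card_Diff_subset_Int Int_commute)
    moreover have "card (act i ` W \<inter> ?U) \<le> card ?U" using fin by (intro card_mono) auto
    ultimately have "real (card (?U - act i ` W)) \<le> (1 - q) * real (card ?U)"
      by (simp add: of_nat_diff algebra_simps)
    also have "\<dots> \<le> (1 - q) * ((1 - q) ^ N * real (card \<Omega>))" using s(2) q by (intro mult_left_mono) auto
    finally have "real (card (?U - act i ` W)) \<le> (1 - q) ^ Suc N * real (card \<Omega>)" by simp
    moreover have "(\<Union>j<N. act ((s(N := i)) j) ` W) = (\<Union>j<N. act (s j) ` W)"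
      by (rule SUP_cong) auto
    then have "\<Omega> - (\<Union>j<Suc N. act ((s(N := i)) j) ` W) = ?U - act i ` W"
      unfolding lessThan_Suc by (simp add: Diff_eq Int_ac)
    ultimately show ?case using s(1) i(1) by (intro exI[of _ "s(N := i)"]) (auto simp: Pi_iff less_Suc_eq)
  qed
  note ex = this
  \<comment> \<open>The \<open>+ 1\<close> makes \<open>N\<close> strictly larger than
    \<open>ln (card \<Omega>) / q\<close>; strictness pushes the number of uncovered points below
    1.\<close>
  define N where "N = nat \<lfloor>ln (real (card \<Omega>)) / q\<rfloor> + 1"
  obtain s where s: "s \<in> {..<N} \<rightarrow> I"
      "real (card (\<Omega> - (\<Union>j<N. act (s j) ` W))) \<le> (1 - q) ^ N * real (card \<Omega>)" using ex[of N] by auto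
  have ln0: "0 \<le> ln (real (card \<Omega>)) / q" using q cW by (intro divide_nonneg_pos ln_ge_zero) auto
  have "ln (real (card \<Omega>)) / q < real N" unfolding N_def using ln0 by linarith
  then have Nq: "ln (real (card \<Omega>)) < q * real N" using q by (simp add: field_simps)
  have "(1 - q) ^ N \<le> exp (- q) ^ N"
    using q exp_ge_add_one_self[of "- q"] by (intro power_mono) auto
  also have "\<dots> = exp (- (q * real N))" by (simp add: exp_of_nat_mult[symmetric] mult.commute)
  finally have "(1 - q) ^ N * real (card \<Omega>) \<le> exp (- (q * real N)) * real (card \<Omega>)"
    by (intro mult_right_mono) auto
  also have "\<dots> < exp (- ln (real (card \<Omega>))) * real (card \<Omega>)"
    using Nq cW by (intro mult_strict_right_mono) auto
  also have "\<dots> = 1" using cW by (simp add: exp_minus)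
  finally have "card (\<Omega> - (\<Union>j<N. act (s j) ` W)) = 0" using s(2) by linarith
  then have "\<Omega> \<subseteq> (\<Union>j<N. act (s j) ` W)" using fin by simp
  moreover have "real N \<le> ln (real (card \<Omega>)) / q + 1" unfolding N_def using ln0 by (simp add: of_nat_floor)
  then have "real N \<le> real (card \<Omega>) / real (card W) * ln (real (card \<Omega>)) + 1"
    by (simp add: q_def mult.commute)
  ultimately show thesis using s(1) that by blast
qed

text \<open>Composing on both sides with permutations that carry \<open>xs'\<close> to
  \<open>xs\<close> and \<open>us\<close> to \<open>us'\<close> embeds one set of permutations into
  the other. Exchanging the roles gives equality, the uniformity that \<open>greedy_cover\<close>
  asks for.\<close>

lemma card_permute_list_le:
  assumes "xs \<in> permutations_of_multiset A" "us \<in> permutations_of_multiset A"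
    "xs' \<in> permutations_of_multiset A" "us' \<in> permutations_of_multiset A"
  shows "card {\<sigma>. \<sigma> permutes {..<size A} \<and> permute_list \<sigma> xs = us} \<le>
    card {\<sigma>. \<sigma> permutes {..<size A} \<and> permute_list \<sigma> xs' = us'}"
proof -
  note len = assms[THEN length_finite_permutations_of_multiset]
  have "mset xs = mset xs'" "mset us' = mset us"
    using assms by (auto simp: permutations_of_multiset_def)
  then obtain a b where a: "a permutes {..<size A}" "permute_list a xs' = xs"
    and b: "b permutes {..<size A}" "permute_list b us = us'"
    by (metis mset_eq_permutation len(3) len(2))
  show ?thesis
  proof (rule card_inj_on_le[where f = "\<lambda>\<sigma>. a \<circ> \<sigma> \<circ> b"])
    show "inj_on (\<lambda>\<sigma>. a \<circ> \<sigma> \<circ> b) {\<sigma>. \<sigma> permutes {..<size A} \<and> permute_list \<sigma> xs = us}"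
    proof (rule inj_onI)
      fix \<sigma> \<tau> assume "a \<circ> \<sigma> \<circ> b = a \<circ> \<tau> \<circ> b"
      then have "inv a \<circ> (a \<circ> \<sigma> \<circ> b) \<circ> inv b = inv a \<circ> (a \<circ> \<tau> \<circ> b) \<circ> inv b" by simp
      moreover have "inv a \<circ> (a \<circ> \<rho> \<circ> b) \<circ> inv b = \<rho>" for \<rho>
        using a(1) b(1) by (auto simp: fun_eq_iff permutes_inverses)
      ultimately show "\<sigma> = \<tau>" by metis
    qed
    show "(\<lambda>\<sigma>. a \<circ> \<sigma> \<circ> b) ` {\<sigma>. \<sigma> permutes {..<size A} \<and> permute_list \<sigma> xs = us} \<subseteq>
        {\<sigma>. \<sigma> permutes {..<size A} \<and> permute_list \<sigma> xs' = us'}"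
    proof clarify
      fix \<sigma> assume \<sigma>: "\<sigma> permutes {..<size A}" "us = permute_list \<sigma> xs"
      have "permute_list (a \<circ> \<sigma> \<circ> b) xs' = permute_list b (permute_list \<sigma> (permute_list a xs'))"
        using a(1) b(1) \<sigma>(1) len by (simp add: permute_list_compose permutes_compose)
      then show "a \<circ> \<sigma> \<circ> b permutes {..<size A} \<and> permute_list (a \<circ> \<sigma> \<circ> b) xs' = us'"
        using a b \<sigma> by (auto intro: permutes_compose)
    qed
    have "finite {\<sigma>. \<sigma> permutes {..<size A}}" by (simp add: finite_permutations)
    then show "finite {\<sigma>. \<sigma> permutes {..<size A} \<and> permute_list \<sigma> xs' = us'}"
      by (rule rev_finite_subset) auto
  qed
qed

lemma card_permute_list_const:
  obtains c where "\<And>xs us. xs \<in> permutations_of_multiset A \<Longrightarrow> us \<in> permutations_of_multiset A \<Longrightarrow>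
    card {\<sigma>. \<sigma> permutes {..<size A} \<and> permute_list \<sigma> xs = us} = c"
proof -
  obtain as where "as \<in> permutations_of_multiset A"
    using permutations_of_multiset_not_empty by blast
  then show thesis
    by (intro that[of "card {\<sigma>. \<sigma> permutes {..<size A} \<and> permute_list \<sigma> as = as}"] antisym
        card_permute_list_le)
qed

lemma permute_list_inj:
  assumes "\<rho> permutes {..<length xs}" "length xs' = length xs" "permute_list \<rho> xs = permute_list \<rho> xs'"
  shows "xs = xs'"
  using list_all2_permute_list_iff[OF assms(1), of "(=)" xs'] assms(3) by (simp add: list.rel_eq)

lemma inj_unzip: "inj (\<lambda>zs :: ('v \<times> 'w) list. (map fst zs, map snd zs))"
proof (rule injI)
  fix zs zs' :: "('v \<times> 'w) list"
  assume "(map fst zs, map snd zs) = (map fst zs', map snd zs')"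
  then have "zip (map fst zs) (map snd zs) = zip (map fst zs') (map snd zs')" by simp
  then show "zs = zs'" by (simp only: zip_map_fst_snd)
qed

lemma card_perms_le_marginals:
  "card (permutations_of_multiset M) \<le>
     card (permutations_of_multiset (image_mset fst M)) * card (permutations_of_multiset (image_mset snd M))"
  unfolding card_cartesian_product[symmetric]
  by (rule card_inj_on_le[OF inj_on_subset[OF inj_unzip]])
     (auto simp: permutations_of_multiset_image)

section \<open>Lower bound for the joint type class\<close>

context spectral_point
begin

text \<open>Permuting coordinates preserves letterwise relations, so the \<open>N\<close> covering
  translates are the image of \<open>N\<close> mutually unrelated copies of the joint type class,
  which cost a factor \<open>N\<close>. The permutations act on the two components independently: a
  common permutation would map the joint type class to itself and cover nothing new.\<close>

lemma type_val_prod_ge: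
  fixes M :: "('v \<times> 'w) multiset"
  assumes E: "tolerance E" and F: "tolerance F"
  defines "A \<equiv> image_mset fst M" and "B \<equiv> image_mset snd M"
  defines "\<omega> \<equiv> real (card (permutations_of_multiset A)) * real (card (permutations_of_multiset B))"
  shows "type_val E A * type_val F B \<le>
    (\<omega> / real (card (permutations_of_multiset M)) * ln \<omega> + 1) * type_val (rel_prod E F) M"
proof -
  have T: "tolerance (list_all2 E)" "tolerance (list_all2 F)" "tolerance (list_all2 (rel_prod E F))"
    using assms by (simp_all add: tolerance_list_all2 tolerance_rel_prod)
  let ?A = "permutations_of_multiset A" and ?B = "permutations_of_multiset B"
  let ?n = "size M"
  have sz: "size A = ?n" "size B = ?n" by (simp_all add: A_def B_def)
  let ?S = "{\<sigma>. \<sigma> permutes {..<?n}}"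
  let ?\<Omega> = "?A \<times> ?B"
  let ?unzip = "\<lambda>zs :: ('v \<times> 'w) list. (map fst zs, map snd zs)"
  let ?W = "?unzip ` permutations_of_multiset M"
  let ?act = "\<lambda>(\<sigma>, \<tau>) (xs :: 'v list, ys :: 'w list). (permute_list \<sigma> xs, permute_list \<tau> ys)"
  have len: "length xs = ?n" if "xs \<in> ?A" for xs
    using length_finite_permutations_of_multiset[OF that] sz by simp
  have len': "length ys = ?n" if "ys \<in> ?B" for ys
    using length_finite_permutations_of_multiset[OF that] sz by simp
  have cardW: "card ?W = card (permutations_of_multiset M)"
    by (intro card_image inj_on_subset[OF inj_unzip]) simp
  obtain c where c: "\<And>xs us. xs \<in> ?A \<Longrightarrow> us \<in> ?A \<Longrightarrow> card {\<sigma>. \<sigma> permutes {..<?n} \<and> permute_list \<sigma> xs = us} = c"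
    using card_permute_list_const[of A, unfolded sz] by metis
  obtain d where d: "\<And>xs us. xs \<in> ?B \<Longrightarrow> us \<in> ?B \<Longrightarrow> card {\<sigma>. \<sigma> permutes {..<?n} \<and> permute_list \<sigma> xs = us} = d"
    using card_permute_list_const[of B, unfolded sz] by metis
  obtain N s where Ns: "s \<in> {..<N} \<rightarrow> ?S \<times> ?S" "?\<Omega> \<subseteq> (\<Union>j<N. ?act (s j) ` ?W)"
    "real N \<le> real (card ?\<Omega>) / real (card ?W) * ln (real (card ?\<Omega>)) + 1"
  proof (rule greedy_cover[where I = "?S \<times> ?S" and \<Omega> = ?\<Omega> and W = ?W and act = ?act and c = "c * d"])
    show "?W \<subseteq> ?\<Omega>" by (auto simp: permutations_of_multiset_def A_def B_def)
    have "id \<in> ?S" by (simp add: permutes_id)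
    then show "?S \<times> ?S \<noteq> {}" by blast
    show "finite (?S \<times> ?S)" by (simp add: finite_permutations)
    fix i assume "i \<in> ?S \<times> ?S"
    then obtain \<sigma> \<tau> where i: "i = (\<sigma>, \<tau>)" "\<sigma> permutes {..<?n}" "\<tau> permutes {..<?n}" by auto
    show "?act i w \<in> ?\<Omega>" if "w \<in> ?\<Omega>" for w
      using that i len len' by (auto simp: permutations_of_multiset_def)
    show "inj_on (?act i) ?\<Omega>"
    proof (rule inj_onI, clarify)
      fix xs ys xs' ys'
      assume mem: "xs \<in> ?A" "ys \<in> ?B" "xs' \<in> ?A" "ys' \<in> ?B"
        and eq: "?act i (xs, ys) = ?act i (xs', ys')"
      show "xs = xs' \<and> ys = ys'"
        using permute_list_inj[of \<sigma> xs xs'] permute_list_inj[of \<tau> ys ys'] i eq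
        by (simp add: len[OF mem(1)] len[OF mem(3)] len'[OF mem(2)] len'[OF mem(4)])
    qed
  next
    fix w u assume "w \<in> ?\<Omega>" "u \<in> ?\<Omega>"
    then obtain xs ys us vs where *: "w = (xs, ys)" "u = (us, vs)" "xs \<in> ?A" "us \<in> ?A" "ys \<in> ?B" "vs \<in> ?B" by auto
    have "{i \<in> ?S \<times> ?S. ?act i w = u} =
      {\<sigma>. \<sigma> permutes {..<?n} \<and> permute_list \<sigma> xs = us} \<times> {\<sigma>. \<sigma> permutes {..<?n} \<and> permute_list \<sigma> ys = vs}"
      using * by auto
    then show "card {i \<in> ?S \<times> ?S. ?act i w = u} = c * d"
      using * c d by (simp add: card_cartesian_product)
  qed (simp_all add: finite_permutations)
  have "type_val E A * type_val F B = val ?\<Omega> (rel_prod (list_all2 E) (list_all2 F))"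
    unfolding type_val_def using T by (intro val_prod[symmetric]) auto
  also have "\<dots> \<le> val ({..<N} \<times> permutations_of_multiset M) (rel_prod (=) (list_all2 (rel_prod E F)))"
  proof (rule val_image_le[where \<psi> = "\<lambda>(j, zs). ?act (s j) (?unzip zs)"])
    show "?\<Omega> \<subseteq> (\<lambda>(j, zs). ?act (s j) (?unzip zs)) ` ({..<N} \<times> permutations_of_multiset M)"
    proof
      fix w assume "w \<in> ?\<Omega>"
      then obtain j zs where "j < N" "zs \<in> permutations_of_multiset M" "w = ?act (s j) (?unzip zs)"
        using Ns(2) by blast
      then show "w \<in> (\<lambda>(j, zs). ?act (s j) (?unzip zs)) ` ({..<N} \<times> permutations_of_multiset M)"
        by (intro image_eqI[of _ _ "(j, zs)"]) auto
    qed
    fix u v assume u: "u \<in> {..<N} \<times> permutations_of_multiset M" and v: "v \<in> {..<N} \<times> permutations_of_multiset M"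
      and uv: "rel_prod (=) (list_all2 (rel_prod E F)) u v"
    obtain j zs k zs' where uv_eq: "u = (j, zs)" "v = (k, zs')" by (cases u; cases v)
    have *: "u = (j, zs)" "v = (j, zs')" "j < N" "length zs = ?n" "length zs' = ?n"
      "list_all2 (rel_prod E F) zs zs'"
      using u v uv by (simp_all add: uv_eq length_finite_permutations_of_multiset)
    obtain \<sigma> \<tau> where s: "s j = (\<sigma>, \<tau>)" "\<sigma> permutes {..<?n}" "\<tau> permutes {..<?n}"
    proof -
      have "s j \<in> ?S \<times> ?S" using Ns(1) *(3) by (simp add: Pi_iff)
      then show thesis using that by blast
    qed
    have "list_all2 E (map fst zs) (map fst zs')" "list_all2 F (map snd zs) (map snd zs')"
      using *(6) by (auto simp: list_all2_conv_all_nth rel_prod_sel)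
    then show "rel_prod (list_all2 E) (list_all2 F) (case u of (j, zs) \<Rightarrow> ?act (s j) (?unzip zs))
        (case v of (j, zs) \<Rightarrow> ?act (s j) (?unzip zs))"
      using * s by (simp add: list_all2_permute_list_iff)
  qed (use T in \<open>simp_all add: tolerance_rel_prod tolerance_eq\<close>)
  also have "\<dots> = val {..<N} (=) * type_val (rel_prod E F) M"
    unfolding type_val_def using T by (intro val_prod) (auto simp: tolerance_eq)
  also have "val {..<N} (=) = real N" by (simp add: val_eq)
  also have "real N \<le> \<omega> / real (card (permutations_of_multiset M)) * ln \<omega> + 1"
    using Ns(3) unfolding cardW by (simp add: \<omega>_def card_cartesian_product)
  finally show ?thesis using type_val_pos[of "rel_prod E F" M] E F
    by (simp add: tolerance_rel_prod mult_right_mono)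
qed

text \<open>The ratio of class sizes is what becomes the mutual information; everything else is
  collected in \<open>K\<close>, which can later be taken linear in the length. Since the ratio is
  at least 1, it absorbs the additive 1 of the covering number.\<close>

lemma ln_type_val_prod_ge:
  fixes M :: "('v \<times> 'w) multiset"
  assumes E: "tolerance E" and F: "tolerance F"
  defines "a \<equiv> real (card (permutations_of_multiset (image_mset fst M)))"
    and "b \<equiv> real (card (permutations_of_multiset (image_mset snd M)))"
    and "m \<equiv> real (card (permutations_of_multiset M))"
  assumes K: "ln a + ln b + 1 \<le> K"
  shows "ln (type_val E (image_mset fst M)) + ln (type_val F (image_mset snd M)) \<le>
    ln (type_val (rel_prod E F) M) + (ln a + ln b - ln m) + ln K"
proof -
  let ?A = "type_val E (image_mset fst M)" and ?B = "type_val F (image_mset snd M)"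
    and ?M = "type_val (rel_prod E F) M"
  have pos: "0 < ?A" "0 < ?B" "0 < ?M" using E F by (simp_all add: type_val_pos tolerance_rel_prod)
  have abm: "1 \<le> a" "1 \<le> b" "1 \<le> m"
    using card_perms_pos[of "image_mset fst M"] card_perms_pos[of "image_mset snd M"] card_perms_pos[of M]
    unfolding a_def b_def m_def by linarith+
  have "m \<le> a * b" unfolding a_def b_def m_def
    using card_perms_le_marginals[of M] by (metis of_nat_le_iff of_nat_mult)
  then have R: "1 \<le> a * b / m" using abm by simp
  have ln_ab: "ln (a * b) = ln a + ln b" using abm by (intro ln_mult_pos) auto
  have K0: "0 < K" using K abm ln_ge_zero[of a] ln_ge_zero[of b] by linarith
  have "?A * ?B \<le> (a * b / m * ln (a * b) + 1) * ?M"
    using type_val_prod_ge[OF E F, of M] by (simp add: a_def b_def m_def)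
  also have "\<dots> \<le> (a * b / m * K) * ?M"
  proof (rule mult_right_mono)
    have "a * b / m * ln (a * b) + 1 \<le> a * b / m * (ln (a * b) + 1)" using R by (simp add: distrib_left)
    also have "\<dots> \<le> a * b / m * K" using R K ln_ab by (intro mult_left_mono) auto
    finally show "a * b / m * ln (a * b) + 1 \<le> a * b / m * K" .
  qed (use pos in simp)
  finally have "ln (?A * ?B) \<le> ln ((a * b / m * K) * ?M)"
    using pos by (subst ln_le_cancel_iff) (auto intro: less_le_trans[OF mult_pos_pos])
  also have "\<dots> = ln (a * b) - ln m + ln K + ln ?M"
    using pos R K0 abm by (simp add: ln_mult_pos ln_divide_pos)
  finally show ?thesis using pos by (simp add: ln_mult_pos ln_ab)
qed

end

section \<open>Properties of exponents\<close>

definition push :: "('v \<Rightarrow> 'w) \<Rightarrow> 'v set \<Rightarrow> ('v \<Rightarrow> real) \<Rightarrow> 'w \<Rightarrow> real" where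
  "push \<phi> X p y = (\<Sum>x\<in>{x \<in> X. \<phi> x = y}. p x)"

lemma sum_push:
  assumes "finite X" "finite Y" "\<phi> \<in> X \<rightarrow> Y"
  shows "(\<Sum>y\<in>Y. push \<phi> X p y) = (\<Sum>x\<in>X. p x)"
  unfolding push_def using assms by (intro sum.group) auto

lemma push_nonneg: "(\<And>x. x \<in> X \<Longrightarrow> 0 \<le> p x) \<Longrightarrow> 0 \<le> push \<phi> X p y"
  unfolding push_def by (intro sum_nonneg) auto

lemma count_image_eq:
  assumes "finite X" "set_mset M \<subseteq> X"
  shows "count (image_mset \<phi> M) y = (\<Sum>x\<in>{x \<in> X. \<phi> x = y}. count M x)"
  unfolding count_image_mset using assms
  by (intro sum.mono_neutral_left) (auto simp: not_in_iff)

lemma count_image_tendsto: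
  assumes "finite X" "\<And>i. set_mset (M i) \<subseteq> X"
    "\<And>x. x \<in> X \<Longrightarrow> ((\<lambda>i. real (count (M i) x) / real (nn i)) \<longlongrightarrow> p x) F"
  shows "((\<lambda>i. real (count (image_mset \<phi> (M i)) y) / real (nn i)) \<longlongrightarrow> push \<phi> X p y) F"
proof -
  have "((\<lambda>i. \<Sum>x\<in>{x \<in> X. \<phi> x = y}. real (count (M i) x) / real (nn i)) \<longlongrightarrow> push \<phi> X p y) F"
    unfolding push_def using assms(3) by (intro tendsto_sum) auto
  then show ?thesis using assms by (simp add: count_image_eq sum_divide_distrib)
qed

lemma ln_linear_over_n:
  assumes "0 \<le> c"
  shows "(\<lambda>n. ln (c * real n + 1) / real n) \<longlonglongrightarrow> 0"
proof (rule tendsto_sandwich)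
  show "eventually (\<lambda>n. 0 \<le> ln (c * real n + 1) / real n) sequentially"
    using assms by (intro always_eventually) simp
  show "(\<lambda>n. ln (c + 1) / real n + ln (real n) / real n) \<longlonglongrightarrow> 0"
    using tendsto_add[OF tendsto_mult[OF tendsto_const lim_1_over_n] lim_ln_over_n, of "ln (c + 1)"] by simp
  show "eventually (\<lambda>n. ln (c * real n + 1) / real n \<le> ln (c + 1) / real n + ln (real n) / real n) sequentially"
    using eventually_gt_at_top[of 0]
  proof eventually_elim
    case (elim n)
    have "c * real n + 1 \<le> (c + 1) * real n" using elim by (simp add: algebra_simps)
    moreover have "0 < c * real n + 1" using assms by (simp add: add_nonneg_pos)
    ultimately have "ln (c * real n + 1) \<le> ln ((c + 1) * real n)" by (subst ln_le_cancel_iff) auto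
    also have "\<dots> = ln (c + 1) + ln (real n)" using assms elim by (intro ln_mult_pos) auto
    finally show ?case by (simp add: divide_right_mono flip: add_divide_distrib)
  qed
qed simp

lemma finite_types: "finite X \<Longrightarrow> finite {M. set_mset M \<subseteq> X \<and> size M = n}"
  and card_types_le: "finite X \<Longrightarrow> card {M. set_mset M \<subseteq> X \<and> size M = n} \<le> (n + 1) ^ card X"
proof -
  assume X: "finite X"
  let ?T = "{M. set_mset M \<subseteq> X \<and> size M = n}" and ?f = "\<lambda>M. restrict (count M) X"
  have inj: "inj_on ?f ?T"
  proof (rule inj_onI, rule multiset_eqI)
    fix M N x assume *: "M \<in> ?T" "N \<in> ?T" "?f M = ?f N"
    show "count M x = count N x"
    proof (cases "x \<in> X")
      case True
      then show ?thesis using fun_cong[OF *(3), of x] by simp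
    next
      case False
      then have "x \<notin># M" "x \<notin># N" using * by auto
      then show ?thesis by (simp add: not_in_iff)
    qed
  qed
  have sub: "?f ` ?T \<subseteq> X \<rightarrow>\<^sub>E {..n}"
    by (auto intro: count_le_size)
  have fin: "finite (X \<rightarrow>\<^sub>E {..n})" using X by (intro finite_PiE) auto
  show "finite ?T" using inj sub fin by (rule inj_on_finite)
  have "card ?T \<le> card (X \<rightarrow>\<^sub>E {..n})" using inj sub fin by (rule card_inj_on_le)
  then show "card ?T \<le> (n + 1) ^ card X" using X by (simp add: card_PiE)
qed

text \<open>Bolzano-Weierstrass, one coordinate at a time, passing to a further subsequence at each
  step.\<close>

lemma convergent_subsequence_finite:
  fixes g :: "nat \<Rightarrow> 'v \<Rightarrow> real"
  assumes "finite X" "\<And>n x. x \<in> X \<Longrightarrow> 0 \<le> g n x \<and> g n x \<le> 1"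
  shows "\<exists>r l. strict_mono (r :: nat \<Rightarrow> nat) \<and> (\<forall>x\<in>X. (\<lambda>n. g (r n) x) \<longlonglongrightarrow> l x)"
  using assms
proof (induction X rule: finite_induct)
  case empty
  then show ?case by (intro exI[of _ id]) (simp add: strict_mono_id)
next
  case (insert a X)
  then obtain r l where r: "strict_mono (r :: nat \<Rightarrow> nat)" "\<And>x. x \<in> X \<Longrightarrow> (\<lambda>n. g (r n) x) \<longlonglongrightarrow> l x"
    by blast
  have "seq_compact {0..1 :: real}" by (simp add: compact_imp_seq_compact)
  moreover have "\<forall>n. g (r n) a \<in> {0..1}" using insert.prems by simp
  ultimately obtain s b where s: "strict_mono (s :: nat \<Rightarrow> nat)" "((\<lambda>n. g (r n) a) \<circ> s) \<longlonglongrightarrow> b"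
    unfolding seq_compact_def by metis
  show ?case
  proof (intro exI conjI ballI)
    show "strict_mono (r \<circ> s)" using r(1) s(1) by (rule strict_mono_o)
    fix x assume x: "x \<in> insert a X"
    show "(\<lambda>n. g ((r \<circ> s) n) x) \<longlonglongrightarrow> (l(a := b)) x"
    proof (cases "x = a")
      case True
      then show ?thesis using s(2) by (simp add: o_def)
    next
      case False
      then have "(\<lambda>n. g (r n) x) \<longlonglongrightarrow> l x" using x r(2) by simp
      from LIMSEQ_subseq_LIMSEQ[OF this s(1)] show ?thesis using False by (simp add: o_def)
    qed
  qed
qed

section \<open>Exponents under maps, addition of weights, sums and products\<close>

context spectral_point
begin

lemma exponent_cong:
  assumes X: "finite X" and E: "tolerance E" "tolerance F"
    and eq: "\<And>u v. u \<in> X \<Longrightarrow> v \<in> X \<Longrightarrow> E u v \<longleftrightarrow> F u v" "\<And>x. x \<in> X \<Longrightarrow> p x = q x"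
  shows "exponent E X p = exponent F X q"
proof -
  have "floor_mset X p n = floor_mset X q n" for n
    unfolding floor_mset_def by (intro sum.cong) (simp_all add: eq)
  moreover have "type_val E (floor_mset X q n) = type_val F (floor_mset X q n)" for n
    using set_floor_mset[OF X, of q n] by (intro type_val_cong E eq) auto
  ultimately show ?thesis by (simp add: exponent_def)
qed

lemma exponent_mono_map:
  assumes X: "finite X" "tolerance E" and Y: "finite Y" "tolerance F" and p: "\<And>x. x \<in> X \<Longrightarrow> 0 \<le> p x"
    and \<phi>: "\<phi> \<in> X \<rightarrow> Y" "\<And>u v. u \<in> X \<Longrightarrow> v \<in> X \<Longrightarrow> F (\<phi> u) (\<phi> v) \<Longrightarrow> E u v"
  shows "exponent E X p \<le> exponent F Y (push \<phi> X p)"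
proof (rule LIMSEQ_le)
  let ?M = "floor_mset X p"
  have M: "set_mset (?M n) \<subseteq> X" for n using X(1) by (rule set_floor_mset)
  show "(\<lambda>n. ln (type_val E (?M n)) / real n) \<longlonglongrightarrow> exponent E X p"
    by (rule floor_mset_tendsto_exponent) (use X p in auto)
  show "(\<lambda>n. ln (type_val F (image_mset \<phi> (?M n))) / real n) \<longlonglongrightarrow> exponent F Y (push \<phi> X p)"
  proof (rule type_val_tendsto_exponent[OF Y filterlim_ident])
    show "set_mset (image_mset \<phi> (?M n)) \<subseteq> Y" for n using M \<phi>(1) by auto
    show "(\<lambda>n. real (count (image_mset \<phi> (?M n)) y) / real n) \<longlonglongrightarrow> push \<phi> X p y" for y
      using M p by (intro count_image_tendsto X count_floor_mset_tendsto) auto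
  qed (use p in \<open>auto intro: push_nonneg\<close>)
  have "type_val E (?M n) \<le> type_val F (image_mset \<phi> (?M n))" for n
    using M[of n] by (intro type_val_map_mono X Y \<phi>(2)) auto
  then have "ln (type_val E (?M n)) / real n \<le> ln (type_val F (image_mset \<phi> (?M n))) / real n" for n
    using type_val_pos[OF X(2)] type_val_pos[OF Y(2)] by (intro divide_right_mono) simp_all
  then show "\<exists>N. \<forall>n\<ge>N. ln (type_val E (?M n)) / real n \<le> ln (type_val F (image_mset \<phi> (?M n))) / real n"
    by blast
qed

lemma exponent_image_le:
  assumes X: "finite X" "tolerance E" and Y: "finite Y" "tolerance F" and p: "\<And>x. x \<in> X \<Longrightarrow> 0 \<le> p x"
    and \<phi>: "\<phi> \<in> X \<rightarrow> Y" "\<And>u v. u \<in> X \<Longrightarrow> v \<in> X \<Longrightarrow> E u v \<Longrightarrow> F (\<phi> u) (\<phi> v)"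
  shows "exponent F Y (push \<phi> X p) \<le> exponent E X p"
proof (rule LIMSEQ_le)
  let ?M = "floor_mset X p"
  have M: "set_mset (?M n) \<subseteq> X" for n using X(1) by (rule set_floor_mset)
  show "(\<lambda>n. ln (type_val E (?M n)) / real n) \<longlonglongrightarrow> exponent E X p"
    by (rule floor_mset_tendsto_exponent) (use X p in auto)
  show "(\<lambda>n. ln (type_val F (image_mset \<phi> (?M n))) / real n) \<longlonglongrightarrow> exponent F Y (push \<phi> X p)"
  proof (rule type_val_tendsto_exponent[OF Y filterlim_ident])
    show "set_mset (image_mset \<phi> (?M n)) \<subseteq> Y" for n using M \<phi>(1) by auto
    show "(\<lambda>n. real (count (image_mset \<phi> (?M n)) y) / real n) \<longlonglongrightarrow> push \<phi> X p y" for y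
      using M p by (intro count_image_tendsto X count_floor_mset_tendsto) auto
  qed (use p in \<open>auto intro: push_nonneg\<close>)
  have "type_val F (image_mset \<phi> (?M n)) \<le> type_val E (?M n)" for n
    using M[of n] by (intro type_val_image_le X Y \<phi>(2)) auto
  then have "ln (type_val F (image_mset \<phi> (?M n))) / real n \<le> ln (type_val E (?M n)) / real n" for n
    using type_val_pos[OF X(2)] type_val_pos[OF Y(2)] by (intro divide_right_mono) simp_all
  then show "\<exists>N. \<forall>n\<ge>N. ln (type_val F (image_mset \<phi> (?M n))) / real n \<le> ln (type_val E (?M n)) / real n"
    by blast
qed

text \<open>A type for \<open>p\<close> is concatenated with a type for \<open>q\<close>. Applied to
  the weights \<open>t * P\<close> and \<open>(1 - t) * Q\<close>, and combined with
  \<open>exponent_scale\<close>, this is concavity.\<close>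

lemma exponent_superadditive:
  assumes X: "finite X" "tolerance E" and p: "\<And>x. x \<in> X \<Longrightarrow> 0 \<le> p x" and q: "\<And>x. x \<in> X \<Longrightarrow> 0 \<le> q x"
  shows "exponent E X p + exponent E X q \<le> exponent E X (\<lambda>x. p x + q x)"
proof (rule LIMSEQ_le)
  let ?M = "floor_mset X p" and ?N = "floor_mset X q"
  have MN: "set_mset (?M n) \<subseteq> X" "set_mset (?N n) \<subseteq> X" for n by (intro set_floor_mset X(1))+
  show "(\<lambda>n. ln (type_val E (?M n)) / real n + ln (type_val E (?N n)) / real n) \<longlonglongrightarrow> exponent E X p + exponent E X q"
    by (intro tendsto_add floor_mset_tendsto_exponent) (use X p q in auto)
  show "(\<lambda>n. ln (type_val E (?M n + ?N n)) / real n) \<longlonglongrightarrow> exponent E X (\<lambda>x. p x + q x)"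
  proof (rule type_val_tendsto_exponent[OF X filterlim_ident])
    show "set_mset (?M n + ?N n) \<subseteq> X" for n using MN by auto
    show "(\<lambda>n. real (count (?M n + ?N n) x) / real n) \<longlonglongrightarrow> p x + q x" if "x \<in> X" for x
      using tendsto_add[OF count_floor_mset_tendsto[of X x p] count_floor_mset_tendsto[of X x q]] X p q that
      by (simp add: add_divide_distrib)
  qed (use p q in auto)
  have "ln (type_val E (?M n)) / real n + ln (type_val E (?N n)) / real n \<le> ln (type_val E (?M n + ?N n)) / real n" for n
  proof -
    have "ln (type_val E (?M n)) + ln (type_val E (?N n)) = ln (type_val E (?M n) * type_val E (?N n))"
      using type_val_pos[OF X(2)] by (simp add: ln_mult_pos)
    also have "\<dots> \<le> ln (type_val E (?M n + ?N n))"
      using type_val_pos[OF X(2)] type_val_add[OF X(2)] by simp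
    finally show ?thesis by (simp add: divide_right_mono flip: add_divide_distrib)
  qed
  then show "\<exists>N. \<forall>n\<ge>N. ln (type_val E (?M n)) / real n + ln (type_val E (?N n)) / real n
      \<le> ln (type_val E (?M n + ?N n)) / real n"
    by blast
qed

text \<open>\<open>type_val_sum\<close> is an identity, so the limit is one too. The side patterns
  are written as a type class over \<open>bool\<close>, so that \<open>ln_card_perms_tendsto\<close>
  turns their number into the entropy of \<open>s\<close> and \<open>1 - s\<close>.\<close>

lemma exponent_sum:
  assumes X: "finite X" "tolerance E" and Y: "finite Y" "tolerance F"
    and p: "\<And>x. x \<in> X \<Longrightarrow> 0 \<le> p x" and q: "\<And>y. y \<in> Y \<Longrightarrow> 0 \<le> q y"
    and one: "(\<Sum>x\<in>X. p x) + (\<Sum>y\<in>Y. q y) = 1"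
  defines "s \<equiv> (\<Sum>x\<in>X. p x)"
  shows "exponent (rel_sum E F) (X <+> Y) (case_sum p q) =
    exponent E X p + exponent F Y q - s * ln s - (1 - s) * ln (1 - s)"
proof -
  let ?M = "floor_mset X p" and ?N = "floor_mset Y q"
  let ?S = "\<lambda>n. image_mset Inl (?M n) + image_mset Inr (?N n)"
  let ?Z = "\<lambda>n. replicate_mset (size (?M n)) True + replicate_mset (size (?N n)) False"
  have MN: "set_mset (?M n) \<subseteq> X" "set_mset (?N n) \<subseteq> Y" for n
    by (intro set_floor_mset X(1) Y(1))+
  have "(\<lambda>n. ln (type_val (rel_sum E F) (?S n)) / real n) \<longlonglongrightarrow> exponent (rel_sum E F) (X <+> Y) (case_sum p q)"
  proof (rule type_val_tendsto_exponent[OF _ _ filterlim_ident])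
    show "set_mset (?S n) \<subseteq> X <+> Y" for n using MN by auto
    fix z assume z: "z \<in> X <+> Y"
    then show "0 \<le> case_sum p q z" using p q by auto
    have inl: "count (image_mset Inr K) (Inl x) = 0" "count (image_mset Inl L) (Inr y) = 0" for K L x y
      by (auto simp: count_eq_zero_iff)
    have inj: "count (image_mset Inl L) (Inl x) = count L x" "count (image_mset Inr K) (Inr y) = count K y" for K L x y
      by (induction L; simp) (induction K; simp)
    show "(\<lambda>n. real (count (?S n) z) / real n) \<longlonglongrightarrow> case_sum p q z"
      using z by (auto simp: inl inj intro!: count_floor_mset_tendsto X Y p q)
  qed (use X Y in \<open>auto intro: tolerance_rel_sum\<close>)
  moreover have "(\<lambda>n. ln (type_val (rel_sum E F) (?S n)) / real n) \<longlonglongrightarrow>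
      (1 * ln 1 - (s * ln s + (1 - s) * ln (1 - s))) + (exponent E X p + exponent F Y q)"
  proof -
    have sizes: "(\<lambda>n. real (size (?M n)) / real n) \<longlonglongrightarrow> s" "(\<lambda>n. real (size (?N n)) / real n) \<longlonglongrightarrow> 1 - s"
    proof -
      have "(\<lambda>n. \<Sum>x\<in>X. real (count (?M n) x) / real n) \<longlonglongrightarrow> s"
        unfolding s_def by (intro tendsto_sum count_floor_mset_tendsto X p)
      then show "(\<lambda>n. real (size (?M n)) / real n) \<longlonglongrightarrow> s"
        by (simp add: size_eq_sum_count[OF X(1) MN(1)] sum_divide_distrib)
      have "(\<lambda>n. \<Sum>x\<in>Y. real (count (?N n) x) / real n) \<longlonglongrightarrow> (\<Sum>y\<in>Y. q y)"
        by (intro tendsto_sum count_floor_mset_tendsto Y q)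
      also have "(\<Sum>y\<in>Y. q y) = 1 - s" using one by (simp add: s_def)
      finally show "(\<lambda>n. real (size (?N n)) / real n) \<longlonglongrightarrow> 1 - s"
        by (simp add: size_eq_sum_count[OF Y(1) MN(2)] sum_divide_distrib)
    qed
    have "(\<lambda>n. ln (real (card (permutations_of_multiset (?Z n)))) / real n) \<longlonglongrightarrow>
        (\<Sum>b\<in>UNIV. if b then s else 1 - s) * ln (\<Sum>b\<in>UNIV. if b then s else 1 - s) -
        (\<Sum>b\<in>UNIV. (if b then s else 1 - s) * ln (if b then s else 1 - s))"
      using sizes by (intro ln_card_perms_tendsto filterlim_ident) (auto split: if_splits)
    then have Z: "(\<lambda>n. ln (real (card (permutations_of_multiset (?Z n)))) / real n) \<longlonglongrightarrow>
        1 * ln 1 - (s * ln s + (1 - s) * ln (1 - s))"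
      by (simp add: UNIV_bool algebra_simps)
    have eq: "ln (type_val (rel_sum E F) (?S n)) / real n =
        ln (real (card (permutations_of_multiset (?Z n)))) / real n +
        (ln (type_val E (?M n)) / real n + ln (type_val F (?N n)) / real n)" for n
    proof -
      have "type_val (rel_sum E F) (?S n) =
          real (card (permutations_of_multiset (?Z n))) * (type_val E (?M n) * type_val F (?N n))"
        by (simp add: type_val_sum X Y card_perms_bool)
      moreover have "0 < real (card (permutations_of_multiset (?Z n)))"
        using card_perms_pos by simp
      ultimately have "ln (type_val (rel_sum E F) (?S n)) =
          ln (real (card (permutations_of_multiset (?Z n)))) + (ln (type_val E (?M n)) + ln (type_val F (?N n)))"
        using type_val_pos[OF X(2)] type_val_pos[OF Y(2)] by (simp only: ln_mult_pos mult_pos_pos)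
      then show ?thesis by (simp add: add_divide_distrib)
    qed
    show ?thesis unfolding eq
      by (intro tendsto_add Z floor_mset_tendsto_exponent) (use X Y p q in auto)
  qed
  ultimately have "exponent (rel_sum E F) (X <+> Y) (case_sum p q) =
      (1 * ln 1 - (s * ln s + (1 - s) * ln (1 - s))) + (exponent E X p + exponent F Y q)"
    by (rule LIMSEQ_unique)
  then show ?thesis by simp
qed

text \<open>Both bounds are limits of bounds for the floors of the joint weights. The marginals of
  these floors need not be the floors of the marginals; they only have the right limiting
  frequencies, which \<open>type_val_tendsto_exponent\<close> accepts.\<close>

lemma exponent_prod:
  assumes X: "finite X" "tolerance E" and Y: "finite Y" "tolerance F"
    and p: "\<And>z. z \<in> X \<times> Y \<Longrightarrow> 0 \<le> p z" and one: "(\<Sum>z\<in>X \<times> Y. p z) = 1"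
  defines "p1 \<equiv> push fst (X \<times> Y) p" and "p2 \<equiv> push snd (X \<times> Y) p"
  shows "exponent (rel_prod E F) (X \<times> Y) p \<le> exponent E X p1 + exponent F Y p2"
    and "exponent E X p1 + exponent F Y p2 \<le> exponent (rel_prod E F) (X \<times> Y) p +
      ((\<Sum>z\<in>X \<times> Y. p z * ln (p z)) - (\<Sum>x\<in>X. p1 x * ln (p1 x)) - (\<Sum>y\<in>Y. p2 y * ln (p2 y)))"
proof -
  let ?M = "floor_mset (X \<times> Y) p"
  let ?A = "\<lambda>n. image_mset fst (?M n)" and ?B = "\<lambda>n. image_mset snd (?M n)"
  let ?c = "\<lambda>M. real (card (permutations_of_multiset M))"
  have XY: "finite (X \<times> Y)" "tolerance (rel_prod E F)" using X Y by (auto intro: tolerance_rel_prod)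
  have M: "set_mset (?M n) \<subseteq> X \<times> Y" for n using XY(1) by (rule set_floor_mset)
  have A: "set_mset (?A n) \<subseteq> X" and B: "set_mset (?B n) \<subseteq> Y" for n using M[of n] by auto
  have cM: "(\<lambda>n. real (count (?M n) z) / real n) \<longlonglongrightarrow> p z" if "z \<in> X \<times> Y" for z
    using that by (intro count_floor_mset_tendsto XY p)
  have cA: "(\<lambda>n. real (count (?A n) x) / real n) \<longlonglongrightarrow> p1 x" for x
    unfolding p1_def using XY(1) M cM by (rule count_image_tendsto)
  have cB: "(\<lambda>n. real (count (?B n) y) / real n) \<longlonglongrightarrow> p2 y" for y
    unfolding p2_def using XY(1) M cM by (rule count_image_tendsto)
  have sum1: "(\<Sum>x\<in>X. p1 x) = 1" "(\<Sum>y\<in>Y. p2 y) = 1"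
    using sum_push[OF XY(1) X(1), of fst p] sum_push[OF XY(1) Y(1), of snd p] one
    unfolding p1_def p2_def by (simp_all add: Pi_iff)
  have limM: "(\<lambda>n. ln (type_val (rel_prod E F) (?M n)) / real n) \<longlonglongrightarrow> exponent (rel_prod E F) (X \<times> Y) p"
    by (rule floor_mset_tendsto_exponent[OF XY p])
  have "(\<lambda>n. ln (type_val E (?A n)) / real n) \<longlonglongrightarrow> exponent E X p1"
    by (rule type_val_tendsto_exponent[OF X filterlim_ident _ A cA]) (auto simp: p1_def intro!: push_nonneg p)
  moreover have "(\<lambda>n. ln (type_val F (?B n)) / real n) \<longlonglongrightarrow> exponent F Y p2"
    by (rule type_val_tendsto_exponent[OF Y filterlim_ident _ B cB]) (auto simp: p2_def intro!: push_nonneg p)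
  ultimately have limAB: "(\<lambda>n. ln (type_val E (?A n)) / real n + ln (type_val F (?B n)) / real n) \<longlonglongrightarrow>
      exponent E X p1 + exponent F Y p2"
    by (rule tendsto_add)
  note pos = type_val_pos[OF X(2)] type_val_pos[OF Y(2)] type_val_pos[OF XY(2)]
  have ln_AB: "ln (type_val E (?A n) * type_val F (?B n)) = ln (type_val E (?A n)) + ln (type_val F (?B n))" for n
    using pos by (simp add: ln_mult_pos)
  show "exponent (rel_prod E F) (X \<times> Y) p \<le> exponent E X p1 + exponent F Y p2"
  proof (rule LIMSEQ_le[OF limM limAB])
    have "ln (type_val (rel_prod E F) (?M n)) \<le> ln (type_val E (?A n) * type_val F (?B n))" for n
      using type_val_prod_le[OF X(2) Y(2), of "?M n"] pos by (subst ln_le_cancel_iff) auto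
    then have "ln (type_val (rel_prod E F) (?M n)) / real n \<le> ln (type_val E (?A n)) / real n + ln (type_val F (?B n)) / real n" for n
      unfolding ln_AB by (simp add: divide_right_mono flip: add_divide_distrib)
    then show "\<exists>N. \<forall>n\<ge>N. ln (type_val (rel_prod E F) (?M n)) / real n \<le>
        ln (type_val E (?A n)) / real n + ln (type_val F (?B n)) / real n" by blast
  qed
  let ?hA = "- (\<Sum>x\<in>X. p1 x * ln (p1 x))" and ?hB = "- (\<Sum>y\<in>Y. p2 y * ln (p2 y))"
    and ?hM = "- (\<Sum>z\<in>X \<times> Y. p z * ln (p z))"
  have hM: "(\<lambda>n. ln (?c (?M n)) / real n) \<longlonglongrightarrow> ?hM"
    using ln_card_perms_tendsto[OF XY(1) filterlim_ident M cM] one by simp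
  have hA: "(\<lambda>n. ln (?c (?A n)) / real n) \<longlonglongrightarrow> ?hA"
    using ln_card_perms_tendsto[OF X(1) filterlim_ident A cA] sum1 by simp
  have hB: "(\<lambda>n. ln (?c (?B n)) / real n) \<longlonglongrightarrow> ?hB"
    using ln_card_perms_tendsto[OF Y(1) filterlim_ident B cB] sum1 by simp
  \<comment> \<open>Any positive constant above the sum of the two marginal entropies works.
    Eventually the logarithms of the marginal class sizes add up to at most \<open>C * n\<close>, so
    \<open>K = C * n + 1\<close> is admissible, and \<open>ln K / n\<close> vanishes.\<close>
  define C where "C = \<bar>?hA + ?hB\<bar> + 1"
  have "eventually (\<lambda>n. ln (?c (?A n)) / real n + ln (?c (?B n)) / real n < C) sequentially"
    by (rule order_tendstoD(2)[OF tendsto_add[OF hA hB]]) (simp add: C_def)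
  then have bound: "eventually (\<lambda>n. ln (type_val E (?A n)) / real n + ln (type_val F (?B n)) / real n \<le>
      ln (type_val (rel_prod E F) (?M n)) / real n + (ln (?c (?A n)) / real n + ln (?c (?B n)) / real n - ln (?c (?M n)) / real n)
        + ln (C * real n + 1) / real n) sequentially" (is "eventually (\<lambda>n. ?l n \<le> ?r n) _")
    using eventually_gt_at_top[of 0]
  proof eventually_elim
    case (elim n)
    have "ln (?c (?A n)) + ln (?c (?B n)) + 1 \<le> C * real n + 1"
      using elim by (simp add: field_simps flip: add_divide_distrib)
    from divide_right_mono[OF ln_type_val_prod_ge[OF X(2) Y(2) this], of "real n"]
    show ?case by (simp add: add_divide_distrib diff_divide_distrib)
  qed
  have "?r \<longlonglongrightarrow> exponent (rel_prod E F) (X \<times> Y) p + (?hA + ?hB - ?hM) + 0"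
    by (intro tendsto_add tendsto_diff limM hA hB hM ln_linear_over_n) (simp add: C_def)
  then have "exponent E X p1 + exponent F Y p2 \<le> exponent (rel_prod E F) (X \<times> Y) p + (?hA + ?hB - ?hM) + 0"
    using tendsto_le[OF _ _ limAB bound] by simp
  then show "exponent E X p1 + exponent F Y p2 \<le> exponent (rel_prod E F) (X \<times> Y) p +
      ((\<Sum>z\<in>X \<times> Y. p z * ln (p z)) - (\<Sum>x\<in>X. p1 x * ln (p1 x)) - (\<Sum>y\<in>Y. p2 y * ln (p2 y)))"
    by simp
qed


lemma exponent_le:
  assumes X: "finite X" "X \<noteq> {}" "tolerance E" and p: "\<And>x. x \<in> X \<Longrightarrow> 0 \<le> p x" and one: "(\<Sum>x\<in>X. p x) = 1"
  shows "exponent E X p \<le> ln (val X E)"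
proof (rule LIMSEQ_le_const2[OF floor_mset_tendsto_exponent[OF X(1,3) p]])
  let ?M = "floor_mset X p"
  have v: "1 \<le> val X E" using X by (intro val_ge_1)
  have "ln (type_val E (?M n)) / real n \<le> ln (val X E)" if "1 \<le> n" for n
  proof -
    have "real (size (?M n)) \<le> (\<Sum>x\<in>X. real n * p x)"
      unfolding size_floor_mset[OF X(1)] of_nat_sum using p by (intro sum_mono of_nat_floor) auto
    also have "\<dots> = real n" using one by (simp flip: sum_distrib_left)
    finally have n: "size (?M n) \<le> n" by simp
    have "type_val E (?M n) \<le> val X E ^ size (?M n)"
      by (intro type_val_le_power X set_floor_mset)
    also have "\<dots> \<le> val X E ^ n" using n v by (intro power_increasing)
    finally have "ln (type_val E (?M n)) \<le> ln (val X E ^ n)"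
      using type_val_pos[OF X(3)] v by (subst ln_le_cancel_iff) auto
    also have "\<dots> = real n * ln (val X E)" using v by (simp add: ln_realpow)
    finally show ?thesis using that by (simp add: field_simps)
  qed
  then show "\<exists>N. \<forall>n\<ge>N. ln (type_val E (?M n)) / real n \<le> ln (val X E)" by blast
qed

text \<open>Since the types of size \<open>n\<close> are polynomially many, the best of them carries
  \<open>val X E ^ n\<close> up to a polynomial factor. Its frequencies converge along a
  subsequence, and the limit is the maximiser, because the exponent is the limit along every
  sequence of types with these frequencies.\<close>

lemma exponent_max:
  assumes X: "finite X" "X \<noteq> {}" "tolerance E"
  obtains p where "\<And>x. x \<in> X \<Longrightarrow> 0 \<le> p x" "(\<Sum>x\<in>X. p x) = 1" "ln (val X E) \<le> exponent E X p"
proof -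
  let ?T = "\<lambda>n. {M. set_mset M \<subseteq> X \<and> size M = n}"
  have "\<exists>M\<in>?T n. \<forall>N\<in>?T n. type_val E N \<le> type_val E M" for n
  proof -
    obtain x where "x \<in> X" using X by auto
    then have "replicate_mset n x \<in> ?T n" by auto
    then have "?T n \<noteq> {}" by blast
    then have im: "finite (type_val E ` ?T n)" "type_val E ` ?T n \<noteq> {}" using finite_types[OF X(1), of n] by auto
    obtain M where M: "M \<in> ?T n" "Max (type_val E ` ?T n) = type_val E M"
      using Max_in[OF im] by (rule imageE)
    have "type_val E N \<le> type_val E M" if "N \<in> ?T n" for N
      using Max_ge[OF im(1) imageI[OF that]] unfolding M(2) .
    with M(1) show ?thesis by (intro bexI[of _ M] ballI)
  qed
  then have "\<forall>n. \<exists>M. M \<in> ?T n \<and> (\<forall>N\<in>?T n. type_val E N \<le> type_val E M)" by blast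
  from choice[OF this] obtain M where
    "\<forall>n. M n \<in> ?T n \<and> (\<forall>N\<in>?T n. type_val E N \<le> type_val E (M n))" ..
  then have M: "M n \<in> ?T n" "\<And>N. N \<in> ?T n \<Longrightarrow> type_val E N \<le> type_val E (M n)" for n by blast+
  have lower: "val X E ^ n \<le> real ((n + 1) ^ card X) * type_val E (M n)" for n
  proof -
    have "{xs. set xs \<subseteq> X \<and> length xs = n} = (\<Union>N\<in>?T n. permutations_of_multiset N)"
      by (auto simp: permutations_of_multiset_def)
    then have "val X E ^ n = val (\<Union>N\<in>?T n. permutations_of_multiset N) (list_all2 E)"
      using val_strings[OF X(1,3), of n] by simp
    also have "\<dots> \<le> (\<Sum>N\<in>?T n. type_val E N)"
      unfolding type_val_def using X by (intro val_UN finite_types tolerance_list_all2) auto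
    also have "\<dots> \<le> real (card (?T n)) * type_val E (M n)"
      using M(2) by (intro sum_bounded_above) auto
    also have "\<dots> \<le> real ((n + 1) ^ card X) * type_val E (M n)"
      using card_types_le[OF X(1), of n] type_val_pos[OF X(3), of "M n"]
      by (intro mult_right_mono) (auto simp flip: of_nat_Suc)
    finally show ?thesis .
  qed
  let ?g = "\<lambda>n x. real (count (M n) x) / real n"
  have "0 \<le> ?g n x \<and> ?g n x \<le> 1" for n x
    using M(1)[of n] count_le_size[of "M n" x] by (cases "n = 0") auto
  then obtain r l where r: "strict_mono (r :: nat \<Rightarrow> nat)" and l: "\<And>x. x \<in> X \<Longrightarrow> (\<lambda>n. ?g (r n) x) \<longlonglongrightarrow> l x"
    using convergent_subsequence_finite[OF X(1), of ?g] by blast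
  have rtop: "filterlim r at_top sequentially" using r by (rule filterlim_subseq)
  have rpos: "eventually (\<lambda>n. 0 < r n) sequentially"
    using filterlim_at_top[THEN iffD1, OF rtop, rule_format, of 1] by (simp add: Suc_le_eq)
  have l0: "0 \<le> l x" if "x \<in> X" for x
    by (rule LIMSEQ_le_const[OF l[OF that]]) auto
  have "(\<lambda>n. \<Sum>x\<in>X. ?g (r n) x) \<longlonglongrightarrow> (\<Sum>x\<in>X. l x)" by (intro tendsto_sum l)
  moreover have "eventually (\<lambda>n. (\<Sum>x\<in>X. ?g (r n) x) = 1) sequentially"
    using rpos
  proof eventually_elim
    case (elim n)
    have "(\<Sum>x\<in>X. real (count (M (r n)) x)) = real (r n)"
      using M(1)[of "r n"] size_eq_sum_count[OF X(1), of "M (r n)"] by (simp flip: of_nat_sum)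
    then show ?case using elim by (simp flip: sum_divide_distrib)
  qed
  then have "(\<lambda>n. \<Sum>x\<in>X. ?g (r n) x) \<longlonglongrightarrow> 1" by (rule tendsto_eventually)
  ultimately have l1: "(\<Sum>x\<in>X. l x) = 1" by (rule LIMSEQ_unique)
  have v: "1 \<le> val X E" using X by (intro val_ge_1)
  have "ln (val X E) \<le> 0 + exponent E X l"
  proof (rule tendsto_lowerbound)
    have "(\<lambda>n. real (card X) * (ln (1 * real (r n) + 1) / real (r n))) \<longlonglongrightarrow> real (card X) * 0"
      by (intro tendsto_mult tendsto_const filterlim_compose[OF ln_linear_over_n rtop]) auto
    then show "(\<lambda>n. real (card X) * (ln (1 * real (r n) + 1) / real (r n)) + ln (type_val E (M (r n))) / real (r n)) \<longlonglongrightarrow>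
        0 + exponent E X l"
      using M(1) l0 l by (intro tendsto_add type_val_tendsto_exponent X rtop) auto
    show "eventually (\<lambda>n. ln (val X E) \<le>
        real (card X) * (ln (1 * real (r n) + 1) / real (r n)) + ln (type_val E (M (r n))) / real (r n)) sequentially"
      using rpos
    proof eventually_elim
      case (elim n)
      have "real (r n) * ln (val X E) = ln (val X E ^ r n)" using v by (simp add: ln_realpow)
      also have "\<dots> \<le> ln (real ((r n + 1) ^ card X) * type_val E (M (r n)))"
        using lower[of "r n"] v type_val_pos[OF X(3), of "M (r n)"] by (subst ln_le_cancel_iff) auto
      also have "\<dots> = real (card X) * ln (real (r n) + 1) + ln (type_val E (M (r n)))"
        using type_val_pos[OF X(3), of "M (r n)"]
        by (subst ln_mult_pos) (auto simp: ln_realpow add.commute)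
      finally have "real (r n) * ln (val X E) / real (r n) \<le>
          (real (card X) * ln (real (r n) + 1) + ln (type_val E (M (r n)))) / real (r n)"
        by (rule divide_right_mono) simp
      then show ?case using elim by (simp add: add_divide_distrib)
    qed
  qed simp
  then show thesis using that[of l] l0 l1 by simp
qed

end

section \<open>Probabilistic values\<close>

definition near_types :: "'v set \<Rightarrow> ('v \<Rightarrow> real) \<Rightarrow> real \<Rightarrow> nat \<Rightarrow> 'v multiset set" where
  "near_types X p \<epsilon> n =
     {M. set_mset M \<subseteq> X \<and> size M = n \<and> (\<Sum>x\<in>X. \<bar>p x - real (count M x) / real n\<bar>) / 2 < \<epsilon>}"

text \<open>For positive \<open>n\<close>, the \<open>n\<close>-types are the empirical
  distributions of multisets of size \<open>n\<close>. At \<open>n = 0\<close> all frequencies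
  degenerate to 0, so this length is excluded, which does not affect a limsup.\<close>

lemma type_union_strings_tv_ball:
  assumes X: "finite X" and n: "0 < n"
  shows "type_union_strings X n (tv_ball X P \<epsilon>) =
    (\<Union>M\<in>near_types X (pmf P) \<epsilon> n. permutations_of_multiset M)" (is "?L = ?R")
proof
  show "?L \<subseteq> ?R"
  proof
    fix xs assume "xs \<in> ?L"
    then obtain Q where Q: "Q \<in> tv_ball X P \<epsilon>" and xs: "length xs = n" "set xs \<subseteq> X"
      and cnt: "\<And>x. x \<in> X \<Longrightarrow> real (count_list xs x) = real n * pmf Q x"
      by (auto simp: type_union_strings_def type_strings_def)
    have "(\<Sum>x\<in>X. \<bar>pmf P x - real (count (mset xs) x) / real n\<bar>) = (\<Sum>x\<in>X. \<bar>pmf P x - pmf Q x\<bar>)"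
      using n by (intro sum.cong refl) (simp add: count_mset cnt)
    with Q xs have "mset xs \<in> near_types X (pmf P) \<epsilon> n"
      by (simp add: near_types_def tv_ball_def tv_dist_def)
    then show "xs \<in> ?R" by (rule UN_I) (simp add: permutations_of_multisetI)
  qed
  show "?R \<subseteq> ?L"
  proof
    fix xs assume "xs \<in> ?R"
    then obtain M where "M \<in> near_types X (pmf P) \<epsilon> n" and "xs \<in> permutations_of_multiset M" by blast
    then have M: "set_mset M \<subseteq> X" "size M = n"
      "(\<Sum>x\<in>X. \<bar>pmf P x - real (count M x) / real n\<bar>) / 2 < \<epsilon>" and xs: "mset xs = M"
      by (simp_all add: near_types_def permutations_of_multiset_def)
    let ?Q = "pmf_of_multiset M"
    have "M \<noteq> {#}" using M n by auto
    then have Q: "pmf ?Q x = real (count M x) / real n" "set_pmf ?Q = set_mset M" for x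
      using M by simp_all
    have nQ: "real n * pmf ?Q x = real (count M x)" for x using n by (simp add: Q)
    have "?Q \<in> tv_ball X P \<epsilon>"
      using M by (simp add: tv_ball_def tv_dist_def distributions_def Q)
    moreover have "is_type X n ?Q"
      using M by (simp add: is_type_def distributions_def Q(2) nQ)
    moreover have "xs \<in> type_strings X n ?Q"
      using M xs by (auto simp: type_strings_def nQ simp flip: count_mset)
    ultimately show "xs \<in> ?L" by (auto simp: type_union_strings_def)
  qed
qed

lemma sum_pmf_distributions:
  assumes "finite X" "P \<in> distributions X"
  shows "(\<Sum>x\<in>X. pmf P x) = 1"
  using assms by (intro sum_pmf_eq_1) (auto simp: distributions_def)

lemma push_pmf:
  assumes "finite X" "P \<in> distributions X"
  shows "pmf (map_pmf \<phi> P) y = push \<phi> X (pmf P) y"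
proof -
  have "pmf (map_pmf \<phi> P) y = measure (measure_pmf P) (\<phi> -` {y} \<inter> set_pmf P)"
    by (simp add: pmf_map measure_Int_set_pmf)
  also have "\<phi> -` {y} \<inter> set_pmf P = {x \<in> X. \<phi> x = y} \<inter> set_pmf P"
    using assms by (auto simp: distributions_def)
  also have "measure (measure_pmf P) \<dots> = push \<phi> X (pmf P) y"
    using assms by (simp add: measure_Int_set_pmf measure_measure_pmf_finite push_def)
  finally show ?thesis .
qed

lemma map_pmf_distributions: "P \<in> distributions X \<Longrightarrow> \<phi> \<in> X \<rightarrow> Y \<Longrightarrow> map_pmf \<phi> P \<in> distributions Y"
  by (auto simp: distributions_def)

lemma shannon_entropy_eq:
  assumes "finite X" "P \<in> distributions X"
  shows "shannon_entropy P = - (\<Sum>x\<in>X. pmf P x * ln (pmf P x)) / ln 2"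
proof -
  have "(\<Sum>x\<in>set_pmf P. pmf P x * log 2 (pmf P x)) = (\<Sum>x\<in>X. pmf P x * log 2 (pmf P x))"
    using assms by (intro sum.mono_neutral_left) (auto simp: distributions_def set_pmf_iff)
  then show ?thesis by (simp add: shannon_entropy_def log_def sum_divide_distrib)
qed

text \<open>\<open>near_types\<close> asks for size exactly \<open>n\<close>, while floors fall
  short of it. Copies of one letter \<open>x0\<close> fill the gap; their share tends to 0 because
  the weights sum to 1.\<close>

lemma pad_floor_mset:
  assumes X: "finite X" and x0: "x0 \<in> X" and p: "\<And>x. x \<in> X \<Longrightarrow> 0 \<le> p x" and one: "(\<Sum>x\<in>X. p x) = 1"
  obtains M where "\<And>n. set_mset (M n) \<subseteq> X" "\<And>n. size (M n) = n"
    "\<And>x. x \<in> X \<Longrightarrow> (\<lambda>n. real (count (M n) x) / real n) \<longlonglongrightarrow> p x"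
proof
  let ?N = "floor_mset X p"
  let ?M = "\<lambda>n. ?N n + replicate_mset (n - size (?N n)) x0"
  have size: "size (?N n) \<le> n" for n
  proof -
    have "real (size (?N n)) \<le> (\<Sum>x\<in>X. real n * p x)"
      unfolding size_floor_mset[OF X] of_nat_sum using p by (intro sum_mono of_nat_floor) auto
    also have "\<dots> = real n" using one by (simp flip: sum_distrib_left)
    finally show ?thesis by simp
  qed
  show "set_mset (?M n) \<subseteq> X" for n using set_floor_mset[OF X, of p n] x0 by (auto split: if_splits)
  show "size (?M n) = n" for n using size[of n] by simp
  have sz: "(\<lambda>n. \<Sum>x\<in>X. real (count (?N n) x) / real n) \<longlonglongrightarrow> 1"
    unfolding one[symmetric] by (intro tendsto_sum count_floor_mset_tendsto X p)
  have "eventually (\<lambda>n. 1 - (\<Sum>x\<in>X. real (count (?N n) x) / real n) = real (n - size (?N n)) / real n) sequentially"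
    using eventually_gt_at_top[of 0]
  proof eventually_elim
    case (elim n)
    then show ?case
      using size[of n] size_eq_sum_count[OF X set_floor_mset[OF X, of p n]]
      by (simp add: of_nat_diff diff_divide_distrib flip: sum_divide_distrib)
  qed
  from Lim_transform_eventually[OF tendsto_diff[OF tendsto_const sz] this]
  have pad: "(\<lambda>n. real (n - size (?N n)) / real n) \<longlonglongrightarrow> 0" by simp
  fix x assume x: "x \<in> X"
  show "(\<lambda>n. real (count (?M n) x) / real n) \<longlonglongrightarrow> p x"
  proof (cases "x = x0")
    case True
    then show ?thesis
      using tendsto_add[OF count_floor_mset_tendsto[of X x p] pad] X x p by (simp add: add_divide_distrib)
  next
    case False
    then show ?thesis using count_floor_mset_tendsto[of X x p] X x p by simp
  qed
qed

section \<open>Identification of the probabilistic value with the exponent\<close>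

context spectral_point
begin

text \<open>The union has polynomially many type classes, and each type in a small ball differs from
  \<open>M n\<close> in few letters, so continuity bounds its value by that of
  \<open>M n\<close>.\<close>

lemma val_near_types_le:
  assumes X: "finite X" and E: "tolerance E" and "0 < \<theta>"
    and M: "\<And>n. set_mset (M n) \<subseteq> X" "\<And>n. size (M n) = n"
      "\<And>x. x \<in> X \<Longrightarrow> (\<lambda>n. real (count (M n) x) / real n) \<longlonglongrightarrow> p x"
  obtains \<delta> where "0 < \<delta>" "\<And>\<epsilon>. \<epsilon> < \<delta> \<Longrightarrow> eventually (\<lambda>n.
    val (\<Union>N\<in>near_types X p \<epsilon> n. permutations_of_multiset N) (list_all2 E) \<le>
      real (n + 1) ^ card X * (exp (\<theta> * real n) * type_val E (M n))) sequentially"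
proof -
  obtain \<delta> where \<delta>: "0 < \<delta>"
    "\<And>n K N. set_mset N \<subseteq> X \<Longrightarrow> real (size N) \<le> 1 * n \<Longrightarrow> real (size (N - K)) \<le> \<delta> * n \<Longrightarrow>
       ln (type_val E N) \<le> ln (type_val E K) + \<theta> * n"
    by (rule type_val_continuous[OF X E zero_less_one \<open>0 < \<theta>\<close>]) (rule that)
  show thesis
  \<comment> \<open>The distance in \<open>near_types\<close> is half the sum of absolute
    differences, so \<epsilon> below \<open>\<delta> / 4\<close> keeps that sum below
    \<open>\<delta> / 2\<close>; the other half is spent on the distance of \<open>M n\<close> from
    \<open>p\<close>.\<close>
  proof (rule that[of "\<delta> / 4"])
    show "0 < \<delta> / 4" using \<delta> by simp
    fix \<epsilon> assume \<epsilon>: "\<epsilon> < \<delta> / 4"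
    have "(\<lambda>n. \<Sum>x\<in>X. \<bar>p x - real (count (M n) x) / real n\<bar>) \<longlonglongrightarrow> (\<Sum>x\<in>X. \<bar>p x - p x\<bar>)"
      by (intro tendsto_sum tendsto_rabs tendsto_diff tendsto_const M)
    then have "eventually (\<lambda>n. (\<Sum>x\<in>X. \<bar>p x - real (count (M n) x) / real n\<bar>) < \<delta> / 2) sequentially"
      using \<delta> by (intro order_tendstoD(2)) auto
    then show "eventually (\<lambda>n. val (\<Union>N\<in>near_types X p \<epsilon> n. permutations_of_multiset N) (list_all2 E) \<le>
      real (n + 1) ^ card X * (exp (\<theta> * real n) * type_val E (M n))) sequentially"
      using eventually_gt_at_top[of 0]
    proof eventually_elim
      case (elim n)
      let ?T = "near_types X p \<epsilon> n"
      have sub: "?T \<subseteq> {M. set_mset M \<subseteq> X \<and> size M = n}" by (auto simp: near_types_def)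
      then have finT: "finite ?T" using finite_types[OF X] by (rule finite_subset)
      have le: "type_val E N \<le> exp (\<theta> * real n) * type_val E (M n)" if N: "N \<in> ?T" for N
      proof -
        have NX: "set_mset N \<subseteq> X" "size N = n" and tv: "(\<Sum>x\<in>X. \<bar>p x - real (count N x) / real n\<bar>) < \<delta> / 2"
          using N \<epsilon> by (auto simp: near_types_def)
        have "set_mset (N - M n) \<subseteq> X" using NX by (meson in_diffD subset_iff)
        then have "real (size (N - M n)) = (\<Sum>x\<in>X. real (count N x - count (M n) x))"
          by (simp add: size_eq_sum_count[OF X])
        also have "\<dots> \<le> (\<Sum>x\<in>X. real n * (\<bar>p x - real (count N x) / real n\<bar> + \<bar>p x - real (count (M n) x) / real n\<bar>))"
        proof (rule sum_mono)
          fix x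
          have "real (count N x - count (M n) x) \<le> \<bar>real (count N x) - real (count (M n) x)\<bar>" by linarith
          also have "\<dots> = real n * \<bar>real (count N x) / real n - real (count (M n) x) / real n\<bar>"
            using elim(2) by (simp add: abs_divide flip: diff_divide_distrib)
          also have "\<dots> \<le> real n * (\<bar>p x - real (count N x) / real n\<bar> + \<bar>p x - real (count (M n) x) / real n\<bar>)"
            by (intro mult_left_mono) linarith+
          finally show "real (count N x - count (M n) x) \<le> \<dots>" .
        qed
        also have "\<dots> = real n * ((\<Sum>x\<in>X. \<bar>p x - real (count N x) / real n\<bar>) + (\<Sum>x\<in>X. \<bar>p x - real (count (M n) x) / real n\<bar>))"
          by (simp add: sum_distrib_left sum.distrib distrib_left)
        also have "\<dots> \<le> real n * \<delta>"
          using tv elim(1) by (intro mult_left_mono) linarith+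
        finally have "ln (type_val E N) \<le> ln (type_val E (M n)) + \<theta> * real n"
          using NX by (intro \<delta>(2)) (auto simp: mult.commute)
        then have "exp (ln (type_val E N)) \<le> exp (ln (type_val E (M n)) + \<theta> * real n)" by simp
        then show ?thesis using type_val_pos[OF E] by (simp add: exp_add mult.commute)
      qed
      have "val (\<Union>N\<in>?T. permutations_of_multiset N) (list_all2 E) \<le> (\<Sum>N\<in>?T. type_val E N)"
        unfolding type_val_def using finT E by (intro val_UN tolerance_list_all2) auto
      also have "\<dots> \<le> real (card ?T) * (exp (\<theta> * real n) * type_val E (M n))"
        using le by (intro sum_bounded_above) auto
      also have "\<dots> \<le> real (n + 1) ^ card X * (exp (\<theta> * real n) * type_val E (M n))"
      proof (rule mult_right_mono)
        have "card ?T \<le> (n + 1) ^ card X"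
          using card_mono[OF finite_types[OF X] sub] card_types_le[OF X, of n] by linarith
        then show "real (card ?T) \<le> real (n + 1) ^ card X"
          by (metis of_nat_le_iff of_nat_power)
      qed (use type_val_pos[OF E, of "M n"] in simp)
      finally show ?case .
    qed
  qed
qed

lemma root_eq_exp: "0 < n \<Longrightarrow> 0 < x \<Longrightarrow> root n x = exp (ln x / real n)"
  by (simp add: root_powr_inverse powr_def field_simps)

text \<open>One sequence of types serves both bounds. It eventually lies in every ball, which gives
  the lower bound for each positive \<epsilon>; and in a small ball it controls all other types up
  to \<open>exp (\<theta> * n)\<close> and a polynomial factor, which the root removes.\<close>

lemma growth_rate_tendsto:
  assumes G: "pair_graph G" "pverts G \<noteq> {}" and P: "P \<in> distributions (pverts G)"
  shows "(growth_rate f G P \<longlongrightarrow> ereal (exp (exponent (adj_eq G) (pverts G) (pmf P)))) (at_right 0)"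
proof -
  let ?X = "pverts G" and ?E = "adj_eq G"
  let ?L = "exponent ?E ?X (pmf P)"
  have X: "finite ?X" using G(1) by (simp add: pair_graph_iff)
  have E: "tolerance ?E" using G(1) by (rule tolerance_adj_eq)
  let ?V = "\<lambda>\<epsilon> n. \<Union>M\<in>near_types ?X (pmf P) \<epsilon> n. permutations_of_multiset M"
  let ?u = "\<lambda>\<epsilon> n. val (?V \<epsilon> n) (list_all2 ?E)"
  have V_sub: "?V \<epsilon> n \<subseteq> {xs. length xs = n \<and> set xs \<subseteq> ?X}" for \<epsilon> n
    by (auto simp: near_types_def permutations_of_multiset_def)
  have finV: "finite (?V \<epsilon> n)" for \<epsilon> n
    by (rule finite_subset[OF V_sub]) (use finite_lists_length_eq[OF X, of n] in \<open>simp add: conj_commute\<close>)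
  have growth: "growth_rate f G P \<epsilon> = limsup (\<lambda>n. ereal (root n (?u \<epsilon> n)))" for \<epsilon>
    unfolding growth_rate_def
  proof (rule Limsup_eq)
    show "eventually (\<lambda>n. ereal (root n (f (iso_class (induced (strong_power G n)
        (type_union_strings ?X n (tv_ball ?X P \<epsilon>)))))) = ereal (root n (?u \<epsilon> n))) sequentially"
      using eventually_gt_at_top[of 0]
    proof eventually_elim
      case (elim n)
      show ?case unfolding type_union_strings_tv_ball[OF X elim] val_def
        by (simp only: induced_strong_power[OF G(1) V_sub])
    qed
  qed
  obtain x0 where x0: "x0 \<in> ?X" using G(2) by auto
  obtain M where M: "\<And>n. set_mset (M n) \<subseteq> ?X" "\<And>n. size (M n) = n"
    "\<And>x. x \<in> ?X \<Longrightarrow> (\<lambda>n. real (count (M n) x) / real n) \<longlonglongrightarrow> pmf P x"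
    using pad_floor_mset[OF X x0, of "pmf P"] sum_pmf_distributions[OF X P] by auto
  have limM: "(\<lambda>n. ln (type_val ?E (M n)) / real n) \<longlonglongrightarrow> ?L"
    by (rule type_val_tendsto_exponent[OF X E filterlim_ident _ M(1,3)]) auto
  have lower: "ereal (exp ?L) \<le> growth_rate f G P \<epsilon>" if "0 < \<epsilon>" for \<epsilon>
  proof -
    have "(\<lambda>n. (\<Sum>x\<in>?X. \<bar>pmf P x - real (count (M n) x) / real n\<bar>) / 2) \<longlonglongrightarrow> (\<Sum>x\<in>?X. \<bar>pmf P x - pmf P x\<bar>) / 2"
      by (intro tendsto_divide tendsto_sum tendsto_rabs tendsto_diff tendsto_const M) auto
    then have near: "eventually (\<lambda>n. (\<Sum>x\<in>?X. \<bar>pmf P x - real (count (M n) x) / real n\<bar>) / 2 < \<epsilon>) sequentially"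
      using that by (intro order_tendstoD(2)) auto
    have "(\<lambda>n. ereal (exp (ln (type_val ?E (M n)) / real n))) \<longlonglongrightarrow> ereal (exp ?L)"
      using limM by (intro tendsto_intros)
    then have "ereal (exp ?L) = limsup (\<lambda>n. ereal (exp (ln (type_val ?E (M n)) / real n)))"
      by (intro lim_imp_Limsup[symmetric]) auto
    also have "\<dots> \<le> growth_rate f G P \<epsilon>" unfolding growth
    proof (rule Limsup_mono)
      show "eventually (\<lambda>n. ereal (exp (ln (type_val ?E (M n)) / real n)) \<le> ereal (root n (?u \<epsilon> n))) sequentially"
        using near eventually_gt_at_top[of 0]
      proof eventually_elim
        case (elim n)
        have "M n \<in> near_types ?X (pmf P) \<epsilon> n" using M elim by (simp add: near_types_def)
        then have "type_val ?E (M n) \<le> ?u \<epsilon> n"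
          unfolding type_val_def using finV E by (intro val_mono tolerance_list_all2) auto
        then show ?case
          using elim type_val_pos[OF E, of "M n"] by (simp flip: root_eq_exp)
      qed
    qed
    finally show ?thesis .
  qed
  show ?thesis
  proof (rule order_tendstoI)
    fix a assume "a < ereal (exp ?L)"
    then show "eventually (\<lambda>\<epsilon>. a < growth_rate f G P \<epsilon>) (at_right 0)"
      using lower by (intro eventually_at_rightI[of 0 1]) (auto intro: less_le_trans)
  next
    fix a assume a: "ereal (exp ?L) < a"
    \<comment> \<open>A margin in the exponent that stays below \<open>a\<close>: half the gap to
      \<open>ln r\<close> for a finite bound \<open>r\<close>, and anything positive for an infinite
      one.\<close>
    obtain \<theta> where \<theta>: "0 < \<theta>" "ereal (exp (?L + \<theta>)) < a"
    proof (cases a)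
      case (real r)
      with a have r: "exp ?L < r" "0 < r" using order.strict_trans[OF exp_gt_zero, of ?L r] by auto
      then have "?L < ln r" by (subst ln_exp[symmetric], subst ln_less_cancel_iff) auto
      then have "exp (?L + (ln r - ?L) / 2) < exp (ln r)" by (simp add: field_simps)
      with \<open>?L < ln r\<close> show ?thesis
        using r real by (intro that[of "(ln r - ?L) / 2"]) auto
    next
      case PInf
      then show ?thesis by (intro that[of 1]) auto
    next
      case MInf
      then show ?thesis using a by simp
    qed
    obtain \<delta> where \<delta>: "0 < \<delta>" "\<And>\<epsilon>. \<epsilon> < \<delta> \<Longrightarrow> eventually (\<lambda>n. ?u \<epsilon> n \<le>
      real (n + 1) ^ card ?X * (exp (\<theta> * real n) * type_val ?E (M n))) sequentially"
      by (rule val_near_types_le[OF X E \<theta>(1) M]) (assumption, rule that)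
    have upper: "growth_rate f G P \<epsilon> \<le> ereal (exp (?L + \<theta>))" if "\<epsilon> < \<delta>" for \<epsilon>
    proof -
      let ?b = "\<lambda>n. real (card ?X) * (ln (1 * real n + 1) / real n) + \<theta> + ln (type_val ?E (M n)) / real n"
      have "?b \<longlonglongrightarrow> real (card ?X) * 0 + \<theta> + ?L"
        by (intro tendsto_add tendsto_mult tendsto_const ln_linear_over_n limM) auto
      from tendsto_ereal[OF tendsto_exp[OF this]]
      have "(\<lambda>n. ereal (exp (?b n))) \<longlonglongrightarrow> ereal (exp (?L + \<theta>))" by (simp add: add.commute)
      then have "limsup (\<lambda>n. ereal (exp (?b n))) = ereal (exp (?L + \<theta>))"
        by (intro lim_imp_Limsup) auto
      moreover have "growth_rate f G P \<epsilon> \<le> limsup (\<lambda>n. ereal (exp (?b n)))" unfolding growth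
      proof (rule Limsup_mono)
        show "eventually (\<lambda>n. ereal (root n (?u \<epsilon> n)) \<le> ereal (exp (?b n))) sequentially"
          using \<delta>(2)[OF that] eventually_gt_at_top[of 0]
        proof eventually_elim
          case (elim n)
          let ?B = "real (n + 1) ^ card ?X * (exp (\<theta> * real n) * type_val ?E (M n))"
          have pos: "0 < type_val ?E (M n)" "0 < real (n + 1) ^ card ?X" using type_val_pos[OF E] by auto
          have "root n (?u \<epsilon> n) \<le> root n ?B" using elim by simp
          also have "\<dots> = exp (ln ?B / real n)" using elim pos by (intro root_eq_exp mult_pos_pos) auto
          also have "ln ?B = real (card ?X) * ln (real n + 1) + (\<theta> * real n + ln (type_val ?E (M n)))"
            using pos by (simp add: ln_mult_pos ln_realpow add.commute)
          also have "\<dots> / real n = ?b n" using elim by (simp add: add_divide_distrib)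
          finally show ?case by simp
        qed
      qed
      ultimately show ?thesis by simp
    qed
    show "eventually (\<lambda>\<epsilon>. growth_rate f G P \<epsilon> < a) (at_right 0)"
      using \<delta>(1) upper \<theta>(2) by (intro eventually_at_rightI[of 0 \<delta>]) (auto intro: le_less_trans)
  qed
qed

lemma prob_value_eq:
  assumes "pair_graph G" "pverts G \<noteq> {}" "P \<in> distributions (pverts G)"
  shows "prob_value f G P = exp (exponent (adj_eq G) (pverts G) (pmf P))"
  unfolding prob_value_def using growth_rate_tendsto[OF assms]
  by (subst tendsto_Lim[of "at_right 0"]) auto

lemma log_prob_value_eq:
  assumes "pair_graph G" "pverts G \<noteq> {}" "P \<in> distributions (pverts G)"
  shows "log_prob_value f G P = exponent (adj_eq G) (pverts G) (pmf P) / ln 2"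
  by (simp add: log_prob_value_def prob_value_eq[OF assms] log_def)



section \<open>Properties of the logarithmic value\<close>

lemma log_prob_value_mono_hom:
  fixes G :: "'g pair_pre_digraph" and H :: "'h pair_pre_digraph"
  assumes G: "pair_graph G" "pverts G \<noteq> {}" and H: "pair_graph H" "pverts H \<noteq> {}"
    and \<phi>: "graph_hom \<phi> (complement H) (complement G)" and P: "P \<in> distributions (pverts H)"
  shows "log_prob_value f H P \<le> log_prob_value f G (map_pmf \<phi> P)"
proof -
  have map: "\<phi> \<in> pverts H \<rightarrow> pverts G" using \<phi> by (simp add: graph_hom_def complement_def)
  have X: "finite (pverts G)" "finite (pverts H)" using G H by (simp_all add: pair_graph_iff)
  note E = tolerance_adj_eq[OF G(1)] tolerance_adj_eq[OF H(1)]
  have "exponent (adj_eq H) (pverts H) (pmf P) \<le> exponent (adj_eq G) (pverts G) (push \<phi> (pverts H) (pmf P))"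
  proof (rule exponent_mono_map[OF X(2) E(2) X(1) E(1) _ map])
    fix u v assume "u \<in> pverts H" "v \<in> pverts H" "adj_eq G (\<phi> u) (\<phi> v)"
    then show "adj_eq H u v"
      using graph_hom_complement_rel_graph[of \<phi> "pverts H" "adj_eq H" "pverts G" "adj_eq G" u v] \<phi> E
      by (simp add: rel_graph_adj_eq G H)
  qed simp
  also have "push \<phi> (pverts H) (pmf P) = pmf (map_pmf \<phi> P)"
    by (intro ext push_pmf[OF X(2) P, symmetric])
  finally show ?thesis
    using log_prob_value_eq[OF H P] log_prob_value_eq[OF G map_pmf_distributions[OF P map]]
    by (simp add: divide_right_mono)
qed

text \<open>An isomorphism both preserves and reflects \<open>adj_eq\<close>, so the pushforward
  bounds hold in both directions.\<close>

lemma log_prob_value_isomorphic: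
  fixes G :: "'g pair_pre_digraph" and H :: "'h pair_pre_digraph"
  assumes "prob_graph G P" "prob_graph H Q" "prob_graph_isomorphic G P H Q"
  shows "log_prob_value f G P = log_prob_value f H Q"
proof -
  have G: "pair_graph G" "pverts G \<noteq> {}" "P \<in> distributions (pverts G)"
    and H: "pair_graph H" "pverts H \<noteq> {}" "Q \<in> distributions (pverts H)"
    using assms by (auto simp: prob_graph_def)
  obtain \<phi> where iso: "graph_isomorphism \<phi> G H" and Q: "map_pmf \<phi> P = Q"
    using assms(3) by (auto simp: prob_graph_isomorphic_def)
  have X: "finite (pverts G)" "finite (pverts H)" using G H by (simp_all add: pair_graph_iff)
  note E = tolerance_adj_eq[OF G(1)] tolerance_adj_eq[OF H(1)]
  have bij: "bij_betw \<phi> (pverts G) (pverts H)"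
    and arcs: "\<And>u v. u \<in> pverts G \<Longrightarrow> v \<in> pverts G \<Longrightarrow> (u, v) \<in> parcs G \<longleftrightarrow> (\<phi> u, \<phi> v) \<in> parcs H"
    using iso by (auto simp: graph_isomorphism_def)
  have map: "\<phi> \<in> pverts G \<rightarrow> pverts H" using bij by (auto simp: bij_betw_def)
  have adj: "adj_eq G u v \<longleftrightarrow> adj_eq H (\<phi> u) (\<phi> v)" if "u \<in> pverts G" "v \<in> pverts G" for u v
    using arcs[OF that] that bij by (auto simp: adj_eq_def bij_betw_def dest: inj_onD)
  have "exponent (adj_eq G) (pverts G) (pmf P) = exponent (adj_eq H) (pverts H) (push \<phi> (pverts G) (pmf P))"
    by (intro antisym exponent_mono_map[OF X(1) E(1) X(2) E(2) _ map]
        exponent_image_le[OF X(1) E(1) X(2) E(2) _ map]) (simp_all add: adj)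
  also have "push \<phi> (pverts G) (pmf P) = pmf Q"
    unfolding Q[symmetric] by (intro ext push_pmf[OF X(1) G(3), symmetric])
  finally show ?thesis by (simp add: log_prob_value_eq G H)
qed

lemma log_prob_value_concave:
  fixes G :: "'g pair_pre_digraph"
  assumes G: "pair_graph G" "pverts G \<noteq> {}" and P: "P \<in> distributions (pverts G)"
    and Q: "Q \<in> distributions (pverts G)" and t: "t \<in> {0..1}"
  shows "t * log_prob_value f G P + (1 - t) * log_prob_value f G Q \<le> log_prob_value f G (mix t P Q)"
proof -
  have X: "finite (pverts G)" using G by (simp add: pair_graph_iff)
  note E = tolerance_adj_eq[OF G(1)]
  let ?e = "exponent (adj_eq G) (pverts G)"
  have mix: "pmf (mix t P Q) = (\<lambda>x. t * pmf P x + (1 - t) * pmf Q x)"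
    using t by (intro ext pmf_mix) auto
  have D: "mix t P Q \<in> distributions (pverts G)"
    using P Q by (auto simp: distributions_def mix_def split: if_splits)
  have "t * ?e (pmf P) + (1 - t) * ?e (pmf Q) = ?e (\<lambda>x. t * pmf P x) + ?e (\<lambda>x. (1 - t) * pmf Q x)"
    using exponent_scale[OF X E, of "pmf P" t] exponent_scale[OF X E, of "pmf Q" "1 - t"] t by simp
  also have "\<dots> \<le> ?e (pmf (mix t P Q))"
    unfolding mix using t by (intro exponent_superadditive X E) auto
  finally have "(t * ?e (pmf P) + (1 - t) * ?e (pmf Q)) / ln 2 \<le> ?e (pmf (mix t P Q)) / ln 2"
    by (rule divide_right_mono) simp
  then show ?thesis
    by (simp add: log_prob_value_eq[OF G] P Q D add_divide_distrib)
qed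

lemma log_prob_value_strong_product:
  fixes G :: "'g pair_pre_digraph" and H :: "'h pair_pre_digraph"
  assumes G: "pair_graph G" "pverts G \<noteq> {}" and H: "pair_graph H" "pverts H \<noteq> {}"
    and P: "P \<in> distributions (pverts G \<times> pverts H)"
  shows "log_prob_value f (G \<boxtimes> H) P \<le> log_prob_value f G (map_pmf fst P) + log_prob_value f H (map_pmf snd P)"
    and "log_prob_value f G (map_pmf fst P) + log_prob_value f H (map_pmf snd P) \<le>
      log_prob_value f (G \<boxtimes> H) P + mutual_info P"
proof -
  let ?X = "pverts G" and ?Y = "pverts H" and ?E = "adj_eq G" and ?F = "adj_eq H"
  have X: "finite ?X" "finite ?Y" "finite (?X \<times> ?Y)" using G H by (simp_all add: pair_graph_iff)
  have E: "tolerance ?E" "tolerance ?F" "tolerance (rel_prod ?E ?F)" "tolerance (adj_eq (G \<boxtimes> H))"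
    using G H by (simp_all add: tolerance_adj_eq tolerance_rel_prod pair_graph_strong_product)
  have GH: "pair_graph (G \<boxtimes> H)" "pverts (G \<boxtimes> H) = ?X \<times> ?Y" "pverts (G \<boxtimes> H) \<noteq> {}"
    using G H by (simp_all add: pair_graph_strong_product) (simp_all add: strong_product_def)
  have push: "push fst (?X \<times> ?Y) (pmf P) = pmf (map_pmf fst P)" "push snd (?X \<times> ?Y) (pmf P) = pmf (map_pmf snd P)"
    by (intro ext push_pmf[OF X(3) P, symmetric])+
  have D: "map_pmf fst P \<in> distributions ?X" "map_pmf snd P \<in> distributions ?Y"
    by (rule map_pmf_distributions[OF P]; auto)+
  \<comment> \<open>The two relations agree only on the vertex set: two pairs with the same second
    component outside \<open>H\<close> can be related by \<open>rel_prod\<close> without being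
    adjacent in the product.\<close>
  have "exponent (adj_eq (G \<boxtimes> H)) (?X \<times> ?Y) (pmf P) = exponent (rel_prod ?E ?F) (?X \<times> ?Y) (pmf P)"
    using G H by (intro exponent_cong X E adj_eq_strong_product) auto
  then have val: "log_prob_value f (G \<boxtimes> H) P = exponent (rel_prod ?E ?F) (?X \<times> ?Y) (pmf P) / ln 2"
    using log_prob_value_eq[OF GH(1,3)] P by (simp add: GH(2))
  note ineq = exponent_prod[OF X(1) E(1) X(2) E(2) pmf_nonneg sum_pmf_distributions[OF X(3) P], unfolded push]
  note vals = val log_prob_value_eq[OF G D(1)] log_prob_value_eq[OF H D(2)]
  show "log_prob_value f (G \<boxtimes> H) P \<le> log_prob_value f G (map_pmf fst P) + log_prob_value f H (map_pmf snd P)"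
    unfolding vals add_divide_distrib[symmetric] using ineq(1) by (rule divide_right_mono) simp
  have "mutual_info P = ((\<Sum>z\<in>?X \<times> ?Y. pmf P z * ln (pmf P z)) - (\<Sum>x\<in>?X. pmf (map_pmf fst P) x * ln (pmf (map_pmf fst P) x))
      - (\<Sum>y\<in>?Y. pmf (map_pmf snd P) y * ln (pmf (map_pmf snd P) y))) / ln 2"
    unfolding mutual_info_def shannon_entropy_eq[OF X(3) P] shannon_entropy_eq[OF X(1) D(1)] shannon_entropy_eq[OF X(2) D(2)]
    by (simp add: diff_divide_distrib)
  then show "log_prob_value f G (map_pmf fst P) + log_prob_value f H (map_pmf snd P) \<le>
      log_prob_value f (G \<boxtimes> H) P + mutual_info P"
    unfolding vals add_divide_distrib[symmetric] using divide_right_mono[OF ineq(2), of "ln 2"]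
    by (simp add: add_divide_distrib)
qed

text \<open>On the two sides \<open>direct_sum\<close> has the weights \<open>t * P\<close> and
  \<open>(1 - t) * Q\<close>, to which \<open>exponent_sum\<close> applies as they stand;
  \<open>exponent_scale\<close> then extracts the factors. The endpoints are included because
  scaling by 0 is allowed and logarithms of 0 are 0.\<close>

lemma log_prob_value_disjoint_union:
  fixes G :: "'g pair_pre_digraph" and H :: "'h pair_pre_digraph"
  assumes G: "pair_graph G" "pverts G \<noteq> {}" and H: "pair_graph H" "pverts H \<noteq> {}"
    and P: "P \<in> distributions (pverts G)" and Q: "Q \<in> distributions (pverts H)" and t: "t \<in> {0..1}"
  shows "log_prob_value f (G \<squnion>\<^sub>G H) (direct_sum t P Q) =
    t * log_prob_value f G P + (1 - t) * log_prob_value f H Q + binary_entropy t"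
proof -
  let ?X = "pverts G" and ?Y = "pverts H" and ?E = "adj_eq G" and ?F = "adj_eq H"
  have X: "finite ?X" "finite ?Y" using G H by (simp_all add: pair_graph_iff)
  have E: "tolerance ?E" "tolerance ?F" using G H by (simp_all add: tolerance_adj_eq)
  have GH: "pair_graph (G \<squnion>\<^sub>G H)" "pverts (G \<squnion>\<^sub>G H) = ?X <+> ?Y" "pverts (G \<squnion>\<^sub>G H) \<noteq> {}"
    using G H by (simp_all add: pair_graph_disjoint_union) (simp_all add: disjoint_union_def)
  have D: "direct_sum t P Q \<in> distributions (?X <+> ?Y)"
    using P Q by (auto simp: distributions_def direct_sum_def mix_def split: if_splits)
  have pmf: "pmf (direct_sum t P Q) = case_sum (\<lambda>x. t * pmf P x) (\<lambda>y. (1 - t) * pmf Q y)"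
  proof
    fix z
    have "pmf (map_pmf Inr Q) (Inl x) = 0" "pmf (map_pmf Inl P) (Inr y) = 0" for x :: 'g and y :: 'h
      by (auto simp: pmf_eq_0_set_pmf)
    then show "pmf (direct_sum t P Q) z = case_sum (\<lambda>x. t * pmf P x) (\<lambda>y. (1 - t) * pmf Q y) z"
      using t by (cases z) (simp_all add: direct_sum_def pmf_mix pmf_map_inj')
  qed
  have sums: "(\<Sum>x\<in>?X. t * pmf P x) = t" "(\<Sum>y\<in>?Y. (1 - t) * pmf Q y) = 1 - t"
    by (simp_all add: sum_pmf_distributions[OF X(1) P] sum_pmf_distributions[OF X(2) Q] flip: sum_distrib_left)
  have "exponent (rel_sum ?E ?F) (?X <+> ?Y) (pmf (direct_sum t P Q)) =
      exponent ?E ?X (\<lambda>x. t * pmf P x) + exponent ?F ?Y (\<lambda>y. (1 - t) * pmf Q y) - t * ln t - (1 - t) * ln (1 - t)"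
    using exponent_sum[OF X(1) E(1) X(2) E(2), of "\<lambda>x. t * pmf P x" "\<lambda>y. (1 - t) * pmf Q y"] t
    unfolding pmf sums by simp
  also have "exponent ?E ?X (\<lambda>x. t * pmf P x) = t * exponent ?E ?X (pmf P)"
    using t by (intro exponent_scale X E) auto
  also have "exponent ?F ?Y (\<lambda>y. (1 - t) * pmf Q y) = (1 - t) * exponent ?F ?Y (pmf Q)"
    using t by (intro exponent_scale X E) auto
  finally have "log_prob_value f (G \<squnion>\<^sub>G H) (direct_sum t P Q) =
      (t * exponent ?E ?X (pmf P) + (1 - t) * exponent ?F ?Y (pmf Q) - t * ln t - (1 - t) * ln (1 - t)) / ln 2"
    using log_prob_value_eq[OF GH(1,3), of "direct_sum t P Q"] D by (simp add: GH(2) adj_eq_disjoint_union)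
  then show ?thesis
    by (simp add: log_prob_value_eq[OF G P] log_prob_value_eq[OF H Q] binary_entropy_def log_def
        add_divide_distrib diff_divide_distrib)
qed

lemma growth_rate_tendsto_prob_value:
  assumes "pair_graph G" "pverts G \<noteq> {}" "P \<in> distributions (pverts G)"
  shows "(growth_rate f G P \<longlongrightarrow> ereal (prob_value f G P)) (at_right 0)"
  using growth_rate_tendsto[OF assms] by (simp add: prob_value_eq[OF assms])

lemma prob_value_pos:
  assumes "pair_graph G" "pverts G \<noteq> {}" "P \<in> distributions (pverts G)"
  shows "0 < prob_value f G P"
  by (simp add: prob_value_eq[OF assms])

lemma f_eq_val: "pair_graph G \<Longrightarrow> f (iso_class G) = val (pverts G) (adj_eq G)"
  by (simp add: val_def rel_graph_adj_eq)

lemma prob_value_le: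
  fixes G :: "'g pair_pre_digraph"
  assumes G: "pair_graph G" "pverts G \<noteq> {}" and P: "P \<in> distributions (pverts G)"
  shows "prob_value f G P \<le> f (iso_class G)"
proof -
  have X: "finite (pverts G)" using G by (simp add: pair_graph_iff)
  note E = tolerance_adj_eq[OF G(1)]
  have "exponent (adj_eq G) (pverts G) (pmf P) \<le> ln (val (pverts G) (adj_eq G))"
    by (rule exponent_le[OF X G(2) E pmf_nonneg sum_pmf_distributions[OF X P]])
  then have "exp (exponent (adj_eq G) (pverts G) (pmf P)) \<le> exp (ln (val (pverts G) (adj_eq G)))" by simp
  then show ?thesis
    using val_ge_1[OF X E G(2)] by (simp add: prob_value_eq[OF G P] f_eq_val G)
qed

lemma prob_value_attained:
  fixes G :: "'g pair_pre_digraph"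
  assumes G: "pair_graph G" "pverts G \<noteq> {}"
  shows "\<exists>P\<in>distributions (pverts G). f (iso_class G) = prob_value f G P"
proof -
  have X: "finite (pverts G)" using G by (simp add: pair_graph_iff)
  note E = tolerance_adj_eq[OF G(1)]
  obtain p where p: "\<And>x. x \<in> pverts G \<Longrightarrow> 0 \<le> p x" "(\<Sum>x\<in>pverts G. p x) = 1"
    "ln (val (pverts G) (adj_eq G)) \<le> exponent (adj_eq G) (pverts G) p"
    by (rule exponent_max[OF X G(2) E]) (rule that)
  \<comment> \<open>The maximiser is controlled only on the vertices; extension by 0 makes it a
    density on the whole type, as \<open>embed_pmf\<close> requires, and places its support inside
    the vertex set.\<close>
  let ?p = "\<lambda>x. if x \<in> pverts G then p x else 0"
  define P where "P = embed_pmf ?p"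
  have "(\<integral>\<^sup>+ x. ennreal (?p x) \<partial>count_space UNIV) = (\<Sum>x\<in>pverts G. ennreal (p x))"
    using X by (subst nn_integral_count_space'[of "pverts G"]) (auto simp: p)
  also have "\<dots> = 1" using p by (subst sum_ennreal) auto
  finally have pmf: "pmf P x = ?p x" for x
    unfolding P_def by (intro pmf_embed_pmf) (auto simp: p)
  have P: "P \<in> distributions (pverts G)"
    by (auto simp: distributions_def set_pmf_iff pmf split: if_splits)
  have "exponent (adj_eq G) (pverts G) (pmf P) = exponent (adj_eq G) (pverts G) p"
    by (intro exponent_cong X E) (simp_all add: pmf)
  then have "exp (ln (val (pverts G) (adj_eq G))) \<le> prob_value f G P"
    using p(3) by (simp add: prob_value_eq[OF G P])
  then have "f (iso_class G) \<le> prob_value f G P"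
    using val_ge_1[OF X E G(2)] by (simp add: f_eq_val G)
  then show ?thesis using prob_value_le[OF G P] P by (intro bexI[of _ P] antisym)
qed

end

theorem theorem1p1:
  fixes f :: "nat pair_pre_digraph set \<Rightarrow> real"
  assumes "f \<in> asymptotic_spectrum"
  shows
    "(\<forall>(G :: 'a pair_pre_digraph) P. prob_graph G P \<longrightarrow>
        (growth_rate f G P \<longlongrightarrow> ereal (prob_value f G P)) (at_right 0) \<and>
        0 < prob_value f G P) \<and>
     (\<forall>(G :: 'a pair_pre_digraph) P (H :: 'b pair_pre_digraph) Q.
        prob_graph G P \<longrightarrow> prob_graph H Q \<longrightarrow> prob_graph_isomorphic G P H Q \<longrightarrow>
        log_prob_value f G P = log_prob_value f H Q) \<and>
     (\<forall>G :: 'a pair_pre_digraph. pair_graph G \<longrightarrow> pverts G \<noteq> {} \<longrightarrow>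
        (\<forall>P \<in> distributions (pverts G). \<forall>Q \<in> distributions (pverts G). \<forall>t \<in> {0..1}.
           t * log_prob_value f G P + (1 - t) * log_prob_value f G Q
             \<le> log_prob_value f G (mix t P Q))) \<and>
     (\<forall>(G :: 'a pair_pre_digraph) (H :: 'b pair_pre_digraph).
        pair_graph G \<longrightarrow> pverts G \<noteq> {} \<longrightarrow> pair_graph H \<longrightarrow> pverts H \<noteq> {} \<longrightarrow>
        (\<forall>P \<in> distributions (pverts G \<times> pverts H).
           log_prob_value f (G \<boxtimes> H) P
             \<le> log_prob_value f G (map_pmf fst P) + log_prob_value f H (map_pmf snd P) \<and>
           log_prob_value f G (map_pmf fst P) + log_prob_value f H (map_pmf snd P)
             \<le> log_prob_value f (G \<boxtimes> H) P + mutual_info P)) \<and>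
     (\<forall>(G :: 'a pair_pre_digraph) (H :: 'b pair_pre_digraph).
        pair_graph G \<longrightarrow> pverts G \<noteq> {} \<longrightarrow> pair_graph H \<longrightarrow> pverts H \<noteq> {} \<longrightarrow>
        (\<forall>P \<in> distributions (pverts G). \<forall>Q \<in> distributions (pverts H). \<forall>p \<in> {0..1}.
           log_prob_value f (G \<squnion>\<^sub>G H) (direct_sum p P Q)
             = p * log_prob_value f G P + (1 - p) * log_prob_value f H Q + binary_entropy p)) \<and>
     (\<forall>(G :: 'a pair_pre_digraph) (H :: 'b pair_pre_digraph) \<phi>.
        pair_graph G \<longrightarrow> pverts G \<noteq> {} \<longrightarrow> pair_graph H \<longrightarrow> pverts H \<noteq> {} \<longrightarrow>
        graph_hom \<phi> (complement H) (complement G) \<longrightarrow>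
        (\<forall>P \<in> distributions (pverts H).
           log_prob_value f H P \<le> log_prob_value f G (map_pmf \<phi> P))) \<and>
     (\<forall>G :: 'a pair_pre_digraph. pair_graph G \<longrightarrow> pverts G \<noteq> {} \<longrightarrow>
        (\<exists>P \<in> distributions (pverts G). f (iso_class G) = prob_value f G P) \<and>
        (\<forall>P \<in> distributions (pverts G). prob_value f G P \<le> f (iso_class G)))"
proof -
  interpret spectral_point f by unfold_locales fact
  show ?thesis
    by (intro conjI allI impI ballI)
       (simp_all add: prob_graph_def growth_rate_tendsto_prob_value prob_value_pos log_prob_value_isomorphic
         log_prob_value_concave log_prob_value_strong_product log_prob_value_disjoint_union
         log_prob_value_mono_hom prob_value_attained prob_value_le)
qed

end
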